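(* Let $(A,m)$ be an $A_\infty$-algebra over a field $K$ of characteristic zero and let $I\subset A$ be an $A_\infty$-ideal with $I_0=0$. Then the quotient map $(A,m)\to(A/I,m)$ induces an isomorphism $HP_\bullet(A,m)\to HP_\bullet(A/I,m)$.
   Context: $A=\bigoplus_{i\ge0}A_i$ nonnegatively graded, $A[1]_i=A_{i-1}$, Koszul signs. An $A_\infty$-algebra $(A,m)$ is a family $m_n:A^{\otimes n}\to A$ ($n\ge1$) of degree $n-2$ such that the unique degree $-1$ coderivation $b'_m$ of the tensor coalgebra $T^cA[1]=\bigoplus_{n\ge0}A[1]^{\otimes n}$ (deconcatenation coproduct) with $b'_m(1)=0$ and corestriction $\sum_nm_n$ satisfies $(b'_m)^2=0$. An $A_\infty$-ideal is a graded subspace $I=\bigoplus I_i\subset A$ such that for all $n\ge1$, $m_n(a_1,\dots,a_n)\in I$ whenever some $a_i\in I$; then $A/I=\bigoplus_iA_i/I_i$ carries the induced $A_\infty$-structure and the quotient map is a strict morphism (commutes with all $m_n$). Periodic cyclic homology: $C_n(A)=A[1]^{\otimes(n+1)}$, $\lambda(a_0,\dots,a_n)=(-1)^{\varepsilon}(a_n,a_0,\dots,a_{n-1})$, $\varepsilon=(|a_n|+1)(\sum_{i<n}|a_i|+n)$, $N=1+\lambda+\dots+\lambda^n$; $b'_m$ is the bar codifferential and $b_m=b'_m+$ (terms where some $m_i$ is applied to a cyclically consecutive block wrapping around from $a_n$ to $a_0$, result placed in position $0$, with Koszul sign). $CC(A,m)$ is the double complex with column $p\in\mathbb Z$ equal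 to $(C_\bullet(A),b_m)$ for $p$ even and $(C_\bullet(A),-b'_m)$ for $p$ odd, horizontal maps $1-\lambda$ (odd to even) and $N$ (even to odd); it is the X-complex of the DG coalgebra $(T^cA[1],b'_m)$. $HP_\bullet(A,m)$ is the homology of the direct-product total complex of $CC(A,m)$. *)

theory Defs
  imports Main "HOL-Library.Poly_Mapping"
begin

record ('k, 'v) ainf =
  acar  :: "'v set"
  azero :: 'v
  aadd  :: "'v \<Rightarrow> 'v \<Rightarrow> 'v"
  asmul :: "'k \<Rightarrow> 'v \<Rightarrow> 'v"
  acomp :: "nat \<Rightarrow> 'v set"
  amu   :: "nat \<Rightarrow> 'v list \<Rightarrow> 'v"

definition lsum :: "('k, 'v) ainf \<Rightarrow> 'v list \<Rightarrow> 'v" where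
  "lsum A xs = foldr (aadd A) xs (azero A)"

definition is_subspace :: "('k::field, 'v) ainf \<Rightarrow> 'v set \<Rightarrow> bool" where
  "is_subspace A S \<longleftrightarrow> S \<subseteq> acar A \<and> azero A \<in> S \<and>
     (\<forall>x\<in>S. \<forall>y\<in>S. aadd A x y \<in> S) \<and> (\<forall>k. \<forall>x\<in>S. asmul A k x \<in> S)"

definition vector_space_ax :: "('k::field, 'v) ainf \<Rightarrow> bool" where
  "vector_space_ax A \<longleftrightarrow>
     azero A \<in> acar A \<and>
     (\<forall>x\<in>acar A. \<forall>y\<in>acar A. aadd A x y \<in> acar A) \<and>
     (\<forall>k. \<forall>x\<in>acar A. asmul A k x \<in> acar A) \<and>
     (\<forall>x\<in>acar A. \<forall>y\<in>acar A. \<forall>z\<in>acar A. aadd A (aadd A x y) z = aadd A x (aadd A y z)) \<and>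
     (\<forall>x\<in>acar A. \<forall>y\<in>acar A. aadd A x y = aadd A y x) \<and>
     (\<forall>x\<in>acar A. aadd A (azero A) x = x) \<and>
     (\<forall>x\<in>acar A. \<exists>y\<in>acar A. aadd A x y = azero A) \<and>
     (\<forall>k. \<forall>x\<in>acar A. \<forall>y\<in>acar A. asmul A k (aadd A x y) = aadd A (asmul A k x) (asmul A k y)) \<and>
     (\<forall>k l. \<forall>x\<in>acar A. asmul A (k + l) x = aadd A (asmul A k x) (asmul A l x)) \<and>
     (\<forall>k l. \<forall>x\<in>acar A. asmul A (k * l) x = asmul A k (asmul A l x)) \<and>
     (\<forall>x\<in>acar A. asmul A 1 x = x)"

definition graded_vs :: "('k::field, 'v) ainf \<Rightarrow> bool" where
  "graded_vs A \<longleftrightarrow> vector_space_ax A \<and> (\<forall>i. is_subspace A (acomp A i)) \<and>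
     (\<forall>x\<in>acar A. \<exists>N c. (\<forall>i<N. c i \<in> acomp A i) \<and> x = lsum A (map c [0..<N])) \<and>
     (\<forall>N c. (\<forall>i<N. c i \<in> acomp A i) \<and> lsum A (map c [0..<N]) = azero A
             \<longrightarrow> (\<forall>i<N. c i = azero A))"

type_synonym 'v word = "(nat \<times> 'v) list"  \<comment> \<open>(degree, element) pairs\<close>

definition valid :: "('k, 'v) ainf \<Rightarrow> 'v word \<Rightarrow> bool" where
  "valid A w \<longleftrightarrow> (\<forall>(d, a) \<in> set w. a \<in> acomp A d)"

text \<open>Degree in the shifted space A[1]^{\<otimes> n}: sum of (|a_i| + 1).\<close>
definition sdeg :: "'v word \<Rightarrow> nat" where
  "sdeg w = sum_list (map (\<lambda>(d, a). d + 1) w)"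

definition gen :: "'v word \<Rightarrow> ('v word \<Rightarrow>\<^sub>0 'k::field)" where
  "gen w = Poly_Mapping.single w 1"

definition psc :: "'k::field \<Rightarrow> ('v word \<Rightarrow>\<^sub>0 'k) \<Rightarrow> ('v word \<Rightarrow>\<^sub>0 'k)" where
  "psc k p = Poly_Mapping.map (\<lambda>c. k * c) p"

definition lin :: "('v word \<Rightarrow> ('u word \<Rightarrow>\<^sub>0 'k::field)) \<Rightarrow> ('v word \<Rightarrow>\<^sub>0 'k) \<Rightarrow> ('u word \<Rightarrow>\<^sub>0 'k)" where
  "lin f p = (\<Sum>w\<in>Poly_Mapping.keys p. psc (Poly_Mapping.lookup p w) (f w))"

text \<open>The subspace of multilinearity relations; tensor powers are the quotient
  of the free space on valid words by it.\<close>
inductive_set trel :: "('k::field, 'v) ainf \<Rightarrow> ('v word \<Rightarrow>\<^sub>0 'k) set" for A where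
  trel_zero: "0 \<in> trel A"
| trel_add: "\<lbrakk>valid A us; valid A ws; a \<in> acomp A d; c \<in> acomp A d\<rbrakk> \<Longrightarrow>
     gen (us @ [(d, aadd A a c)] @ ws) - gen (us @ [(d, a)] @ ws) - gen (us @ [(d, c)] @ ws) \<in> trel A"
| trel_smul: "\<lbrakk>valid A us; valid A ws; a \<in> acomp A d\<rbrakk> \<Longrightarrow>
     gen (us @ [(d, asmul A k a)] @ ws) - psc k (gen (us @ [(d, a)] @ ws)) \<in> trel A"
| trel_plus: "\<lbrakk>p \<in> trel A; q \<in> trel A\<rbrakk> \<Longrightarrow> p + q \<in> trel A"
| trel_scal: "p \<in> trel A \<Longrightarrow> psc k p \<in> trel A"

text \<open>Term of the bar codifferential: m_j applied to the block of length j starting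
  at position i, with Koszul sign (-1)^(shifted degree of the first i letters).
  If the output degree is negative, the output lies in A_{<0} = 0.\<close>
definition bterm :: "('k::field, 'v) ainf \<Rightarrow> 'v word \<Rightarrow> nat \<Rightarrow> nat \<Rightarrow> ('v word \<Rightarrow>\<^sub>0 'k)" where
  "bterm A w i j =
     (let blk = take j (drop i w);
          e = int (sum_list (map fst blk)) + int j - 2
      in if e < 0 then 0
         else psc ((-1) ^ sdeg (take i w))
                (gen (take i w @ [(nat e, amu A j (map snd blk))] @ drop (i + j) w)))"

definition bprime_w :: "('k::field, 'v) ainf \<Rightarrow> 'v word \<Rightarrow> ('v word \<Rightarrow>\<^sub>0 'k)" where
  "bprime_w A w = (\<Sum>(i, j) \<in> {(i, j). 1 \<le> j \<and> i + j \<le> length w}. bterm A w i j)"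

definition bprime :: "('k::field, 'v) ainf \<Rightarrow> ('v word \<Rightarrow>\<^sub>0 'k) \<Rightarrow> ('v word \<Rightarrow>\<^sub>0 'k)" where
  "bprime A = lin (bprime_w A)"

definition multilinear_ops :: "('k::field, 'v) ainf \<Rightarrow> bool" where
  "multilinear_ops A \<longleftrightarrow>
     (\<forall>n\<ge>1. \<forall>xs. length xs = n \<and> set xs \<subseteq> acar A \<longrightarrow> amu A n xs \<in> acar A) \<and>
     (\<forall>n us ws x y. set us \<subseteq> acar A \<and> set ws \<subseteq> acar A \<and> x \<in> acar A \<and> y \<in> acar A \<and>
        length us + 1 + length ws = n \<longrightarrow>
        amu A n (us @ [aadd A x y] @ ws) = aadd A (amu A n (us @ [x] @ ws)) (amu A n (us @ [y] @ ws))) \<and>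
     (\<forall>n us ws x k. set us \<subseteq> acar A \<and> set ws \<subseteq> acar A \<and> x \<in> acar A \<and>
        length us + 1 + length ws = n \<longrightarrow>
        amu A n (us @ [asmul A k x] @ ws) = asmul A k (amu A n (us @ [x] @ ws)))"

definition degree_ops :: "('k::field, 'v) ainf \<Rightarrow> bool" where
  "degree_ops A \<longleftrightarrow>
     (\<forall>w. valid A w \<and> w \<noteq> [] \<longrightarrow>
        (let e = int (sum_list (map fst w)) + int (length w) - 2 in
          if e < 0 then amu A (length w) (map snd w) = azero A
          else amu A (length w) (map snd w) \<in> acomp A (nat e)))"

definition ainf_algebra :: "('k::field, 'v) ainf \<Rightarrow> bool" where
  "ainf_algebra A \<longleftrightarrow> graded_vs A \<and> multilinear_ops A \<and> degree_ops A \<and>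
     (\<forall>w. valid A w \<longrightarrow> bprime A (bprime_w A w) \<in> trel A)"

definition ainf_ideal :: "('k::field, 'v) ainf \<Rightarrow> 'v set \<Rightarrow> bool" where
  "ainf_ideal A I \<longleftrightarrow> is_subspace A I \<and>
     (\<forall>x\<in>I. \<forall>N c. (\<forall>i<N. c i \<in> acomp A i) \<and> x = lsum A (map c [0..<N]) \<longrightarrow> (\<forall>i<N. c i \<in> I)) \<and>
     (\<forall>n\<ge>1. \<forall>xs. length xs = n \<and> set xs \<subseteq> acar A \<and> (\<exists>x\<in>set xs. x \<in> I) \<longrightarrow> amu A n xs \<in> I)"

definition coset :: "('k, 'v) ainf \<Rightarrow> 'v set \<Rightarrow> 'v \<Rightarrow> 'v set" where
  "coset A I a = {aadd A a i | i. i \<in> I}"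

definition rep :: "'v set \<Rightarrow> 'v" where
  "rep X = (SOME x. x \<in> X)"

definition quot :: "('k, 'v) ainf \<Rightarrow> 'v set \<Rightarrow> ('k, 'v set) ainf" where
  "quot A I = \<lparr> acar = coset A I ` acar A,
                azero = coset A I (azero A),
                aadd = (\<lambda>X Y. coset A I (aadd A (rep X) (rep Y))),
                asmul = (\<lambda>k X. coset A I (asmul A k (rep X))),
                acomp = (\<lambda>i. coset A I ` acomp A i),
                amu = (\<lambda>n Xs. coset A I (amu A n (map rep Xs))) \<rparr>"

definition lam_w :: "'v word \<Rightarrow> ('v word \<Rightarrow>\<^sub>0 'k::field)" where
  "lam_w w = (if w = [] then 0
              else psc ((-1) ^ ((fst (last w) + 1) * sdeg (butlast w))) (gen (last w # butlast w)))"

definition N_w :: "'v word \<Rightarrow> ('v word \<Rightarrow>\<^sub>0 'k::field)" where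
  "N_w w = (\<Sum>k<length w. (lin lam_w ^^ k) (gen w))"

text \<open>Wrap-around terms of the Hochschild differential: m_{j+k+1} applied to
  (a_{n-j+1},...,a_n,a_0,...,a_k), result in position 0, Koszul sign of the
  cyclic rotation bringing the last j letters to the front.\<close>
definition wterm :: "('k::field, 'v) ainf \<Rightarrow> 'v word \<Rightarrow> nat \<Rightarrow> nat \<Rightarrow> ('v word \<Rightarrow>\<^sub>0 'k)" where
  "wterm A w j k =
     (let L = length w; tl_part = drop (L - j) w; hd_part = take (L - j) w;
          blk = tl_part @ take (k + 1) hd_part;
          e = int (sum_list (map fst blk)) + int (length blk) - 2
      in if e < 0 then 0
         else psc ((-1) ^ (sdeg tl_part * sdeg hd_part))
                (gen ((nat e, amu A (length blk) (map snd blk)) # drop (k + 1) hd_part)))"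

definition b_w :: "('k::field, 'v) ainf \<Rightarrow> 'v word \<Rightarrow> ('v word \<Rightarrow>\<^sub>0 'k)" where
  "b_w A w = bprime_w A w +
     (\<Sum>(j, k) \<in> {(j, k). 1 \<le> j \<and> j + k + 1 \<le> length w}. wterm A w j k)"

definition vdiff :: "('k::field, 'v) ainf \<Rightarrow> int \<Rightarrow> ('v word \<Rightarrow>\<^sub>0 'k) \<Rightarrow> ('v word \<Rightarrow>\<^sub>0 'k)" where
  "vdiff A p x = (if even p then lin (b_w A) x else - lin (bprime_w A) x)"

definition hdiff :: "int \<Rightarrow> ('v word \<Rightarrow>\<^sub>0 'k::field) \<Rightarrow> ('v word \<Rightarrow>\<^sub>0 'k)" where
  "hdiff p x = (if odd p then x - lin lam_w x else lin N_w x)"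

text \<open>Direct-product total complex in total degree t: families (x_p)_{p \<in> Z}
  with x_p \<in> C_\<bullet>(A) of internal degree t - p.\<close>
definition chains :: "('k::field, 'v) ainf \<Rightarrow> int \<Rightarrow> (int \<Rightarrow> ('v word \<Rightarrow>\<^sub>0 'k)) set" where
  "chains A t = {x. \<forall>p. \<forall>w\<in>Poly_Mapping.keys (x p). valid A w \<and> w \<noteq> [] \<and> int (sdeg w) = t - p}"

definition totdiff :: "('k::field, 'v) ainf \<Rightarrow> (int \<Rightarrow> ('v word \<Rightarrow>\<^sub>0 'k)) \<Rightarrow> (int \<Rightarrow> ('v word \<Rightarrow>\<^sub>0 'k))" where
  "totdiff A x = (\<lambda>p. vdiff A p (x p) + hdiff (p + 1) (x (p + 1)))"

text \<open>Everything is computed in the free space modulo the tensor relations trel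
  (componentwise), i.e. in the genuine tensor powers.\<close>
definition cycles :: "('k::field, 'v) ainf \<Rightarrow> int \<Rightarrow> (int \<Rightarrow> ('v word \<Rightarrow>\<^sub>0 'k)) set" where
  "cycles A t = {x \<in> chains A t. \<forall>p. totdiff A x p \<in> trel A}"

definition homologous :: "('k::field, 'v) ainf \<Rightarrow> int \<Rightarrow> ((int \<Rightarrow> ('v word \<Rightarrow>\<^sub>0 'k)) \<times> (int \<Rightarrow> ('v word \<Rightarrow>\<^sub>0 'k))) set" where
  "homologous A t = {(x, y). x \<in> cycles A t \<and> y \<in> cycles A t \<and>
      (\<exists>z\<in>chains A (t + 1). \<forall>p. x p - y p - totdiff A z p \<in> trel A)}"

definition HP :: "('k::field, 'v) ainf \<Rightarrow> int \<Rightarrow> (int \<Rightarrow> ('v word \<Rightarrow>\<^sub>0 'k)) set set" where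
  "HP A t = cycles A t // homologous A t"

definition word_map :: "('v \<Rightarrow> 'u) \<Rightarrow> 'v word \<Rightarrow> 'u word" where
  "word_map f w = map (\<lambda>(d, a). (d, f a)) w"

definition chain_map :: "('v \<Rightarrow> 'u) \<Rightarrow> (int \<Rightarrow> ('v word \<Rightarrow>\<^sub>0 'k::field)) \<Rightarrow> (int \<Rightarrow> ('u word \<Rightarrow>\<^sub>0 'k))" where
  "chain_map f x = (\<lambda>p. lin (\<lambda>w. gen (word_map f w)) (x p))"

definition HP_map :: "('k::field, 'u) ainf \<Rightarrow> int \<Rightarrow> ('v \<Rightarrow> 'u) \<Rightarrow> (int \<Rightarrow> ('v word \<Rightarrow>\<^sub>0 'k)) set \<Rightarrow> (int \<Rightarrow> ('u word \<Rightarrow>\<^sub>0 'k)) set" where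
  "HP_map B t f X = homologous B t `` {chain_map f (SOME x. x \<in> X)}"

end

theory Submission
  imports Defs
begin

text \<open>Goodwillie's argument for the vanishing of periodic cyclic homology in positive weight, carried over
  to \<open>A\<^sub>\<infinity>\<close>-algebras. Give the elements of \<open>I\<close> of degree \<open>d\<close> weight \<open>d - 1\<close>, those killed by \<open>m\<^sub>1\<close> weight \<open>d\<close>,
  and all other elements weight \<open>0\<close>. The resulting filtration of \<open>A\<close> is multiplicative for all \<open>m\<^sub>n\<close>, and the
  kernel of the map of chain complexes is its part of weight at least \<open>1\<close>, because \<open>I\<^sub>0 = 0\<close>. Over a field the
  filtration splits, which gives a linear operator \<open>D\<close> acting on weight \<open>k\<close> as \<open>k\<close> modulo higher weight;
  so, up to higher weight, \<open>D\<close> is a derivation. If \<open>D\<close> acts on the first letter only, then \<open>D N\<close> commutes with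
  the Hochschild differential up to higher weight, and the sum of the conjugates of \<open>D\<close> under rotation
  is \<open>k\<close> on weight \<open>k\<close>. Together with the exactness of the rows (characteristic zero) this bounds every
  cycle of weight \<open>k \<ge> 1\<close> up to higher weight. A word of weight \<open>k\<close> has degree at least \<open>k\<close>, so in each
  degree the iteration is finite and it converges in the direct-product total complex.\<close>

section \<open>Free modules on words, linear operators and signed rotations\<close>

text \<open>The weight is a derivation on the graded pieces of the filtration, and in characteristic
  zero a derivation acts as zero on periodic cyclic homology; as it acts on weight \<open>k\<close>
  as the scalar \<open>k\<close>, every piece with \<open>k \<ge> 1\<close> is acyclic. The linear
  splitting need not respect the operations, so all statements about \<open>D\<close> are
  congruences modulo the next weight. The weight has to be at least 1 on all of \<open>I\<close> and
  at most the degree. The degree itself fails because \<open>m\<^sub>1\<close> lowers it. Lowering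
  the weight by one on the elements of \<open>I\<close> that are not cycles repairs this, since the
  values of \<open>m\<^sub>1\<close> are cycles again. Signs are confined to one device: a term of
  either differential is the operation on an initial block, \<open>front\<close>, composed with
  signed rotations \<open>rot\<close>. The rotations form an action of the integers, so the
  classical identities between the differentials, \<open>N\<close> and \<open>1 - \<lambda>\<close>
  become reindexings of sums over positions. They hold already for formal combinations of words;
  only the squares of the differentials need the relations \<open>trel\<close>.\<close>

type_synonym ('v, 'k) chain = "'v word \<Rightarrow>\<^sub>0 'k"

lemma lookup_psc [simp]: "Poly_Mapping.lookup (psc k p) w = k * Poly_Mapping.lookup p w"
  by (simp add: psc_def Poly_Mapping.map.rep_eq when_def)

lemma psc_add: "psc k (p + q) = psc k p + psc k q"
  by (rule poly_mapping_eqI) (simp add: lookup_add algebra_simps)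

lemma psc_add_left: "psc (k + l) p = psc k p + psc l p"
  by (rule poly_mapping_eqI) (simp add: lookup_add algebra_simps)

lemma psc_psc [simp]: "psc k (psc l p) = psc (k * l) p"
  by (rule poly_mapping_eqI) (simp add: algebra_simps)

lemma psc_one [simp]: "psc 1 p = p"
  by (rule poly_mapping_eqI) simp

lemma psc_zero_left [simp]: "psc 0 p = 0"
  by (rule poly_mapping_eqI) simp

lemma psc_zero [simp]: "psc k 0 = 0"
  by (rule poly_mapping_eqI) simp

lemma psc_minus_left: "psc (- k) p = - psc k p"
  by (rule poly_mapping_eqI) simp

lemma psc_minus: "psc k (- p) = - psc k p"
  by (rule poly_mapping_eqI) simp

lemma psc_diff: "psc k (p - q) = psc k p - psc k q"
  by (rule poly_mapping_eqI) (simp add: lookup_minus algebra_simps)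

lemma psc_sum: "psc k (sum f S) = (\<Sum>i\<in>S. psc k (f i))"
  by (induction S rule: infinite_finite_induct) (simp_all add: psc_add)

lemma psc_sum_left: "psc (sum f S) p = (\<Sum>i\<in>S. psc (f i) p)"
  by (induction S rule: infinite_finite_induct) (simp_all add: psc_add_left)

lemma psc_of_nat: "psc (of_nat n) p = (\<Sum>i<n. p)"
  by (induction n) (simp_all add: psc_add_left add.commute)

lemma gen_expand: "p = (\<Sum>w\<in>Poly_Mapping.keys p. psc (Poly_Mapping.lookup p w) (gen w))"
proof (rule poly_mapping_eqI)
  fix v
  have "(\<Sum>w\<in>Poly_Mapping.keys p. Poly_Mapping.lookup p w * (1 when w = v)) =
      (\<Sum>w\<in>Poly_Mapping.keys p. if w = v then Poly_Mapping.lookup p v else 0)"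
    by (rule sum.cong) (auto simp: when_def)
  also have "\<dots> = Poly_Mapping.lookup p v"
    by (simp add: sum.delta in_keys_iff)
  finally show "Poly_Mapping.lookup p v = Poly_Mapping.lookup (\<Sum>w\<in>Poly_Mapping.keys p. psc (Poly_Mapping.lookup p w) (gen w)) v"
    by (simp add: lookup_sum gen_def lookup_single)
qed

lemma keys_gen [simp]: "Poly_Mapping.keys (gen w :: ('v, 'k::field) chain) = {w}"
  by (simp add: gen_def)

lemma keys_psc: "Poly_Mapping.keys (psc k p) \<subseteq> Poly_Mapping.keys p"
  by (auto simp: in_keys_iff)

section \<open>Linear maps and subspaces of chains\<close>

definition lmap :: "(('v, 'k::field) chain \<Rightarrow> ('u word \<Rightarrow>\<^sub>0 'k)) \<Rightarrow> bool" where
  "lmap f \<longleftrightarrow> (\<forall>x y. f (x + y) = f x + f y) \<and> (\<forall>k x. f (psc k x) = psc k (f x))"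

named_theorems lmap_intros

lemma lmapI: "(\<And>x y. f (x + y) = f x + f y) \<Longrightarrow> (\<And>k x. f (psc k x) = psc k (f x)) \<Longrightarrow> lmap f"
  by (simp add: lmap_def)

lemma lmap_add: "lmap f \<Longrightarrow> f (x + y) = f x + f y"
  and lmap_psc: "lmap f \<Longrightarrow> f (psc k x) = psc k (f x)"
  by (simp_all add: lmap_def)

lemma lmap_0: "lmap f \<Longrightarrow> f 0 = 0"
  using lmap_psc[of f 0 0] by simp

lemma lmap_minus: "lmap f \<Longrightarrow> f (- x) = - f x"
  using lmap_psc[of f "-1" x] by (simp add: psc_minus_left)

lemma lmap_diff: "lmap f \<Longrightarrow> f (x - y) = f x - f y"
  using lmap_add[of f x "- y"] by (simp add: lmap_minus)

lemma lmap_sum: "lmap f \<Longrightarrow> f (sum g S) = (\<Sum>i\<in>S. f (g i))"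
  by (induction S rule: infinite_finite_induct) (simp_all add: lmap_0 lmap_add)

lemmas lmap_simps = lmap_add lmap_psc lmap_0 lmap_minus lmap_diff lmap_sum

lemma lmap_lin [lmap_intros]: "lmap (lin f)"
proof (rule lmapI)
  have expand: "lin f p = (\<Sum>w\<in>S. psc (Poly_Mapping.lookup p w) (f w))"
    if "finite S" "Poly_Mapping.keys p \<subseteq> S" for p S
    unfolding lin_def using that by (intro sum.mono_neutral_left) (auto simp: in_keys_iff)
  fix x y :: "'a word \<Rightarrow>\<^sub>0 'b" and k
  let ?S = "Poly_Mapping.keys x \<union> Poly_Mapping.keys y"
  have "Poly_Mapping.keys (x + y) \<subseteq> ?S"
    by (rule Poly_Mapping.keys_add)
  then show "lin f (x + y) = lin f x + lin f y"
    by (simp add: expand[of ?S] lookup_add psc_add_left sum.distrib)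
  show "lin f (psc k x) = psc k (lin f x)"
    using keys_psc[of k x] by (simp add: expand[of "Poly_Mapping.keys x"] psc_sum)
qed

lemma lin_gen [simp]: "lin f (gen w) = f w"
  by (simp add: lin_def gen_def)

lemma lmap_compose: "lmap f \<Longrightarrow> lmap g \<Longrightarrow> lmap (\<lambda>x. f (g x))"
  by (simp add: lmap_def)

lemma lmap_expand: "lmap f \<Longrightarrow> f p = (\<Sum>w\<in>Poly_Mapping.keys p. psc (Poly_Mapping.lookup p w) (f (gen w)))"
  by (subst gen_expand[of p]) (simp only: lmap_sum lmap_psc)

lemma lmap_eqI:
  assumes "lmap f" "lmap g" "\<And>w. w \<in> Poly_Mapping.keys p \<Longrightarrow> f (gen w) = g (gen w)"
  shows "f p = g p"
  by (simp add: lmap_expand[OF assms(1), of p] lmap_expand[OF assms(2), of p] assms(3))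

lemma lmap_id [lmap_intros]: "lmap (\<lambda>x. x)"
  and lmap_zero [lmap_intros]: "lmap (\<lambda>x. 0)"
  by (simp_all add: lmap_def)

lemma lmap_comb [lmap_intros]:
  assumes "lmap f"
  shows "lmap g \<Longrightarrow> lmap (\<lambda>x. f x + g x)"
    and "lmap g \<Longrightarrow> lmap (\<lambda>x. f x - g x)"
    and "lmap (\<lambda>x. - f x)"
    and "lmap (\<lambda>x. psc k (f x))"
    and "lmap (\<lambda>x. lin h (f x))"
  using assms lmap_lin[of h] by (simp_all add: lmap_def psc_add psc_diff psc_minus mult.commute)

lemma lmap_setsum [lmap_intros]: "(\<And>i. i \<in> S \<Longrightarrow> lmap (f i)) \<Longrightarrow> lmap (\<lambda>x. \<Sum>i\<in>S. f i x)"
  by (simp add: lmap_def sum.distrib psc_sum)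

definition lspace :: "('v, 'k::field) chain set \<Rightarrow> bool" where
  "lspace S \<longleftrightarrow> 0 \<in> S \<and> (\<forall>x\<in>S. \<forall>y\<in>S. x + y \<in> S) \<and> (\<forall>k. \<forall>x\<in>S. psc k x \<in> S)"

lemma lspaceI: "0 \<in> S \<Longrightarrow> (\<And>x y. x \<in> S \<Longrightarrow> y \<in> S \<Longrightarrow> x + y \<in> S) \<Longrightarrow> (\<And>k x. x \<in> S \<Longrightarrow> psc k x \<in> S) \<Longrightarrow> lspace S"
  by (simp add: lspace_def)

lemma lspace_0: "lspace S \<Longrightarrow> 0 \<in> S"
  and lspace_add: "lspace S \<Longrightarrow> x \<in> S \<Longrightarrow> y \<in> S \<Longrightarrow> x + y \<in> S"
  and lspace_psc: "lspace S \<Longrightarrow> x \<in> S \<Longrightarrow> psc k x \<in> S"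
  by (simp_all add: lspace_def)

lemma lspace_minus: "lspace S \<Longrightarrow> x \<in> S \<Longrightarrow> - x \<in> S"
  using lspace_psc[of S x "-1"] by (simp add: psc_minus_left)

lemma lspace_diff: "lspace S \<Longrightarrow> x \<in> S \<Longrightarrow> y \<in> S \<Longrightarrow> x - y \<in> S"
  using lspace_add[of S x "- y"] by (simp add: lspace_minus)

lemma lspace_sum: "lspace S \<Longrightarrow> (\<And>i. i \<in> T \<Longrightarrow> f i \<in> S) \<Longrightarrow> sum f T \<in> S"
  by (induction T rule: infinite_finite_induct) (simp_all add: lspace_0 lspace_add)

lemma lspace_diff_iff: "lspace S \<Longrightarrow> x - y \<in> S \<Longrightarrow> x \<in> S \<longleftrightarrow> y \<in> S"
  using lspace_add[of S "x - y" y] lspace_diff[of S x "x - y"] by auto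

lemma lspace_lmap_keys:
  assumes "lspace S" "lmap f" "\<And>w. w \<in> Poly_Mapping.keys p \<Longrightarrow> f (gen w) \<in> S"
  shows "f p \<in> S"
  by (subst lmap_expand[OF assms(2)]) (intro lspace_sum lspace_psc assms(1,3))

lemma lspace_trel: "lspace (trel A)"
  by (intro lspaceI trel.intros)

lemma lspace_keys: "lspace {x :: ('v, 'k::field) chain. Poly_Mapping.keys x \<subseteq> W}"
proof (rule lspaceI)
  fix x y :: "('v, 'k) chain" assume "x \<in> {x. Poly_Mapping.keys x \<subseteq> W}" "y \<in> {x. Poly_Mapping.keys x \<subseteq> W}"
  then show "x + y \<in> {x. Poly_Mapping.keys x \<subseteq> W}"
    using Poly_Mapping.keys_add[of x y] by blast
next
  fix k and x :: "('v, 'k) chain" assume "x \<in> {x. Poly_Mapping.keys x \<subseteq> W}"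
  then show "psc k x \<in> {x. Poly_Mapping.keys x \<subseteq> W}"
    using keys_psc[of k x] by blast
qed simp

text \<open>\<open>rot z\<close> is the power \<open>\<lambda>\<^sup>-\<^sup>z\<close> of the signed cyclic rotation (on the empty word it is the identity, whereas
  \<open>lam_w [] = 0\<close>).\<close>

definition rot_w :: "int \<Rightarrow> 'v word \<Rightarrow> ('v, 'k::field) chain" where
  "rot_w z w = (let m = nat (z mod int (length w)) in
     psc ((-1) ^ (sdeg (take m w) * sdeg (drop m w))) (gen (drop m w @ take m w)))"

definition rot :: "int \<Rightarrow> ('v, 'k::field) chain \<Rightarrow> ('v, 'k) chain" where
  "rot z = lin (rot_w z)"

lemma sdeg_simps [simp]: "sdeg [] = 0" "sdeg (x # w) = fst x + 1 + sdeg w" "sdeg (u @ v) = sdeg u + sdeg v"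
  by (simp_all add: sdeg_def split: prod.splits)

lemma lmap_rot [lmap_intros]: "lmap (rot z)"
  unfolding rot_def by (rule lmap_lin)

lemmas rot_simps = lmap_simps[OF lmap_rot]

lemma rot_gen: "rot z (gen w) = rot_w z w"
  by (simp add: rot_def)

lemma minus_one_power_cong: "even (m + n) \<Longrightarrow> (- 1 :: 'k::field) ^ m = (- 1) ^ n"
  by (metis even_add neg_one_even_power neg_one_odd_power)

lemma rot_app: "rot (int (length u)) (gen (u @ v)) = psc ((-1) ^ (sdeg u * sdeg v)) (gen (v @ u))"
  by (cases "v = []") (simp_all add: rot_gen rot_w_def)

lemma rot_periodic: "z mod int (length w) = z' mod int (length w) \<Longrightarrow> rot z (gen w) = rot z' (gen w)"
  by (simp add: rot_gen rot_w_def)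

lemma rot_0 [simp]: "rot 0 x = (x :: ('v, 'k::field) chain)"
proof -
  have *: "rot 0 (gen w :: ('v, 'k) chain) = gen w" for w
    by (simp add: rot_gen rot_w_def)
  show ?thesis
    by (rule lmap_eqI[OF lmap_rot lmap_id]) (rule *)
qed

text \<open>The sign exponent of a cyclic shift is the product of the shifted degrees of the two
  parts, hence bilinear. With the word cut into three pieces, the exponents of the two shifts and of
  their composite agree modulo 2.\<close>

lemma rot_rot_gen:
  assumes "w \<noteq> []" shows "rot a (rot b (gen w)) = rot (a + b) (gen w :: ('v, 'k::field) chain)"
proof -
  define L where "L = length w"
  define m where "m = nat (b mod int L)"
  define n where "n = nat (a mod int L)"
  have L: "L > 0" using assms by (simp add: L_def)
  have mL: "m < L" and nL: "n < L" using L by (simp_all add: m_def n_def nat_less_iff)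
  have bm: "int m = b mod int L" and an: "int n = a mod int L"
    using L by (simp_all add: m_def n_def)
  have 1: "rot b (gen w :: ('v, 'k) chain) = psc ((-1) ^ (sdeg (take m w) * sdeg (drop m w))) (gen (drop m w @ take m w))"
    by (simp add: rot_gen rot_w_def m_def L_def Let_def)
  have 2: "rot a (gen (drop m w @ take m w) :: ('v, 'k) chain) = rot (int n) (gen (drop m w @ take m w))"
    using mL by (intro rot_periodic) (simp add: an L_def)
  have ab: "(a + b) mod int L = (int m + int n) mod int L"
    by (simp add: bm an mod_simps add.commute)
  show ?thesis
  proof (cases "m + n < L")
    case True
    define u v t where "u = take m w" and "v = take n (drop m w)" and "t = drop n (drop m w)"
    have w: "w = u @ v @ t" "take m w = u" "drop m w = v @ t" by (simp_all add: u_def v_def t_def del: drop_drop)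
    have lu: "length u = m" and lv: "length v = n" using True by (simp_all add: u_def v_def L_def)
    have 3: "rot (a + b) (gen w :: ('v, 'k) chain) = rot (int (length (u @ v))) (gen ((u @ v) @ t))"
      unfolding w(1) append_assoc using ab w(1) by (intro rot_periodic) (simp add: lu lv L_def)
    show ?thesis
      unfolding 1 3 rot_app rot_simps 2 unfolding w(2,3) lv[symmetric] append_assoc rot_app psc_psc power_add[symmetric]
      by (intro arg_cong2[where f=psc] minus_one_power_cong) (auto simp: ring_distribs)
  next
    case False
    \<comment> \<open>The combined shift passes the end of the word, so it amounts to a shift by
      \<open>m + n - L\<close>.\<close>
    define k where "k = m + n - L"
    define u v t where "u = take k w" and "v = drop k (take m w)" and "t = drop m w"
    have km: "k \<le> m" using nL by (simp add: k_def)
    have "u = take k (take m w)" using km by (simp add: u_def)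
    then have uv: "u @ v = take m w" by (simp only: v_def append_take_drop_id)
    have w: "w = u @ v @ t" "take m w = u @ v" "drop m w = t" by (simp_all add: uv t_def flip: append_assoc)
    have lu: "length u = k" and lt: "length (t @ u) = n"
      using km mL False by (simp_all add: u_def t_def L_def k_def)
    have "(int m + int n) mod int L = int k mod int L"
      using False by (simp add: k_def of_nat_diff)
    then have 3: "rot (a + b) (gen w :: ('v, 'k) chain) = rot (int (length u)) (gen (u @ (v @ t)))"
      unfolding w(1) using ab w(1) by (intro rot_periodic) (simp add: lu L_def)
    have 4: "t @ u @ v = (t @ u) @ v" by simp
    show ?thesis
      unfolding 1 3 rot_app rot_simps 2 unfolding w(2,3) lt[symmetric] 4 rot_app psc_psc power_add[symmetric]
      by (intro arg_cong2[where f=psc] minus_one_power_cong) (auto simp: ring_distribs)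
  qed
qed

lemma rot_Nil [simp]: "rot z (gen []) = gen []"
  by (simp add: rot_gen rot_w_def)

lemma rot_rot: "rot a (rot b x) = rot (a + b) (x :: ('v, 'k::field) chain)"
proof (rule lmap_eqI[of "\<lambda>x. rot a (rot b x)" "rot (a + b)"])
  show "rot a (rot b (gen w)) = rot (a + b) (gen w :: ('v, 'k) chain)" for w :: "'v word"
    by (cases "w = []") (simp_all add: rot_rot_gen)
qed (rule lmapI; simp add: rot_simps)+

text \<open>Rotation has no common period on chains of mixed length. Formulas that sum over
  positions are therefore proved for a fixed length and extended by linearity.\<close>

definition hom :: "nat \<Rightarrow> ('v, 'k::field) chain set" where
  "hom L = {x. \<forall>w\<in>Poly_Mapping.keys x. length w = L}"

lemma lspace_hom: "lspace (hom L)"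
  using lspace_keys[of "{w. length w = L}"] by (simp add: hom_def subset_eq)

lemma gen_hom [simp]: "gen w \<in> hom L \<longleftrightarrow> length w = L"
  by (simp add: hom_def)

lemma psc_hom: "x \<in> hom L \<Longrightarrow> psc k x \<in> hom L"
  by (rule lspace_psc[OF lspace_hom])

lemma hom_lmapI: "x \<in> hom L \<Longrightarrow> lmap f \<Longrightarrow> (\<And>w. length w = L \<Longrightarrow> f (gen w) \<in> S) \<Longrightarrow> lspace S \<Longrightarrow> f x \<in> S"
  by (rule lspace_lmap_keys) (auto simp: hom_def)

lemma rot_hom: "x \<in> hom L \<Longrightarrow> rot z x \<in> hom L"
  by (erule hom_lmapI[OF _ lmap_rot]) (simp_all add: rot_gen rot_w_def Let_def lspace_hom psc_hom)

lemma hom_eqI: "x \<in> hom L \<Longrightarrow> lmap f \<Longrightarrow> lmap g \<Longrightarrow> (\<And>w. length w = L \<Longrightarrow> f (gen w) = g (gen w)) \<Longrightarrow> f x = g x"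
  by (rule lmap_eqI) (auto simp: hom_def)

lemma rot_hom_periodic: "x \<in> hom L \<Longrightarrow> z mod int L = z' mod int L \<Longrightarrow> rot z x = rot z' x"
  by (erule hom_eqI[OF _ lmap_rot lmap_rot]) (rule rot_periodic, simp)

lemma lam_w_eq: "w \<noteq> [] \<Longrightarrow> lam_w w = rot (- 1) (gen w)"
proof -
  assume w: "w \<noteq> []"
  have "nat (- 1 mod int (length w)) = length w - 1"
    using w by (simp add: zmod_minus1 nat_diff_distrib del: One_nat_def)
  moreover have "drop (length w - 1) w = [last w]"
    using w by (metis append_butlast_last_id append_eq_conv_conj length_butlast)
  ultimately show ?thesis
    using w by (cases "last w") (simp add: lam_w_def rot_gen rot_w_def butlast_conv_take mult.commute Let_def)
qed

section \<open>The differentials in terms of rotations\<close>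

lemma sum_periodic:
  fixes g :: "int \<Rightarrow> 'a::ab_group_add"
  assumes g: "\<And>s. g (s + int L) = g s"
  shows "(\<Sum>s\<in>{a..<a + int L}. g s) = (\<Sum>s\<in>{0..<int L}. g s)"
proof (cases "L = 0")
  case False
  have step: "(\<Sum>s\<in>{a + 1..<a + 1 + int L}. g s) = (\<Sum>s\<in>{a..<a + int L}. g s)" for a
  proof -
    have "{a + 1..<a + 1 + int L} = insert (a + int L) {a + 1..<a + int L}"
      and "{a..<a + int L} = insert a {a + 1..<a + int L}"
      using False by auto
    then show ?thesis by (simp add: g)
  qed
  show ?thesis
  proof (induction a rule: int_induct[where k = 0])
    case (step1 i) then show ?case using step[of i] by simp
  next
    case (step2 i) then show ?case using step[of "i - 1"] by simp
  qed simp
qed simp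

lemma sum_periodic_shift:
  fixes g :: "int \<Rightarrow> 'a::ab_group_add"
  assumes g: "\<And>s. g (s + int L) = g s"
  shows "(\<Sum>s\<in>{0..<int L}. g (s + a)) = (\<Sum>s\<in>{0..<int L}. g s)"
proof -
  have "(\<Sum>s\<in>{0..<int L}. g (s + a)) = (\<Sum>s\<in>{a..<a + int L}. g s)"
    by (rule sum.reindex_bij_witness[of _ "\<lambda>s. s - a" "\<lambda>s. s + a"]) auto
  then show ?thesis by (simp add: sum_periodic g)
qed

section \<open>Operations on an initial block\<close>

definition block_out :: "('k::field, 'v) ainf \<Rightarrow> 'v word \<Rightarrow> nat \<times> 'v" where
  "block_out A w = (sdeg w - 2, amu A (length w) (map snd w))"

definition front_w :: "('k::field, 'v) ainf \<Rightarrow> nat \<Rightarrow> 'v word \<Rightarrow> ('v, 'k) chain" where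
  "front_w A j w = (if 1 \<le> j \<and> j \<le> length w then bterm A w 0 j else 0)"

definition front :: "('k::field, 'v) ainf \<Rightarrow> nat \<Rightarrow> ('v, 'k) chain \<Rightarrow> ('v, 'k) chain" where
  "front A j = lin (front_w A j)"

lemma lmap_front: "lmap (front A j)"
  unfolding front_def by (rule lmap_lin)

lemmas front_simps = lmap_simps[OF lmap_front]
lemmas lin_simps = lmap_simps[OF lmap_lin]

lemma sdeg_conv: "sum_list (map fst w) + length w = sdeg w"
  by (induction w) auto

lemma bterm_app:
  "bterm A (u @ blk @ v) (length u) (length blk) =
     (if sdeg blk < 2 then 0 else psc ((-1) ^ sdeg u) (gen (u @ block_out A blk # v)))"
proof -
  have "int (sum_list (map fst blk)) + int (length blk) - 2 = int (sdeg blk) - 2"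
    using sdeg_conv[of blk] by simp
  moreover have "nat (int (sdeg blk) - 2) = sdeg blk - 2"
    by simp
  ultimately show ?thesis
    unfolding bterm_def Let_def block_out_def by (simp add: append_eq_conv_conj)
qed

lemma front_app:
  assumes "blk \<noteq> []"
  shows "front A (length blk) (gen (blk @ v)) = (if sdeg blk < 2 then 0 else gen (block_out A blk # v))"
  using assms bterm_app[of A "[]" blk v]
  by (cases blk) (simp_all add: front_def front_w_def)

lemma sdeg_block_out: "2 \<le> sdeg w \<Longrightarrow> Suc (fst (block_out A w)) = sdeg w - 1"
  by (simp add: block_out_def)

lemma word_split:
  assumes "t + j \<le> length w"
  obtains u blk v where "w = u @ blk @ v" "length u = t" "length blk = j"
  using assms that[of "take t w" "take j (drop t w)" "drop j (drop t w)"] by (simp del: drop_drop)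

lemma rot_back: "rot (- int (length u)) (gen (v @ u)) = psc ((-1) ^ (sdeg u * sdeg v)) (gen (u @ v))"
proof -
  have "gen (u @ v) = rot (- int (length u)) (rot (int (length u)) (gen (u @ v)))"
    by (simp add: rot_rot)
  also have "\<dots> = psc ((-1) ^ (sdeg u * sdeg v)) (rot (- int (length u)) (gen (v @ u)))"
    by (simp add: rot_app rot_simps)
  finally have e: "gen (u @ v) = psc ((-1) ^ (sdeg u * sdeg v)) (rot (- int (length u)) (gen (v @ u)))" .
  show ?thesis
    by (subst e) (simp flip: power_add)
qed

text \<open>Moving the prefix \<open>u\<close> to the end and back multiplies \<open>sdeg u\<close>
  with the shifted degree of the rest, once before and once after the contraction. The contraction
  lowers that degree by one, so the Koszul sign \<open>(-1) ^ sdeg u\<close> is what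
  remains.\<close>

lemma bterm_rot:
  fixes A :: "('k::field, 'v) ainf"
  assumes "1 \<le> j" "t + j \<le> length w"
  shows "bterm A w t j = rot (- int t) (front A j (rot (int t) (gen w)))"
proof -
  obtain u blk v where w: "w = u @ blk @ v" "length u = t" "length blk = j"
    using assms(2) by (rule word_split)
  have blk: "blk \<noteq> []" using w(3) assms(1) by auto
  show ?thesis
  proof (cases "sdeg blk < 2")
    case True
    then show ?thesis
      unfolding w(1) w(2,3)[symmetric] bterm_app rot_app front_simps append_assoc front_app[OF blk] by (simp add: rot_simps)
  next
    case False
    have 1: "block_out A blk # v @ u = (block_out A blk # v) @ u" by simp
    from False obtain s where s: "sdeg blk = Suc (Suc s)"
      by (metis One_nat_def Suc_1 Suc_le_D not_less add_2_eq_Suc le_Suc_ex)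
    have 2: "fst (block_out A blk) = s" by (simp add: block_out_def s)
    have "(-1 :: 'k) ^ (sdeg u * sdeg (blk @ v)) * (-1) ^ (sdeg u * sdeg (block_out A blk # v)) = (-1) ^ sdeg u"
      unfolding power_add[symmetric] by (rule minus_one_power_cong) (auto simp: s 2)
    then show ?thesis
      unfolding w(1) w(2,3)[symmetric] bterm_app rot_app front_simps append_assoc front_app[OF blk] rot_simps
      using False unfolding 1 if_not_P[OF False] rot_back psc_psc by simp
  qed
qed

text \<open>There is no rotation back: the result of a wrap-around block stays in position 0, and
  its sign is that of the rotation alone.\<close>

lemma wterm_rot:
  fixes A :: "('k::field, 'v) ainf"
  assumes "1 \<le> j" "j + k + 1 \<le> length w"
  shows "wterm A w j k = front A (j + k + 1) (rot (- int j) (gen w))"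
proof -
  define t h where "t = drop (length w - j) w" and "h = take (length w - j) w"
  have w: "w = h @ t" by (simp add: t_def h_def)
  have lt: "length t = j" using assms by (simp add: t_def)
  define x y where "x = take (k + 1) h" and "y = drop (k + 1) h"
  have h: "h = x @ y" by (simp add: x_def y_def)
  have lx: "length x = k + 1" using assms by (simp add: x_def h_def)
  have lb: "length (t @ x) = j + k + 1" using lt lx by simp
  have blk: "t @ x \<noteq> []" using lb by auto
  have 1: "int (sum_list (map fst (t @ x))) + int (length (t @ x)) - 2 = int (sdeg (t @ x)) - 2"
    using sdeg_conv[of "t @ x"] by simp
  have 2: "nat (int (sdeg (t @ x)) - 2) = sdeg (t @ x) - 2" and 3: "int (sdeg (t @ x)) - 2 < 0 \<longleftrightarrow> sdeg (t @ x) < 2"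
    by linarith+
  have "rot (- int j) (gen w :: ('v, 'k) chain) = psc ((-1) ^ (sdeg t * sdeg h)) (gen ((t @ x) @ y))"
    unfolding w lt[symmetric] rot_back by (simp add: h)
  moreover have "wterm A w j k = (if sdeg (t @ x) < 2 then 0 else
      psc ((-1) ^ (sdeg t * sdeg h)) (gen (block_out A (t @ x) # y)))"
    unfolding wterm_def Let_def t_def[symmetric] h_def[symmetric] x_def[symmetric] y_def[symmetric] 1 2 3 block_out_def
    by (rule refl)
  ultimately show ?thesis
    by (simp only: front_simps front_app[OF blk] flip: lb) simp
qed

section \<open>The differentials and \<open>N\<close> as sums over rotations\<close>

abbreviation bp :: "('k::field, 'v) ainf \<Rightarrow> ('v, 'k) chain \<Rightarrow> ('v, 'k) chain" where
  "bp A \<equiv> lin (bprime_w A)"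

abbreviation bb :: "('k::field, 'v) ainf \<Rightarrow> ('v, 'k) chain \<Rightarrow> ('v, 'k) chain" where
  "bb A \<equiv> lin (b_w A)"

lemma bprime_w_sum: "bprime_w A w = (\<Sum>j\<in>{1..length w}. \<Sum>t\<in>{0..length w - j}. bterm A w t j)"
  unfolding bprime_w_def sum.Sigma[OF finite_atLeastAtMost ballI[OF finite_atLeastAtMost]]
  by (rule sum.reindex_bij_witness[of _ "\<lambda>(j, t). (t, j)" "\<lambda>(i, j). (j, i)"]) auto

lemma bprime_w_rot:
  "bprime_w A w = (\<Sum>j\<in>{1..length w}. \<Sum>t\<in>{0..int (length w) - int j}. rot (- t) (front A j (rot t (gen w))))"
  unfolding bprime_w_sum
proof (intro sum.cong refl)
  fix j assume j: "j \<in> {1..length w}"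
  show "(\<Sum>t\<in>{0..length w - j}. bterm A w t j) =
      (\<Sum>t\<in>{0..int (length w) - int j}. rot (- t) (front A j (rot t (gen w))))"
    using j by (intro sum.reindex_bij_witness[of _ nat int]) (auto simp: bterm_rot)
qed

lemma b_w_sum:
  "b_w A w = bprime_w A w + (\<Sum>n\<in>{1..length w}. \<Sum>s\<in>{1..<n}. front A n (rot (- int s) (gen w)))"
proof -
  have "(\<Sum>(j, k)\<in>{(j, k). 1 \<le> j \<and> j + k + 1 \<le> length w}. wterm A w j k) =
      (\<Sum>(n, s)\<in>Sigma {1..length w} (\<lambda>n. {1..<n}). front A n (rot (- int s) (gen w)))"
    by (rule sum.reindex_bij_witness[of _ "\<lambda>(n, s). (s, n - s - 1)" "\<lambda>(j, k). (j + k + 1, j)"])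
      (auto simp: wterm_rot[simplified])
  then show ?thesis
    by (simp add: b_w_def sum.Sigma)
qed

text \<open>A negative \<open>x\<close> stands for a block whose first \<open>- x\<close> letters
  come from the end of the word. For each arity the starting points thus run through one full period
  modulo the length, and \<open>max x 0\<close> expresses that the result of a wrapping block is not
  rotated back.\<close>

lemma b_w_rot:
  "b_w A w = (\<Sum>n\<in>{1..length w}. \<Sum>x\<in>{1 - int n..int (length w) - int n}.
     rot (- max x 0) (front A n (rot x (gen w))))"
proof -
  have "(\<Sum>s\<in>{1..<n}. front A n (rot (- int s) (gen w))) +
      (\<Sum>t\<in>{0..int (length w) - int n}. rot (- t) (front A n (rot t (gen w)))) =
      (\<Sum>x\<in>{1 - int n..int (length w) - int n}. rot (- max x 0) (front A n (rot x (gen w))))"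
    if n: "n \<in> {1..length w}" for n
  proof -
    have "{1 - int n..int (length w) - int n} = {1 - int n..-1} \<union> {0..int (length w) - int n}"
      using n by auto
    moreover have "(\<Sum>s\<in>{1..<n}. front A n (rot (- int s) (gen w))) =
        (\<Sum>x\<in>{1 - int n..-1}. rot (- max x 0) (front A n (rot x (gen w))))"
      by (rule sum.reindex_bij_witness[of _ "\<lambda>x. nat (- x)" "\<lambda>s. - int s"]) auto
    moreover have "(\<Sum>t\<in>{0..int (length w) - int n}. rot (- t) (front A n (rot t (gen w)))) =
        (\<Sum>x\<in>{0..int (length w) - int n}. rot (- max x 0) (front A n (rot x (gen w))))"
      by (rule sum.cong) (auto simp: max_def)
    ultimately show ?thesis
      by (simp add: sum.union_disjoint)
  qed
  then show ?thesis
    by (simp add: b_w_sum bprime_w_rot add.commute flip: sum.distrib)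
qed

lemma lam_hom: "v \<in> hom L \<Longrightarrow> 0 < L \<Longrightarrow> lin lam_w v = rot (- 1) v"
  by (erule hom_eqI[OF _ lmap_lin lmap_rot]) (auto simp: lam_w_eq)

lemma N_w_rot: "N_w w = (\<Sum>s\<in>{0..<int (length w)}. rot s (gen w) :: ('v, 'k::field) chain)"
proof (cases "w = []")
  case False
  have "(lin lam_w ^^ k) (gen w) = (rot (- int k) (gen w) :: ('v, 'k) chain)" for k
  proof (induction k)
    case (Suc k)
    have "rot (- int k) (gen w :: ('v, 'k) chain) \<in> hom (length w)"
      by (intro rot_hom) simp
    then show ?case using Suc False by (simp add: lam_hom rot_rot)
  qed simp
  then have "N_w w = (\<Sum>k<length w. rot (- int k) (gen w) :: ('v, 'k) chain)"
    by (simp add: N_w_def)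
  also have "\<dots> = (\<Sum>s\<in>{1 - int (length w)..<1 - int (length w) + int (length w)}. rot s (gen w))"
    by (rule sum.reindex_bij_witness[of _ "\<lambda>x. nat (- x)" "\<lambda>s. - int s"]) auto
  also have "\<dots> = (\<Sum>s\<in>{0..<int (length w)}. rot s (gen w))"
    by (rule sum_periodic) (rule rot_periodic, simp)
  finally show ?thesis .
qed (simp add: N_w_def)

lemma N_hom: "v \<in> hom L \<Longrightarrow> lin N_w v = (\<Sum>s\<in>{0..<int L}. rot s v)"
  by (erule hom_eqI) (auto intro!: lmap_intros simp: N_w_rot)

lemma lmap_rbr: "lmap (\<lambda>v. rot x (front A n (rot y v)))"
  by (rule lmapI) (simp_all add: rot_simps front_simps)

lemma bp_hom: "v \<in> hom L \<Longrightarrow>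
    bp A v = (\<Sum>j\<in>{1..L}. \<Sum>t\<in>{0..int L - int j}. rot (- t) (front A j (rot t v)))"
  by (erule hom_eqI) (auto intro!: lmap_lin lmap_setsum lmap_rbr simp: bprime_w_rot)

lemma bb_hom: "v \<in> hom L \<Longrightarrow>
    bb A v = (\<Sum>n\<in>{1..L}. \<Sum>x\<in>{1 - int n..int L - int n}. rot (- max x 0) (front A n (rot x v)))"
  by (erule hom_eqI) (auto intro!: lmap_lin lmap_setsum lmap_rbr simp: b_w_rot)

lemma front_hom:
  fixes A :: "('k::field, 'v) ainf"
  assumes "v \<in> hom L" "1 \<le> n" "n \<le> L"
  shows "front A n v \<in> hom (Suc L - n)"
proof (rule hom_lmapI[OF assms(1) lmap_front])
  fix w :: "'v word" assume w: "length w = L"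
  obtain u v where uv: "w = u @ v" "length u = n"
    by (rule that[of "take n w" "drop n w"]) (use w assms(3) in auto)
  then have "u \<noteq> []" using assms(2) by auto
  then show "front A n (gen w) \<in> hom (Suc L - n)"
    unfolding uv(1) uv(2)[symmetric] front_app[OF \<open>u \<noteq> []\<close>] using uv w
    by (auto simp: lspace_0 lspace_hom)
qed (rule lspace_hom)

lemma lmap_eq_on_hom:
  assumes "lmap f" "lmap g" "\<And>L v. v \<in> hom L \<Longrightarrow> f v = g v"
  shows "f v = g v"
  by (rule lmap_eqI[OF assms(1,2)]) (rule assms(3), simp)

text \<open>Composition with \<open>\<lambda>\<close> shifts the starting point of each block by
  one, so the terms of the wrapping blocks cancel against each other. What survives are the blocks
  of \<open>b'\<close> and their images under \<open>\<lambda>\<close>.\<close>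

lemma bb_one_minus_lam:
  fixes v :: "('v, 'k::field) chain"
  shows "bb A (v - lin lam_w v) = bp A v - lin lam_w (bp A v)"
proof (rule lmap_eq_on_hom[of "\<lambda>v. bb A (v - lin lam_w v)" "\<lambda>v. bp A v - lin lam_w (bp A v)"])
  fix L and v :: "('v, 'k) chain" assume v: "v \<in> hom L"
  show "bb A (v - lin lam_w v) = bp A v - lin lam_w (bp A v)"
  proof (cases "L = 0")
    case True
    then have "\<And>x. x \<in> hom L \<Longrightarrow> bp A x = 0" "\<And>x. x \<in> hom L \<Longrightarrow> bb A x = 0" "lin lam_w v = 0"
      using v by (auto simp: bp_hom bb_hom intro!: hom_eqI[OF v lmap_lin lmap_zero] simp: lam_w_def)
    then show ?thesis using v by (simp add: lin_simps)
  next
    case False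
    define h where "h n x = rot (- max x 0) (front A n (rot x v))" for n x
    define h' where "h' n x = rot (- max (x + 1) 0) (front A n (rot x v))" for n x
    have lam: "lin lam_w v = rot (- 1) v" using v False by (simp add: lam_hom)
    have v1: "v - rot (- 1) v \<in> hom L"
      by (intro lspace_diff[OF lspace_hom] rot_hom v)
    have "bb A (v - lin lam_w v) = (\<Sum>n\<in>{1..L}. \<Sum>x\<in>{1 - int n..int L - int n}. h n x - h' n (x - 1))"
      unfolding lam bb_hom[OF v1] by (simp add: h_def h'_def rot_simps front_simps rot_rot)
    also have "\<dots> = (\<Sum>n\<in>{1..L}. \<Sum>x\<in>{0..int L - int n}. h n x - h' n x)"
    proof (rule sum.cong[OF refl])
      fix n assume n: "n \<in> {1..L}"
      have b: "front A n (rot x v) \<in> hom (Suc L - n)" for x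
        using n by (intro front_hom rot_hom v) auto
      \<comment> \<open>The starting points \<open>L - n\<close> and \<open>- n\<close> agree modulo
        \<open>L\<close>. The outer rotations agree too, because \<open>L + 1 - n\<close> letters
        remain after the contraction and a rotation by that number is the identity.\<close>
      have "h' n (int L - int n) = h' n (- int n)"
        unfolding h'_def
      proof -
        have "rot (int L - int n) v = rot (- int n) v"
          by (rule rot_hom_periodic[OF v]) (simp add: mod_diff_left_eq[of "int L", symmetric])
        moreover have "rot (- max (int L - int n + 1) 0) (front A n (rot (- int n) v)) = rot 0 (front A n (rot (- int n) v))"
        proof (rule rot_hom_periodic[OF b])
          have "- max (int L - int n + 1) 0 = - int (Suc L - n)" using n by auto
          then show "- max (int L - int n + 1) 0 mod int (Suc L - n) = 0 mod int (Suc L - n)" by simp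
        qed
        ultimately show "rot (- max (int L - int n + 1) 0) (front A n (rot (int L - int n) v)) =
            rot (- max (- int n + 1) 0) (front A n (rot (- int n) v))"
          using n by simp
      qed
      moreover have "(\<Sum>x\<in>{1 - int n..int L - int n}. h' n (x - 1)) = (\<Sum>x\<in>{- int n..int L - int n - 1}. h' n x)"
        by (rule sum.reindex_bij_witness[of _ "\<lambda>x. x + 1" "\<lambda>x. x - 1"]) auto
      moreover have "{- int n..int L - int n - 1} = insert (- int n) ({1 - int n..-1} \<union> {0..int L - int n - 1})"
        using n by auto
      moreover have "{0..int L - int n} = insert (int L - int n) {0..int L - int n - 1}"
        using n by auto
      moreover have "{1 - int n..int L - int n} = {1 - int n..-1} \<union> {0..int L - int n}"
        using n by auto
      moreover have "(\<Sum>x\<in>{1 - int n..-1}. h n x) = (\<Sum>x\<in>{1 - int n..-1}. h' n x)"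
        by (rule sum.cong) (auto simp: h_def h'_def)
      ultimately show "(\<Sum>x\<in>{1 - int n..int L - int n}. h n x - h' n (x - 1)) = (\<Sum>x\<in>{0..int L - int n}. h n x - h' n x)"
        using n by (simp add: sum_subtractf sum.union_disjoint)
    qed
    also have "\<dots> = bp A v - lin lam_w (bp A v)"
    proof -
      have "lin lam_w (rot (- t) (front A n (rot t v))) = h' n t" if "n \<in> {1..L}" "t \<in> {0..int L - int n}" for n t
      proof -
        have "rot (- t) (front A n (rot t v)) \<in> hom (Suc L - n)"
          using that by (intro rot_hom front_hom v) auto
        then show ?thesis
          using that by (simp add: lam_hom h'_def rot_rot max_def minus_diff_commute)
      qed
      moreover have "rot (- t) (front A n (rot t v)) = h n t" if "t \<in> {0..int L - int n}" for n t
        using that by (simp add: h_def max_absorb1)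
      ultimately show ?thesis
        by (simp add: bp_hom[OF v] lin_simps sum_subtractf)
    qed
    finally show ?thesis .
  qed
qed (rule lmapI; simp add: lin_simps psc_diff algebra_simps)+

text \<open>A chain in the image of \<open>N\<close> is invariant, so only the outer rotation still
  depends on the position of the block, and the \<open>L + 1 - n\<close> positions are one full
  period for the shortened words. Both sides become the sum over all rotations before and after
  \<open>front A n\<close>.\<close>

lemma bp_N:
  fixes v :: "('v, 'k::field) chain"
  shows "bp A (lin N_w v) = lin N_w (bb A v)"
proof (rule lmap_eq_on_hom[of "\<lambda>v. bp A (lin N_w v)" "\<lambda>v. lin N_w (bb A v)"])
  fix L and v :: "('v, 'k) chain" assume v: "v \<in> hom L"
  have Nv: "(\<Sum>s\<in>{0..<int L}. rot s v) \<in> hom L"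
    by (intro lspace_sum[OF lspace_hom] rot_hom v)
  have per: "rot (s + int L) v = rot s v" for s
    by (rule rot_hom_periodic[OF v]) simp
  have "bp A (lin N_w v) = (\<Sum>n\<in>{1..L}. \<Sum>t\<in>{0..int L - int n}. \<Sum>s\<in>{0..<int L}. rot (- t) (front A n (rot s v)))"
    unfolding N_hom[OF v] bp_hom[OF Nv]
  proof (intro sum.cong refl)
    fix n t
    show "rot (- t) (front A n (rot t (\<Sum>s\<in>{0..<int L}. rot s v))) = (\<Sum>s\<in>{0..<int L}. rot (- t) (front A n (rot s v)))"
      unfolding rot_simps rot_rot front_simps add.commute[of t]
      by (rule sum_periodic_shift) (metis per)
  qed
  also have "\<dots> = (\<Sum>n\<in>{1..L}. \<Sum>s\<in>{0..<int L}. \<Sum>r\<in>{0..<int (Suc L - n)}. rot r (front A n (rot s v)))"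
  proof (rule sum.cong[OF refl])
    fix n assume n: "n \<in> {1..L}"
    have "(\<Sum>t\<in>{0..int L - int n}. rot (- t) (front A n (rot s v))) = (\<Sum>r\<in>{0..<int (Suc L - n)}. rot r (front A n (rot s v)))" for s
    proof -
      have b: "front A n (rot s v) \<in> hom (Suc L - n)" using n by (intro front_hom rot_hom v) auto
      have "(\<Sum>t\<in>{0..int L - int n}. rot (- t) (front A n (rot s v))) =
          (\<Sum>r\<in>{int n - int L..<int n - int L + int (Suc L - n)}. rot r (front A n (rot s v)))"
        using n by (intro sum.reindex_bij_witness[of _ uminus uminus]) auto
      also have "\<dots> = (\<Sum>r\<in>{0..<int (Suc L - n)}. rot r (front A n (rot s v)))"
        by (rule sum_periodic) (rule rot_hom_periodic[OF b], simp)
      finally show ?thesis .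
    qed
    then show "(\<Sum>t\<in>{0..int L - int n}. \<Sum>s\<in>{0..<int L}. rot (- t) (front A n (rot s v))) =
        (\<Sum>s\<in>{0..<int L}. \<Sum>r\<in>{0..<int (Suc L - n)}. rot r (front A n (rot s v)))"
      by (subst sum.swap) simp
  qed
  also have "\<dots> = (\<Sum>n\<in>{1..L}. \<Sum>x\<in>{1 - int n..int L - int n}. lin N_w (rot (- max x 0) (front A n (rot x v))))"
  proof (rule sum.cong[OF refl])
    fix n assume n: "n \<in> {1..L}"
    have b: "front A n (rot s v) \<in> hom (Suc L - n)" for s using n by (intro front_hom rot_hom v) auto
    have "lin N_w (rot (- max x 0) (front A n (rot x v))) = (\<Sum>r\<in>{0..<int (Suc L - n)}. rot r (front A n (rot x v)))" for x
      unfolding N_hom[OF rot_hom[OF b]] rot_rot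
      by (rule sum_periodic_shift) (rule rot_hom_periodic[OF b], simp)
    moreover have "{1 - int n..int L - int n} = {1 - int n..<1 - int n + int L}" by auto
    ultimately show "(\<Sum>s\<in>{0..<int L}. \<Sum>r\<in>{0..<int (Suc L - n)}. rot r (front A n (rot s v))) =
       (\<Sum>x\<in>{1 - int n..int L - int n}. lin N_w (rot (- max x 0) (front A n (rot x v))))"
      by (simp only:) (rule sum_periodic[symmetric], metis per)
  qed
  also have "\<dots> = lin N_w (bb A v)"
    by (simp add: bb_hom[OF v] lin_simps)
  finally show "bp A (lin N_w v) = lin N_w (bb A v)" .
qed (rule lmapI; simp add: lin_simps)+

section \<open>The square of the Hochschild differential\<close>

text \<open>If the initial block is contracted first, the shifted degree in front of the second
  block is smaller by one, whence the minus sign. The second block then starts \<open>i - 1\<close>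
  places earlier.\<close>

lemma front_bterm_disjoint:
  assumes "1 \<le> i" "1 \<le> j" "i \<le> p" "p + j \<le> length w"
  shows "front A i (rot (- int p) (front A j (rot (int p) (gen w)))) =
     - rot (- int (p - i + 1)) (front A j (rot (int (p - i + 1)) (front A i (gen w))))"
proof -
  have "i + (p - i) \<le> length w" using assms by simp
  then obtain blk mid r where w1: "w = blk @ mid @ r" "length blk = i" "length mid = p - i"
    using word_split[of i "p - i" w] by metis
  have "0 + j \<le> length r" using assms w1 by auto
  then obtain blk2 v where r: "r = blk2 @ v" "length blk2 = j"
    using word_split[of 0 j r] by (metis append_Nil length_0_conv)
  have ne: "blk \<noteq> []" using w1 assms by auto
  have p: "p = length (blk @ mid)" and p': "p - i + 1 = length (block_out A blk # mid)"
    using w1 assms by simp_all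
  have L: "rot (- int p) (front A j (rot (int p) (gen w))) = bterm A ((blk @ mid) @ blk2 @ v) (length (blk @ mid)) (length blk2)"
    unfolding bterm_rot[OF assms(2,4), symmetric] p[symmetric] r(2) by (simp only: w1(1) r(1) append_assoc)
  have R: "rot (- int (p - i + 1)) (front A j (rot (int (p - i + 1)) (gen ((block_out A blk # mid) @ blk2 @ v)))) =
      bterm A ((block_out A blk # mid) @ blk2 @ v) (length (block_out A blk # mid)) (length blk2)"
    unfolding p'[symmetric] r(2) using assms r p' by (intro bterm_rot[symmetric]) simp_all
  have B: "front A i (gen w) = (if sdeg blk < 2 then 0 else gen ((block_out A blk # mid) @ blk2 @ v))"
    using front_app[OF ne, of A "mid @ r"] by (simp add: w1 r)
  have C: "front A i (gen ((blk @ mid) @ block_out A blk2 # v)) = (if sdeg blk < 2 then 0 else gen ((block_out A blk # mid) @ block_out A blk2 # v))"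
    using front_app[OF ne, of A "mid @ block_out A blk2 # v"] by (simp add: w1)
  show ?thesis
  proof (cases "sdeg blk < 2")
    case True
    then show ?thesis unfolding L bterm_app by (simp add: B front_simps C rot_simps del: append.simps append_assoc)
  next
    case False
    then have s: "sdeg (blk @ mid) = Suc (sdeg (block_out A blk # mid))"
      using sdeg_block_out[of blk A] by simp
    show ?thesis
      unfolding L B if_not_P[OF False] R unfolding bterm_app
      using False by (simp add: front_simps C s psc_minus_left del: append.simps append_assoc sdeg_simps)
  qed
qed

lemma front_disjoint_hom:
  fixes A :: "('k::field, 'v) ainf"
  assumes v: "v \<in> hom L" and ij: "1 \<le> i" "1 \<le> j" "int i \<le> p" "p + int j \<le> int L"
  shows "front A i (rot (- p) (front A j (rot p v))) =
     - rot (- (p - int i + 1)) (front A j (rot (p - int i + 1) (front A i v)))"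
proof (rule hom_eqI[OF v])
  obtain q where q: "p = int q" using ij(3) by (metis nonneg_int_cases of_nat_0_le_iff order_trans)
  have e: "int (q - i + 1) = int q - int i + 1" using ij q by auto
  fix w :: "'v word" assume "length w = L"
  then show "front A i (rot (- p) (front A j (rot p (gen w)))) =
     - rot (- (p - int i + 1)) (front A j (rot (p - int i + 1) (front A i (gen w))))"
    using front_bterm_disjoint[of i j q w A] ij e unfolding q e by simp
qed (rule lmapI; simp add: rot_simps front_simps psc_minus)+

text \<open>In the square of either differential, pairs of disjoint blocks cancel, and the nested pairs
  with union the first \<open>n\<close> letters contribute \<open>nested A n\<close>, which is zero by the \<open>A\<^sub>\<infinity>\<close>-relations.\<close>

definition nested :: "('k::field, 'v) ainf \<Rightarrow> nat \<Rightarrow> ('v, 'k) chain \<Rightarrow> ('v, 'k) chain" where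
  "nested A n v = (\<Sum>j\<in>{1..n}. \<Sum>p\<in>{0..int n - int j}. front A (Suc n - j) (rot (- p) (front A j (rot p v))))"

lemma bb_bb:
  assumes v: "v \<in> hom L"
  shows "bb A (bb A v) = (\<Sum>n\<in>{1..L}. \<Sum>z\<in>{1 - int n..int L - int n}. rot (- max z 0) (nested A n (rot z v)))"
proof -
  \<comment> \<open>The first block has length \<open>j\<close> and start \<open>x\<close>, the
    second one length \<open>i\<close> and start \<open>y\<close>. The result of the first
    contraction sits in position \<open>max x 0\<close>, that is at offset
    \<open>max x 0 - y\<close> from the start of the second block; the families below sort the pairs
    by this offset.\<close>
  define T where "T = (\<lambda>(j, x, i, y). rot (- max y 0) (front A i (rot (y - max x 0) (front A j (rot x v)))))"
  define S where "S = Sigma {1..L} (\<lambda>j. Sigma {1 - int j..int L - int j} (\<lambda>x. Sigma {1..Suc L - j}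
      (\<lambda>i. {1 - int i..int L + 1 - int j - int i})))"
  define Dneg where "Dneg = {(j, x, i, y)\<in>S. max x 0 - y < 0}"
  define Dpos where "Dpos = {(j, x, i, y)\<in>S. int i \<le> max x 0 - y \<and> max x 0 - y < int L + 1 - int j}"
  \<comment> \<open>In the second alternative the second block wraps around the end: reduced modulo
    the new length \<open>L + 1 - j\<close>, the offset falls into the block again.\<close>
  define Nst where "Nst = {(j, x, i, y)\<in>S. (0 \<le> max x 0 - y \<and> max x 0 - y < int i) \<or> int L + 1 - int j \<le> max x 0 - y}"
  have inS: "(j, x, i, y) \<in> S \<longleftrightarrow> 1 \<le> j \<and> j \<le> L \<and> 1 - int j \<le> x \<and> x \<le> int L - int j \<and> 1 \<le> i \<and>
      int i \<le> int L + 1 - int j \<and> 1 - int i \<le> y \<and> y \<le> int L + 1 - int j - int i" for j x i y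
    unfolding S_def by auto
  have fin: "finite S" unfolding S_def by (intro finite_SigmaI) auto
  \<comment> \<open>\<open>?f\<close> records length and start of the union of a nested pair, then
    length and start of the inner block within it; \<open>?b\<close> is its inverse. A wrapping
    inner block (\<open>x < 0\<close>) has consumed \<open>- x\<close> letters at the end of the
    word, so the union starts that much earlier. An inner block inside the tail used by the second
    one has shortened this tail by \<open>j - 1\<close>.\<close>
  let ?f = "\<lambda>(j, x, i, y). (i + j - 1, if max x 0 - y < int i then y + min x 0 else y - int j + 1, j,
            if max x 0 - y < int i then max x 0 - y else max x 0 - y - (int L + 1 - int j))"
  let ?b = "\<lambda>(n, z, j, p). (j, if 0 < z + p + int j then z + p else z + p + int L, Suc n - j,
            if 0 < z + p then z else if 0 < z + p + int j then - p else z + int j - 1)"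
  have "bb A (bb A v) = (\<Sum>j\<in>{1..L}. \<Sum>x\<in>{1 - int j..int L - int j}. \<Sum>i\<in>{1..Suc L - j}.
      \<Sum>y\<in>{1 - int i..int L + 1 - int j - int i}. T (j, x, i, y))"
    unfolding bb_hom[OF v] lin_simps
  proof (intro sum.cong refl)
    fix j x assume j: "j \<in> {1..L}"
    then have M: "int (Suc L - j) = int L + 1 - int j" by auto
    from j have "rot (- max x 0) (front A j (rot x v)) \<in> hom (Suc L - j)"
      by (intro rot_hom front_hom v) auto
    then show "bb A (rot (- max x 0) (front A j (rot x v))) = (\<Sum>i\<in>{1..Suc L - j}.
      \<Sum>y\<in>{1 - int i..int L + 1 - int j - int i}. T (j, x, i, y))"
      by (simp only: bb_hom T_def rot_rot M prod.case uminus_add_conv_diff diff_conv_add_uminus)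
  qed
  also have "\<dots> = sum T S"
    unfolding S_def by (simp add: sum.Sigma finite_SigmaI split_def)
  also have "S = Nst \<union> (Dneg \<union> Dpos)"
    by (auto simp: Nst_def Dneg_def Dpos_def)
  also have "sum T (Nst \<union> (Dneg \<union> Dpos)) = sum T Nst + (sum T Dneg + sum T Dpos)"
  proof -
    have "finite Nst" "finite Dneg" "finite Dpos"
      by (auto intro!: finite_subset[OF _ fin] simp: Nst_def Dneg_def Dpos_def)
    moreover have "Nst \<inter> (Dneg \<union> Dpos) = {}" "Dneg \<inter> Dpos = {}"
      by (auto simp: Nst_def Dneg_def Dpos_def S_def)
    ultimately show ?thesis by (simp add: sum.union_disjoint)
  qed
  \<comment> \<open>Performing the two disjoint contractions in the opposite order matches
    \<open>Dpos\<close> with \<open>Dneg\<close> and changes the sign.\<close>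
  also have "sum T Dpos = (\<Sum>t\<in>Dneg. - T t)"
  proof (rule sum.reindex_bij_witness[of _ "\<lambda>(i, y, j, y'). (j, y' + int i - 1 + min y 0, i, y)"
        "\<lambda>(j, x, i, y). (i, y, j, max y 0 + (max x 0 - y) - int i + 1)"])
    fix t assume t: "t \<in> Dpos"
    obtain j x i y where [simp]: "t = (j, x, i, y)" by (cases t)
    define g where "g = max x 0 - y"
    have b: "1 \<le> j" "j \<le> L" "1 - int j \<le> x" "x \<le> int L - int j" "1 \<le> i" "int i \<le> int L + 1 - int j"
      "1 - int i \<le> y" "y \<le> int L + 1 - int j - int i" "int i \<le> g" "g < int L + 1 - int j"
      using t by (simp_all add: Dpos_def inS g_def)
    have x: "0 < x" "x = g + y" using b by (auto simp: g_def)
    show "(case case t of (j, x, i, y) \<Rightarrow> (i, y, j, max y 0 + (max x 0 - y) - int i + 1) of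
        (i, y, j, y') \<Rightarrow> (j, y' + int i - 1 + min y 0, i, y)) = t"
      using x by (simp add: max_def min_def)
    show "(case t of (j, x, i, y) \<Rightarrow> (i, y, j, max y 0 + (max x 0 - y) - int i + 1)) \<in> Dneg"
      using b x by (auto simp: Dneg_def inS max_def)
    have "rot (- g) (front A j (rot g (rot y v))) = rot (- g) (front A j (rot x v))"
      by (simp add: rot_rot x)
    moreover have "front A i (rot (- g) (front A j (rot g (rot y v)))) =
        - rot (- (g - int i + 1)) (front A j (rot (g - int i + 1) (front A i (rot y v))))"
      using b by (intro front_disjoint_hom[where L=L] rot_hom v) auto
    moreover have "T t = rot (- max y 0) (front A i (rot (- g) (front A j (rot x v))))"
      by (simp add: T_def g_def)
    moreover have "T (i, y, j, max y 0 + g - int i + 1) =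
        rot (- max y 0 + - (g - int i + 1)) (front A j (rot (g - int i + 1) (front A i (rot y v))))"
    proof -
      have "- max (max y 0 + g - int i + 1) 0 = - max y 0 + - (g - int i + 1)"
        and "max y 0 + g - int i + 1 - max y 0 = g - int i + 1"
        using b by auto
      then show ?thesis by (simp only: T_def prod.case)
    qed
    ultimately show "- T (case t of (j, x, i, y) \<Rightarrow> (i, y, j, max y 0 + (max x 0 - y) - int i + 1)) = T t"
      by (simp only: \<open>t = _\<close> prod.case g_def[symmetric] rot_rot[symmetric] rot_simps)
  next
    fix t assume t: "t \<in> Dneg"
    obtain i y j y' where [simp]: "t = (i, y, j, y')" by (cases t)
    have b: "1 \<le> i" "i \<le> L" "1 - int i \<le> y" "y \<le> int L - int i" "1 \<le> j" "int j \<le> int L + 1 - int i"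
      "1 - int j \<le> y'" "y' \<le> int L + 1 - int i - int j" "max y 0 < y'"
      using t by (simp_all add: Dneg_def inS)
    have x: "max (y' + int i - 1 + min y 0) 0 = y' + int i - 1 + min y 0" "max y 0 = y - min y 0"
      using b by linarith+
    show "(case case t of (i, y, j, y') \<Rightarrow> (j, y' + int i - 1 + min y 0, i, y) of
        (j, x, i, y) \<Rightarrow> (i, y, j, max y 0 + (max x 0 - y) - int i + 1)) = t"
      using b by (simp add: x)
    show "(case t of (i, y, j, y') \<Rightarrow> (j, y' + int i - 1 + min y 0, i, y)) \<in> Dpos"
    proof -
      have "1 - int j \<le> y' + int i - 1 + min y 0" "y' + int i - 1 + min y 0 \<le> int L - int j"
        "int i \<le> y' + int i - 1 + min y 0 - y" "y' + int i - 1 + min y 0 - y < int L + 1 - int j"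
        "y \<le> int L + 1 - int j - int i" "j \<le> L"
        using b by linarith+
      then show ?thesis using b by (simp add: Dpos_def inS x)
    qed
  qed
  also have "sum T Nst = (\<Sum>(n, z, j, p)\<in>Sigma {1..L} (\<lambda>n. Sigma {1 - int n..int L - int n} (\<lambda>z. Sigma {1..n} (\<lambda>j. {0..int n - int j}))).
      rot (- max z 0) (front A (Suc n - j) (rot (- p) (front A j (rot (p + z) v)))))"
    (is "_ = sum ?F ?R")
  proof (rule sum.reindex_bij_witness[of _ ?b ?f])
    fix t assume t: "t \<in> Nst"
    obtain j x i y where [simp]: "t = (j, x, i, y)" by (cases t)
    have b: "1 \<le> j" "j \<le> L" "1 - int j \<le> x" "x \<le> int L - int j" "1 \<le> i" "int i \<le> int L + 1 - int j"
      "1 - int i \<le> y" "y \<le> int L + 1 - int j - int i"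
      "(0 \<le> max x 0 - y \<and> max x 0 - y < int i) \<or> int L + 1 - int j \<le> max x 0 - y"
      using t by (simp_all add: Nst_def inS)
    have n: "int (i + j - 1) = int i + int j - 1" "Suc (i + j - 1) - j = i" using b by auto
    show "?f t \<in> ?R"
      using b n by (auto simp: max_def min_def split: if_splits)
    show "?b (?f t) = t"
    proof (cases "max x 0 - y < int i")
      case True then show ?thesis using b n by (cases "0 < x") (auto simp: max_def min_def)
    next
      case False
      then have "0 < x" using b by auto
      then show ?thesis using b n False by auto
    qed
    show "?F (?f t) = T t"
    proof (cases "max x 0 - y < int i")
      case True
      have "max (y + min x 0) 0 = max y 0" using True b by (auto simp: max_def min_def)
      moreover have "max x 0 - y + (y + min x 0) = x" by (simp add: max_def min_def)
      ultimately show ?thesis using True n by (simp add: T_def)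
    next
      case False
      then have x: "0 < x" "y < 0" using b by auto
      have "rot x v = rot (max x 0 - y - (int L + 1 - int j) + (y - int j + 1)) v"
      proof (rule rot_hom_periodic[OF v])
        have "max x 0 - y - (int L + 1 - int j) + (y - int j + 1) = x - int L" using x by simp
        then show "x mod int L = (max x 0 - y - (int L + 1 - int j) + (y - int j + 1)) mod int L"
          by (simp only: minus_mod_self2)
      qed
      moreover have "rot (y - max x 0) (front A j (rot x v)) = rot (- (max x 0 - y - (int L + 1 - int j))) (front A j (rot x v))"
      proof (rule rot_hom_periodic)
        show "front A j (rot x v) \<in> hom (Suc L - j)" using b by (intro front_hom rot_hom v) auto
        have "int (Suc L - j) = int L + 1 - int j" using b by auto
        then have "- (max x 0 - y - (int L + 1 - int j)) = y - max x 0 + int (Suc L - j)" by simp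
        then show "(y - max x 0) mod int (Suc L - j) = (- (max x 0 - y - (int L + 1 - int j))) mod int (Suc L - j)"
          by (simp only: mod_add_self2)
      qed
      moreover have "max (y - int j + 1) 0 = max y 0" using x b by auto
      ultimately show ?thesis using False n by (simp only: T_def prod.case \<open>t = _\<close> if_False)
    qed
  next
    fix t assume t: "t \<in> ?R"
    obtain n z j p where [simp]: "t = (n, z, j, p)" by (cases t)
    have b: "1 \<le> n" "n \<le> L" "1 - int n \<le> z" "z \<le> int L - int n" "1 \<le> j" "j \<le> n" "0 \<le> p" "p \<le> int n - int j"
      using t by auto
    have i: "int (Suc n - j) = int n + 1 - int j" "Suc n - j + j - 1 = n" using b by auto
    show "?f (?b t) = t"
      using b i by (cases "0 < z + p"; cases "0 < z + p + int j") auto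
    show "?b t \<in> Nst"
      using b i by (cases "0 < z + p"; cases "0 < z + p + int j") (auto simp: Nst_def inS)
  qed
  also have "\<dots> = (\<Sum>n\<in>{1..L}. \<Sum>z\<in>{1 - int n..int L - int n}. rot (- max z 0) (nested A n (rot z v)))"
    by (simp add: sum.Sigma[symmetric] finite_SigmaI nested_def rot_simps rot_rot)
  finally show ?thesis
    by (simp add: sum_negf)
qed

section \<open>Compatibility with the multilinearity relations\<close>

lemma lmap_trel:
  assumes p: "p \<in> trel A" and f: "lmap f" and S: "lspace S"
    and add: "\<And>us ws a c d. valid A us \<Longrightarrow> valid A ws \<Longrightarrow> a \<in> acomp A d \<Longrightarrow> c \<in> acomp A d \<Longrightarrow>
      f (gen (us @ [(d, aadd A a c)] @ ws)) - f (gen (us @ [(d, a)] @ ws)) - f (gen (us @ [(d, c)] @ ws)) \<in> S"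
    and smul: "\<And>us ws a k d. valid A us \<Longrightarrow> valid A ws \<Longrightarrow> a \<in> acomp A d \<Longrightarrow>
      f (gen (us @ [(d, asmul A k a)] @ ws)) - psc k (f (gen (us @ [(d, a)] @ ws))) \<in> S"
  shows "f p \<in> S"
  using p
proof (induction rule: trel.induct)
  case trel_zero
  then show ?case using S by (simp add: lmap_0[OF f] lspace_0)
next
  case (trel_add us ws a d c)
  then show ?case using add[of us ws a d c] by (simp only: lmap_simps[OF f])
next
  case (trel_smul us ws a d k)
  then show ?case using smul[of us ws a d k] by (simp only: lmap_simps[OF f])
next
  case (trel_plus p q)
  then show ?case using S by (simp add: lmap_add[OF f] lspace_add)
next
  case (trel_scal p k)
  then show ?case using S by (simp add: lmap_psc[OF f] lspace_psc)
qed

text \<open>An operator with this property for every letter preserves the multilinearity relations.\<close>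

definition letterwise :: "('k::field, 'v) ainf \<Rightarrow> (('v, 'k) chain \<Rightarrow> ('v, 'k) chain) \<Rightarrow> 'v word \<Rightarrow> 'v word \<Rightarrow> nat \<Rightarrow> bool" where
  "letterwise A f us ws d \<longleftrightarrow>
     (\<forall>x\<in>acomp A d. f (gen (us @ [(d, x)] @ ws)) = 0) \<or>
     (\<exists>us' ws' d' g s. valid A us' \<and> valid A ws' \<and>
        (\<forall>x\<in>acomp A d. f (gen (us @ [(d, x)] @ ws)) = psc s (gen (us' @ [(d', g x)] @ ws'))) \<and>
        (\<forall>x\<in>acomp A d. g x \<in> acomp A d') \<and>
        (\<forall>x\<in>acomp A d. \<forall>y\<in>acomp A d. g (aadd A x y) = aadd A (g x) (g y)) \<and>
        (\<forall>k. \<forall>x\<in>acomp A d. g (asmul A k x) = asmul A k (g x)))"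

lemma letterwise_0: "(\<And>x. x \<in> acomp A d \<Longrightarrow> f (gen (us @ [(d, x)] @ ws)) = 0) \<Longrightarrow> letterwise A f us ws d"
  by (simp add: letterwise_def)

lemma letterwiseI:
  assumes "valid A us'" "valid A ws'"
    and "\<And>x. x \<in> acomp A d \<Longrightarrow> f (gen (us @ [(d, x)] @ ws)) = psc s (gen (us' @ [(d', g x)] @ ws'))"
    and "\<And>x. x \<in> acomp A d \<Longrightarrow> g x \<in> acomp A d'"
    and "\<And>x y. x \<in> acomp A d \<Longrightarrow> y \<in> acomp A d \<Longrightarrow> g (aadd A x y) = aadd A (g x) (g y)"
    and "\<And>k x. x \<in> acomp A d \<Longrightarrow> g (asmul A k x) = asmul A k (g x)"
  shows "letterwise A f us ws d"
  unfolding letterwise_def using assms by blast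

lemma letterwise_sameI:
  assumes "valid A us'" "valid A ws'"
    and "\<And>x. x \<in> acomp A d \<Longrightarrow> f (gen (us @ [(d, x)] @ ws)) = psc s (gen (us' @ [(d, x)] @ ws'))"
  shows "letterwise A f us ws d"
  by (rule letterwiseI[where g = "\<lambda>x. x", OF assms]) simp_all

lemma lmap_trel_letter:
  assumes p: "p \<in> trel A" and f: "lmap f"
    and letter: "\<And>us ws d. valid A us \<Longrightarrow> valid A ws \<Longrightarrow> letterwise A f us ws d"
    and closed: "\<And>d x y. x \<in> acomp A d \<Longrightarrow> y \<in> acomp A d \<Longrightarrow> aadd A x y \<in> acomp A d"
      "\<And>d x k. x \<in> acomp A d \<Longrightarrow> asmul A k x \<in> acomp A d"
  shows "f p \<in> trel A"
proof (rule lmap_trel[OF p f lspace_trel])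
  fix us ws a c d assume v: "valid A us" "valid A ws" "a \<in> acomp A d" "c \<in> acomp A d"
  from letter[OF v(1,2), of d, unfolded letterwise_def]
  show "f (gen (us @ [(d, aadd A a c)] @ ws)) - f (gen (us @ [(d, a)] @ ws)) - f (gen (us @ [(d, c)] @ ws)) \<in> trel A"
  proof (elim disjE exE conjE)
    fix us' ws' d' g s
    assume h: "valid A us'" "valid A ws'"
      "\<forall>x\<in>acomp A d. f (gen (us @ [(d, x)] @ ws)) = psc s (gen (us' @ [(d', g x)] @ ws'))"
      "\<forall>x\<in>acomp A d. g x \<in> acomp A d'"
      "\<forall>x\<in>acomp A d. \<forall>y\<in>acomp A d. g (aadd A x y) = aadd A (g x) (g y)"
    have "psc s (gen (us' @ [(d', aadd A (g a) (g c))] @ ws') - gen (us' @ [(d', g a)] @ ws') - gen (us' @ [(d', g c)] @ ws')) \<in> trel A"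
      using v h by (intro trel_scal trel.trel_add) auto
    then show ?thesis using h v closed(1)[of a d c] by (simp only: psc_diff)
  qed (use v closed in \<open>simp add: trel.trel_zero\<close>)
next
  fix us ws a k d assume v: "valid A us" "valid A ws" "a \<in> acomp A d"
  from letter[OF v(1,2), of d, unfolded letterwise_def]
  show "f (gen (us @ [(d, asmul A k a)] @ ws)) - psc k (f (gen (us @ [(d, a)] @ ws))) \<in> trel A"
  proof (elim disjE exE conjE)
    fix us' ws' d' g s
    assume h: "valid A us'" "valid A ws'"
      "\<forall>x\<in>acomp A d. f (gen (us @ [(d, x)] @ ws)) = psc s (gen (us' @ [(d', g x)] @ ws'))"
      "\<forall>x\<in>acomp A d. g x \<in> acomp A d'"
      "\<forall>k. \<forall>x\<in>acomp A d. g (asmul A k x) = asmul A k (g x)"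
    have "psc s (gen (us' @ [(d', asmul A k (g a))] @ ws') - psc k (gen (us' @ [(d', g a)] @ ws'))) \<in> trel A"
      using v h by (intro trel_scal trel.trel_smul) auto
    moreover have "f (gen (us @ [(d, asmul A k a)] @ ws)) = psc s (gen (us' @ [(d', asmul A k (g a))] @ ws'))"
      using h v closed(2)[of a d k] by simp
    moreover have "psc k (f (gen (us @ [(d, a)] @ ws))) = psc s (psc k (gen (us' @ [(d', g a)] @ ws')))"
      using h v by (simp add: mult.commute)
    ultimately show ?thesis by (simp only: psc_diff)
  qed (use v closed in \<open>simp add: trel.trel_zero\<close>)
qed

lemma valid_simps [simp]:
  "valid A []" "valid A (l # w) \<longleftrightarrow> snd l \<in> acomp A (fst l) \<and> valid A w"
  "valid A (u @ w) \<longleftrightarrow> valid A u \<and> valid A w"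
  by (auto simp: valid_def)

lemma valid_take_drop: "valid A w \<Longrightarrow> valid A (take m w)" "valid A w \<Longrightarrow> valid A (drop m w)"
  by (auto simp: valid_def dest: in_set_takeD in_set_dropD)

section \<open>The operators preserve the multilinearity relations\<close>

locale ainfinity =
  fixes A :: "('k::field, 'v) ainf"
  assumes ainf: "ainf_algebra A"
begin

lemma graded: "graded_vs A" and multilinear: "multilinear_ops A" and degree: "degree_ops A"
  and bp_bp_gen: "valid A w \<Longrightarrow> bp A (bp A (gen w)) \<in> trel A"
  using ainf by (auto simp: ainf_algebra_def bprime_def)

lemma vs: "vector_space_ax A" and comp_subspace: "is_subspace A (acomp A d)"
  using graded by (simp_all add: graded_vs_def)

lemma acomp_acar: "x \<in> acomp A d \<Longrightarrow> x \<in> acar A"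
  and acomp_zero [simp]: "azero A \<in> acomp A d"
  and acomp_add [simp]: "x \<in> acomp A d \<Longrightarrow> y \<in> acomp A d \<Longrightarrow> aadd A x y \<in> acomp A d"
  and acomp_smul [simp]: "x \<in> acomp A d \<Longrightarrow> asmul A k x \<in> acomp A d"
  using comp_subspace[of d] by (auto simp: is_subspace_def)

lemma valid_acar: "valid A w \<Longrightarrow> set (map snd w) \<subseteq> acar A"
  by (induction w) (auto dest: acomp_acar)

lemma block_out_comp:
  assumes "valid A w" "2 \<le> sdeg w"
  shows "snd (block_out A w) \<in> acomp A (fst (block_out A w))"
proof -
  have ne: "w \<noteq> []" using assms(2) by auto
  have e: "int (sum_list (map fst w)) + int (length w) - 2 = int (sdeg w - 2)"
    using sdeg_conv[of w] assms(2) by simp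
  have "if int (sum_list (map fst w)) + int (length w) - 2 < 0 then amu A (length w) (map snd w) = azero A
      else amu A (length w) (map snd w) \<in> acomp A (nat (int (sum_list (map fst w)) + int (length w) - 2))"
    using degree assms(1) ne unfolding degree_ops_def Let_def by blast
  from this[unfolded e] show ?thesis by (simp add: block_out_def)
qed

lemma amu_add: "set us \<subseteq> acar A \<Longrightarrow> set ws \<subseteq> acar A \<Longrightarrow> x \<in> acar A \<Longrightarrow> y \<in> acar A \<Longrightarrow>
    n = length us + 1 + length ws \<Longrightarrow>
    amu A n (us @ [aadd A x y] @ ws) = aadd A (amu A n (us @ [x] @ ws)) (amu A n (us @ [y] @ ws))"
  and amu_smul: "set us \<subseteq> acar A \<Longrightarrow> set ws \<subseteq> acar A \<Longrightarrow> x \<in> acar A \<Longrightarrow>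
    n = length us + 1 + length ws \<Longrightarrow>
    amu A n (us @ [asmul A k x] @ ws) = asmul A k (amu A n (us @ [x] @ ws))"
  and amu_closed: "1 \<le> n \<Longrightarrow> length xs = n \<Longrightarrow> set xs \<subseteq> acar A \<Longrightarrow> amu A n xs \<in> acar A"
  using multilinear unfolding multilinear_ops_def by metis+

lemma front_trel:
  assumes p: "p \<in> trel A"
  shows "front A j p \<in> trel A"
proof (rule lmap_trel_letter[OF p lmap_front])
  fix us ws d assume v: "valid A us" "valid A ws"
  let ?w = "\<lambda>x. us @ [(d, x)] @ ws"
  consider "j = 0 \<or> length us + 1 + length ws < j" | "1 \<le> j" "j \<le> length us" | 
    "length us < j" "j \<le> length us + 1 + length ws"
    by linarith
  then show "letterwise A (front A j) us ws d"
  proof cases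
    case 1
    then show ?thesis by (intro letterwise_0) (auto simp: front_def front_w_def)
  next
    case 2
    define blk u2 where "blk = take j us" and "u2 = drop j us"
    have us: "us = blk @ u2" "length blk = j" "blk \<noteq> []" using 2 by (auto simp: blk_def u2_def)
    have b: "front A j (gen (?w x)) = (if sdeg blk < 2 then 0 else gen ((block_out A blk # u2) @ [(d, x)] @ ws))" for x
      using front_app[OF us(3), of A "u2 @ [(d, x)] @ ws"] us by simp
    show ?thesis
    proof (cases "sdeg blk < 2")
      case True then show ?thesis by (intro letterwise_0) (simp only: b if_True)
    next
      case False
      have "valid A (block_out A blk # u2)" using v us block_out_comp[of blk] False by auto
      then show ?thesis
        by (rule letterwise_sameI[OF _ v(2), where s = 1]) (simp only: b False if_False psc_one)
    qed
  next
    case 3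
    define w1 w2 where "w1 = take (j - length us - 1) ws" and "w2 = drop (j - length us - 1) ws"
    have ws: "ws = w1 @ w2" "length (us @ [(d, x)] @ w1) = j" for x using 3 by (auto simp: w1_def w2_def)
    let ?d = "sdeg us + d + 1 + sdeg w1"
    let ?g = "\<lambda>x. amu A j (map snd us @ [x] @ map snd w1)"
    have b: "front A j (gen (?w x)) = (if ?d < 2 then 0 else gen ((?d - 2, ?g x) # w2))" for x
      using front_app[of "us @ [(d, x)] @ w1" A w2] ws(2)[of x] by (simp add: ws(1) block_out_def add.assoc)
    have c: "set (map snd us) \<subseteq> acar A" "set (map snd w1) \<subseteq> acar A"
      using v ws valid_acar by auto
    have j: "j = length (map snd us) + 1 + length (map snd w1)" using ws(2)[of undefined] by simp
    show ?thesis
    proof (cases "?d < 2")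
      case True then show ?thesis by (intro letterwise_0) (simp only: b if_True)
    next
      case False
      show ?thesis
      proof (rule letterwiseI[of A "[]" w2 d _ _ _ 1 "?d - 2" ?g])
        show "valid A []" "valid A w2" using v ws by simp_all
        fix x assume x: "x \<in> acomp A d"
        show "front A j (gen (?w x)) = psc 1 (gen ([] @ [(?d - 2, ?g x)] @ w2))"
          unfolding b if_not_P[OF False] by simp
        show "?g x \<in> acomp A (?d - 2)"
          using block_out_comp[of "us @ [(d, x)] @ w1"] x v ws False by (simp add: block_out_def add.assoc)
        show "?g (asmul A k x) = asmul A k (?g x)" for k
          by (intro amu_smul c acomp_acar[OF x] j)
        show "?g (aadd A x y) = aadd A (?g x) (?g y)" if "y \<in> acomp A d" for y
          using that by (intro amu_add c acomp_acar[OF x] j acomp_acar)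
      qed
    qed
  qed
qed auto

lemma rot_trel:
  assumes p: "p \<in> trel A"
  shows "rot z p \<in> trel A"
proof (rule lmap_trel_letter[OF p lmap_rot])
  fix us ws d assume v: "valid A us" "valid A ws"
  let ?w = "\<lambda>x :: 'v. us @ [(d, x)] @ ws"
  define m where "m = nat (z mod int (Suc (length us + length ws)))"
  have m: "m < Suc (length us + length ws)" unfolding m_def by (simp add: nat_less_iff)
  have r: "rot z (gen (?w x)) = (psc ((-1) ^ (sdeg (take m (?w x)) * sdeg (drop m (?w x)))) (gen (drop m (?w x) @ take m (?w x))) :: ('v, 'k) chain)" for x
    by (simp add: rot_gen rot_w_def Let_def m_def)
  have "\<exists>us' ws' s. valid A us' \<and> valid A ws' \<and>
        (\<forall>x. rot z (gen (?w x)) = (psc s (gen (us' @ [(d, x)] @ ws')) :: ('v, 'k) chain))"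
  proof (cases "m \<le> length us")
    case True
    then show ?thesis unfolding r using v
      by (intro exI[of _ "drop m us"] exI[of _ "ws @ take m us"]
          exI[of _ "(- 1) ^ (sdeg (take m us) * (sdeg (drop m us) + (d + 1 + sdeg ws)))"] conjI) (simp_all add: valid_take_drop)
  next
    case False
    define q where "q = m - Suc (length us)"
    have q: "m = Suc (length us + q)" using False by (simp add: q_def)
    show ?thesis unfolding r using v
      by (intro exI[of _ "drop q ws @ us"] exI[of _ "take q ws"]
          exI[of _ "(- 1) ^ ((sdeg us + (d + 1 + sdeg (take q ws))) * sdeg (drop q ws))"] conjI) (simp_all add: valid_take_drop q)
  qed
  then obtain us' ws' s where "valid A us'" "valid A ws'"
    "\<forall>x. rot z (gen (?w x)) = (psc s (gen (us' @ [(d, x)] @ ws')) :: ('v, 'k) chain)"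
    by auto
  then show "letterwise A (rot z) us ws d"
    using letterwise_sameI by metis
qed auto

text \<open>Every generating relation is homogeneous in the word length. It therefore suffices to
  argue for a fixed length, where the operators are sums of rotations and
  \<open>front\<close>.\<close>

lemma lmap_trel_hom:
  assumes p: "p \<in> trel A" and f: "lmap f"
    and h: "\<And>L v. v \<in> hom L \<Longrightarrow> v \<in> trel A \<Longrightarrow> f v \<in> trel A"
  shows "f p \<in> trel A"
proof (rule lmap_trel[OF p f lspace_trel])
  fix us ws a c d assume v: "valid A us" "valid A ws" "a \<in> acomp A d" "c \<in> acomp A d"
  have "f (gen (us @ [(d, aadd A a c)] @ ws) - gen (us @ [(d, a)] @ ws) - gen (us @ [(d, c)] @ ws)) \<in> trel A"
    by (rule h[of _ "Suc (length us + length ws)"])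
      (use v in \<open>auto intro!: lspace_diff[OF lspace_hom] trel.trel_add[simplified]\<close>)
  then show "f (gen (us @ [(d, aadd A a c)] @ ws)) - f (gen (us @ [(d, a)] @ ws)) - f (gen (us @ [(d, c)] @ ws)) \<in> trel A"
    by (simp only: lmap_simps[OF f])
next
  fix us ws a k d assume v: "valid A us" "valid A ws" "a \<in> acomp A d"
  have "f (gen (us @ [(d, asmul A k a)] @ ws) - psc k (gen (us @ [(d, a)] @ ws))) \<in> trel A"
    by (rule h[of _ "Suc (length us + length ws)"])
      (use v in \<open>auto intro!: lspace_diff[OF lspace_hom] psc_hom trel.trel_smul[simplified]\<close>)
  then show "f (gen (us @ [(d, asmul A k a)] @ ws)) - psc k (f (gen (us @ [(d, a)] @ ws))) \<in> trel A"
    by (simp only: lmap_simps[OF f])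
qed

lemma bp_trel: "p \<in> trel A \<Longrightarrow> bp A p \<in> trel A"
  by (erule lmap_trel_hom[OF _ lmap_lin]) (auto simp: bp_hom intro!: lspace_sum[OF lspace_trel] rot_trel front_trel)

lemma bb_trel: "p \<in> trel A \<Longrightarrow> bb A p \<in> trel A"
  by (erule lmap_trel_hom[OF _ lmap_lin]) (auto simp: bb_hom intro!: lspace_sum[OF lspace_trel] rot_trel front_trel)

lemma N_trel: "p \<in> trel A \<Longrightarrow> lin N_w p \<in> trel A"
  by (erule lmap_trel_hom[OF _ lmap_lin]) (auto simp: N_hom intro!: lspace_sum[OF lspace_trel] rot_trel)

lemma lam_w_Nil [simp]: "lam_w [] = 0"
  by (simp add: lam_w_def)

lemma lam_trel: "p \<in> trel A \<Longrightarrow> lin lam_w p \<in> trel A"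
proof (erule lmap_trel_hom[OF _ lmap_lin])
  fix L and v :: "('v, 'k) chain" assume v: "v \<in> hom L" "v \<in> trel A"
  show "lin lam_w v \<in> trel A"
  proof (cases "L = 0")
    case True
    have "lin lam_w v = 0"
      by (rule hom_eqI[OF v(1) lmap_lin lmap_zero]) (simp add: True)
    then show ?thesis by (simp add: trel.trel_zero)
  next
    case False then show ?thesis using v by (simp add: lam_hom rot_trel)
  qed
qed

section \<open>The squares of the differentials vanish modulo the relations\<close>

definition lenpart :: "nat \<Rightarrow> ('v, 'k) chain \<Rightarrow> ('v, 'k) chain" where
  "lenpart L = lin (\<lambda>w. if length w = L then gen w else 0)"

lemma lenpart_hom: "v \<in> hom L \<Longrightarrow> lenpart M v = (if L = M then v else 0)"
  unfolding lenpart_def by (erule hom_eqI[OF _ lmap_lin]) (cases "L = M"; simp add: lmap_id lmap_zero)+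

lemma lenpart_trel: "p \<in> trel A \<Longrightarrow> lenpart L p \<in> trel A"
  by (rule lmap_trel_hom) (auto simp: lenpart_hom trel.trel_zero, auto simp: lenpart_def lmap_lin)

definition postfix :: "'v word \<Rightarrow> ('v, 'k) chain \<Rightarrow> ('v, 'k) chain" where
  "postfix v = lin (\<lambda>u. gen (u @ v))"

lemma lmap_postfix: "lmap (postfix v)"
  by (simp add: postfix_def lmap_lin)

lemma postfix_gen: "postfix v (gen u) = gen (u @ v)"
  by (simp add: postfix_def)

lemma postfix_trel:
  assumes v: "valid A v" and p: "p \<in> trel A" shows "postfix v p \<in> trel A"
proof (rule lmap_trel_letter[OF p lmap_postfix])
  fix us ws d assume u: "valid A us" "valid A ws"
  show "letterwise A (postfix v) us ws d"
    using u v by (intro letterwise_sameI[of A us "ws @ v" d _ _ _ 1]) (simp_all add: postfix_gen)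
qed auto

text \<open>For a single letter to remain, the second operation must consume everything that the
  first one leaves. So \<open>nested A n\<close> is exactly the part of length one of the square of
  \<open>b'\<close>.\<close>

lemma nested_trel_front:
  assumes u: "valid A u" "length u = n"
  shows "nested A n (gen u) \<in> trel A"
proof -
  have g: "gen u \<in> hom n" using u by simp
  have "lenpart 1 (bp A (bp A (gen u))) = nested A n (gen u)"
  proof -
    have "lenpart 1 (bp A (rot (- t) (front A j (rot t (gen u))))) = front A (Suc n - j) (rot (- t) (front A j (rot t (gen u))))"
      if j: "j \<in> {1..n}" for j t
    proof -
      let ?v = "rot (- t) (front A j (rot t (gen u)))"
      have v: "?v \<in> hom (Suc n - j)" using j by (intro rot_hom front_hom g) auto
      have "lenpart 1 (bp A ?v) = (\<Sum>i\<in>{1..Suc n - j}. \<Sum>y\<in>{0..int (Suc n - j) - int i}. lenpart 1 (rot (- y) (front A i (rot y ?v))))"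
        unfolding bp_hom[OF v] lenpart_def lin_simps ..
      also have "\<dots> = (\<Sum>i\<in>{1..Suc n - j}. if i = Suc n - j then front A i ?v else 0)"
      proof (rule sum.cong[OF refl])
        fix i assume i: "i \<in> {1..Suc n - j}"
        have "lenpart 1 (rot (- y) (front A i (rot y ?v))) = (if i = Suc n - j then rot (- y) (front A i (rot y ?v)) else 0)" for y
        proof -
          have "rot (- y) (front A i (rot y ?v)) \<in> hom (Suc (Suc n - j) - i)"
            using i by (intro rot_hom front_hom v) auto
          then show ?thesis using i by (auto simp: lenpart_hom)
        qed
        then show "(\<Sum>y\<in>{0..int (Suc n - j) - int i}. lenpart 1 (rot (- y) (front A i (rot y ?v)))) =
            (if i = Suc n - j then front A i ?v else 0)" by simp
      qed
      also have "\<dots> = front A (Suc n - j) ?v" using j by (subst sum.delta) auto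
      finally show ?thesis .
    qed
    then show ?thesis
      unfolding bp_hom[OF g] nested_def by (simp add: lin_simps lenpart_def)
  qed
  then show ?thesis
    using lenpart_trel[OF bp_bp_gen[OF u(1)], of 1] by simp
qed

text \<open>The Koszul sign of a contraction depends only on the letters before the block, so
  letters behind the first \<open>n\<close> are carried along unchanged.\<close>

lemma nested_postfix:
  assumes "length u = n"
  shows "nested A n (gen (u @ v)) = postfix v (nested A n (gen u))"
proof -
  have "front A (Suc n - j) (rot (- p) (front A j (rot p (gen (u @ v))))) =
      postfix v (front A (Suc n - j) (rot (- p) (front A j (rot p (gen u)))))"
    if jp: "j \<in> {1..n}" "p \<in> {0..int n - int j}" for j p
  proof -
    obtain t where t: "p = int t" using jp by (metis atLeastAtMost_iff nonneg_int_cases)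
    have tj: "1 \<le> j" "t + j \<le> length u" "t + j \<le> length (u @ v)" using jp t assms by auto
    obtain u1 blk u3 where u: "u = u1 @ blk @ u3" "length u1 = t" "length blk = j"
      using tj(2) by (rule word_split)
    have n: "Suc n - j = length (u1 @ [block_out A blk] @ u3)" using u assms by simp
    have ne: "u1 @ [block_out A blk] @ u3 \<noteq> []" by simp
    have 1: "rot (- p) (front A j (rot p (gen u))) = bterm A (u1 @ blk @ u3) (length u1) (length blk)"
      using bterm_rot[OF tj(1,2), of A] by (simp only: t u)
    have 2: "rot (- p) (front A j (rot p (gen (u @ v)))) = bterm A (u1 @ blk @ (u3 @ v)) (length u1) (length blk)"
      using bterm_rot[OF tj(1,3), of A] by (simp only: t u append_assoc)
    have 3: "front A (Suc n - j) (gen (u1 @ block_out A blk # u3 @ v)) = postfix v (front A (Suc n - j) (gen (u1 @ block_out A blk # u3)))"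
      using front_app[OF ne, of A v] front_app[OF ne, of A "[]"] unfolding n
      by (simp add: postfix_gen lmap_0[OF lmap_postfix])
    show ?thesis
      unfolding 1 2 unfolding bterm_app by (simp add: front_simps lmap_simps[OF lmap_postfix] 3)
  qed
  then show ?thesis
    by (simp add: nested_def lmap_simps[OF lmap_postfix])
qed

lemma nested_trel:
  assumes "valid A w" "n \<le> length w"
  shows "nested A n (gen w) \<in> trel A"
proof -
  have "nested A n (gen (take n w @ drop n w)) \<in> trel A"
    using assms by (simp only: nested_postfix length_take min_absorb2)
      (intro postfix_trel nested_trel_front valid_take_drop; simp add: valid_take_drop)
  then show ?thesis by simp
qed

lemma rot_valid:
  assumes "valid A w"
  obtains w' s where "rot z (gen w) = (psc s (gen w') :: ('v, 'k) chain)" "valid A w'" "length w' = length w"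
  using assms by (auto simp: rot_gen rot_w_def Let_def valid_take_drop intro!: that)

lemma lmap_nested: "lmap (nested A n)"
  by (rule lmapI) (simp_all add: nested_def front_simps rot_simps sum.distrib psc_sum)

lemma bb_bb_gen:
  assumes w: "valid A w" shows "bb A (bb A (gen w)) \<in> trel A"
proof -
  have "nested A n (rot z (gen w)) \<in> trel A" if "n \<in> {1..length w}" for n z
    using rot_valid[OF w, of z] that nested_trel[of _ n]
    by (metis lmap_psc[OF lmap_nested] trel_scal atLeastAtMost_iff)
  moreover have g: "gen w \<in> hom (length w)" by simp
  ultimately show ?thesis
    unfolding bb_bb[OF g] by (intro lspace_sum[OF lspace_trel] rot_trel)
qed

definition validsp :: "('v, 'k) chain set" where
  "validsp = {x. Poly_Mapping.keys x \<subseteq> {w. valid A w}}"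

lemma lspace_validsp: "lspace validsp"
  unfolding validsp_def by (rule lspace_keys)

lemma validsp_lmapI:
  assumes "x \<in> validsp" "lmap f" "lspace S" "\<And>w. valid A w \<Longrightarrow> f (gen w) \<in> S"
  shows "f x \<in> S"
  by (rule lspace_lmap_keys[OF assms(3,2)]) (use assms in \<open>auto simp: validsp_def\<close>)

lemma bb_bb_trel: "x \<in> validsp \<Longrightarrow> bb A (bb A x) \<in> trel A"
  by (rule validsp_lmapI[of x "\<lambda>x. bb A (bb A x)", OF _ lmap_compose[OF lmap_lin lmap_lin] lspace_trel bb_bb_gen])

lemma bp_bp_trel: "x \<in> validsp \<Longrightarrow> bp A (bp A x) \<in> trel A"
  by (rule validsp_lmapI[of x "\<lambda>x. bp A (bp A x)", OF _ lmap_compose[OF lmap_lin lmap_lin] lspace_trel bp_bp_gen])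

end

section \<open>Linear algebra in the carrier\<close>

context ainfinity
begin

abbreviation vadd (infixl "\<oplus>" 65) where "x \<oplus> y \<equiv> aadd A x y"
abbreviation vsmul (infixr "\<odot>" 70) where "k \<odot> x \<equiv> asmul A k x"
abbreviation vzero ("\<zero>") where "\<zero> \<equiv> azero A"

lemma v0 [simp]: "\<zero> \<in> acar A"
  and vadd_closed [simp]: "x \<in> acar A \<Longrightarrow> y \<in> acar A \<Longrightarrow> x \<oplus> y \<in> acar A"
  and vsmul_closed [simp]: "x \<in> acar A \<Longrightarrow> k \<odot> x \<in> acar A"
  and vadd_assoc: "x \<in> acar A \<Longrightarrow> y \<in> acar A \<Longrightarrow> z \<in> acar A \<Longrightarrow> (x \<oplus> y) \<oplus> z = x \<oplus> (y \<oplus> z)"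
  and vadd_comm: "x \<in> acar A \<Longrightarrow> y \<in> acar A \<Longrightarrow> x \<oplus> y = y \<oplus> x"
  and vadd_0 [simp]: "x \<in> acar A \<Longrightarrow> \<zero> \<oplus> x = x"
  and vsmul_add: "x \<in> acar A \<Longrightarrow> y \<in> acar A \<Longrightarrow> k \<odot> (x \<oplus> y) = k \<odot> x \<oplus> k \<odot> y"
  and vsmul_add_left: "x \<in> acar A \<Longrightarrow> (k + l) \<odot> x = k \<odot> x \<oplus> l \<odot> x"
  and vsmul_mult: "x \<in> acar A \<Longrightarrow> (k * l) \<odot> x = k \<odot> l \<odot> x"
  and vsmul_1 [simp]: "x \<in> acar A \<Longrightarrow> 1 \<odot> x = x"
  and vinv: "x \<in> acar A \<Longrightarrow> \<exists>y\<in>acar A. x \<oplus> y = \<zero>"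
  using vs unfolding vector_space_ax_def by metis+

lemma vadd_0_right [simp]: "x \<in> acar A \<Longrightarrow> x \<oplus> \<zero> = x"
  using vadd_comm[of x "\<zero>"] by simp

lemma vadd_left_comm: "x \<in> acar A \<Longrightarrow> y \<in> acar A \<Longrightarrow> z \<in> acar A \<Longrightarrow> x \<oplus> (y \<oplus> z) = y \<oplus> (x \<oplus> z)"
  by (metis vadd_assoc vadd_comm)

lemma vadd_cancel: "x \<in> acar A \<Longrightarrow> y \<in> acar A \<Longrightarrow> z \<in> acar A \<Longrightarrow> x \<oplus> y = x \<oplus> z \<longleftrightarrow> y = z"
  by (metis vadd_assoc vadd_comm vinv vadd_0)

lemma vsmul_0 [simp]: "x \<in> acar A \<Longrightarrow> 0 \<odot> x = \<zero>"
  using vsmul_add_left[of x 0 0] vadd_cancel[of "0 \<odot> x" "0 \<odot> x" "\<zero>"] by simp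

lemma vsmul_zero [simp]: "k \<odot> \<zero> = \<zero>"
  using vsmul_mult[of "\<zero>" k 0] by simp

lemma vminus [simp]: "x \<in> acar A \<Longrightarrow> x \<oplus> (- 1) \<odot> x = \<zero>" "x \<in> acar A \<Longrightarrow> (- 1) \<odot> x \<oplus> x = \<zero>"
  using vsmul_add_left[of x 1 "-1"] vsmul_add_left[of x "-1" 1] by simp_all

text \<open>Partial linear projections onto \<open>S\<close> are represented by their graphs, so
  that Zorn's lemma applies to inclusion; a maximal one is defined everywhere.\<close>

definition graph_of_projection :: "'v set \<Rightarrow> ('v \<times> 'v) set \<Rightarrow> bool" where
  "graph_of_projection S G \<longleftrightarrow> G \<subseteq> acar A \<times> S \<and> (\<forall>x\<in>S. (x, x) \<in> G) \<and>
     (\<forall>x y x' y'. (x, y) \<in> G \<longrightarrow> (x', y') \<in> G \<longrightarrow> (x \<oplus> x', y \<oplus> y') \<in> G) \<and>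
     (\<forall>k x y. (x, y) \<in> G \<longrightarrow> (k \<odot> x, k \<odot> y) \<in> G) \<and>
     (\<forall>x y y'. (x, y) \<in> G \<longrightarrow> (x, y') \<in> G \<longrightarrow> y = y')"

lemma graph_of_projectionD:
  assumes "graph_of_projection S G"
  shows "(x, y) \<in> G \<Longrightarrow> x \<in> acar A" "(x, y) \<in> G \<Longrightarrow> y \<in> S" "x \<in> S \<Longrightarrow> (x, x) \<in> G"
    "(x, y) \<in> G \<Longrightarrow> (x', y') \<in> G \<Longrightarrow> (x \<oplus> x', y \<oplus> y') \<in> G"
    "(x, y) \<in> G \<Longrightarrow> (k \<odot> x, k \<odot> y) \<in> G"
    "(x, y) \<in> G \<Longrightarrow> (x, y') \<in> G \<Longrightarrow> y = y'"
  using assms unfolding graph_of_projection_def by blast+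

text \<open>The projection is extended by sending the new vector \<open>v\<close> to zero. Two
  different coefficients of \<open>v\<close> in one element would put \<open>v\<close> into the old
  domain, so the value stays unique.\<close>

lemma graph_of_projection_extend:
  assumes S: "is_subspace A S" and G: "graph_of_projection S G" and v: "v \<in> acar A" "v \<notin> Domain G"
  shows "graph_of_projection S {(x \<oplus> c \<odot> v, y) | x y c. (x, y) \<in> G}" (is "graph_of_projection S ?G")
proof -
  note Gd = graph_of_projectionD[OF G]
  have Sa: "x \<in> S \<Longrightarrow> x \<in> acar A" for x using S by (auto simp: is_subspace_def)
  have sub: "(x, y) \<in> ?G" if "(x, y) \<in> G" for x y
    using that Gd(1)[OF that] v(1) by (auto intro!: exI[of _ x] exI[of _ 0])
  show ?thesis
    unfolding graph_of_projection_def
  proof (intro conjI allI impI ballI)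
    show "?G \<subseteq> acar A \<times> S" using Gd(1,2) v(1) by auto
    show "(x, x) \<in> ?G" if "x \<in> S" for x by (rule sub[OF Gd(3)[OF that]])
  next
    fix x y x' y' assume "(x, y) \<in> ?G" "(x', y') \<in> ?G"
    then obtain a c a' c' where *: "x = a \<oplus> c \<odot> v" "(a, y) \<in> G" "x' = a' \<oplus> c' \<odot> v" "(a', y') \<in> G" by auto
    have "x \<oplus> x' = (a \<oplus> a') \<oplus> (c + c') \<odot> v"
      using Gd(1)[OF *(2)] Gd(1)[OF *(4)] v(1)
      by (simp add: *(1,3) vsmul_add_left vadd_assoc vadd_left_comm vadd_comm)
    then show "(x \<oplus> x', y \<oplus> y') \<in> ?G" using Gd(4)[OF *(2,4)] by blast
  next
    fix k x y assume "(x, y) \<in> ?G"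
    then obtain a c where *: "x = a \<oplus> c \<odot> v" "(a, y) \<in> G" by auto
    have "k \<odot> x = k \<odot> a \<oplus> (k * c) \<odot> v"
      using Gd(1)[OF *(2)] v(1) by (simp add: *(1) vsmul_add vsmul_mult)
    then show "(k \<odot> x, k \<odot> y) \<in> ?G" using Gd(5)[OF *(2)] by blast
  next
    fix x y y' assume xy: "(x, y) \<in> ?G" and xy': "(x, y') \<in> ?G"
    from xy obtain a c where "x = a \<oplus> c \<odot> v" "(a, y) \<in> G" by auto
    moreover from xy' obtain a' c' where "x = a' \<oplus> c' \<odot> v" "(a', y') \<in> G" by auto
    ultimately have *: "x = a \<oplus> c \<odot> v" "(a, y) \<in> G" "x = a' \<oplus> c' \<odot> v" "(a', y') \<in> G" by auto
    have aa: "a \<in> acar A" "a' \<in> acar A" using Gd(1) * by blast+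
    have "c = c'"
    proof (rule ccontr)
      assume "c \<noteq> c'"
      have "a \<oplus> (c - c') \<odot> v \<oplus> c' \<odot> v = a \<oplus> c \<odot> v"
        using aa v(1) vsmul_add_left[of v "c - c'" c'] by (simp add: vadd_assoc)
      also have "\<dots> = a' \<oplus> c' \<odot> v" using * by simp
      finally have "a \<oplus> (c - c') \<odot> v = a'"
        using aa v(1) vadd_cancel[of "c' \<odot> v" "a \<oplus> (c - c') \<odot> v" a'] by (simp add: vadd_comm)
      then have "(c - c') \<odot> v = (- 1) \<odot> a \<oplus> a'"
        using aa v(1) vadd_assoc[of "(- 1) \<odot> a" a "(c - c') \<odot> v"] by auto
      then have "inverse (c - c') \<odot> ((- 1) \<odot> a \<oplus> a') = v"
        using v(1) \<open>c \<noteq> c'\<close> by (metis (no_types) vsmul_mult vsmul_1 left_inverse right_minus_eq)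
      then have "(v, inverse (c - c') \<odot> ((- 1) \<odot> y \<oplus> y')) \<in> G"
        using Gd(5)[OF Gd(4)[OF Gd(5)[OF *(2), of "-1"] *(4)], of "inverse (c - c')"] by simp
      then show False using v(2) by auto
    qed
    then have "a = a'"
      using * aa v(1) vadd_cancel[of "c \<odot> v" a a'] by (simp add: vadd_comm)
    then show "y = y'" using * Gd(6) by blast
  qed
qed

lemma projection_exists:
  assumes S: "is_subspace A S"
  obtains P where "\<And>x. x \<in> acar A \<Longrightarrow> P x \<in> S" "\<And>x. x \<in> S \<Longrightarrow> P x = x"
    "\<And>x y. x \<in> acar A \<Longrightarrow> y \<in> acar A \<Longrightarrow> P (x \<oplus> y) = P x \<oplus> P y"
    "\<And>k x. x \<in> acar A \<Longrightarrow> P (k \<odot> x) = k \<odot> P x"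
proof -
  have Sd: "S \<subseteq> acar A" "\<zero> \<in> S" "\<And>x y. x \<in> S \<Longrightarrow> y \<in> S \<Longrightarrow> x \<oplus> y \<in> S" "\<And>k x. x \<in> S \<Longrightarrow> k \<odot> x \<in> S"
    using S by (auto simp: is_subspace_def)
  have "\<exists>M\<in>Collect (graph_of_projection S). \<forall>X\<in>Collect (graph_of_projection S). M \<subseteq> X \<longrightarrow> X = M"
  proof (rule subset_Zorn_nonempty)
    have "graph_of_projection S {(x, x) | x. x \<in> S}"
      using Sd by (auto simp: graph_of_projection_def)
    then show "Collect (graph_of_projection S) \<noteq> {}" by auto
    fix C assume C: "C \<noteq> {}" "subset.chain (Collect (graph_of_projection S)) C"
    then have Cg: "G \<in> C \<Longrightarrow> graph_of_projection S G" for G by (auto simp: subset.chain_def)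
    have two: "\<exists>G\<in>C. p \<in> G \<and> q \<in> G" if "p \<in> \<Union>C" "q \<in> \<Union>C" for p q
      using that C(2) unfolding subset.chain_def by blast
    obtain G0 where G0: "G0 \<in> C" using C(1) by auto
    have "graph_of_projection S (\<Union>C)"
      unfolding graph_of_projection_def
    proof (intro conjI allI impI ballI)
      show "\<Union>C \<subseteq> acar A \<times> S" using graph_of_projectionD(1,2)[OF Cg] by auto
      show "(x, x) \<in> \<Union>C" if "x \<in> S" for x using graph_of_projectionD(3)[OF Cg[OF G0] that] G0 by auto
    next
      fix x y x' y' assume "(x, y) \<in> \<Union>C" "(x', y') \<in> \<Union>C"
      from two[OF this] show "(x \<oplus> x', y \<oplus> y') \<in> \<Union>C"
        using graph_of_projectionD(4)[OF Cg] by blast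
    next
      fix k x y assume "(x, y) \<in> \<Union>C"
      then show "(k \<odot> x, k \<odot> y) \<in> \<Union>C" using graph_of_projectionD(5)[OF Cg] by blast
    next
      fix x y y' assume "(x, y) \<in> \<Union>C" "(x, y') \<in> \<Union>C"
      from two[OF this] show "y = y'" using graph_of_projectionD(6)[OF Cg] by blast
    qed
    then show "\<Union>C \<in> Collect (graph_of_projection S)" by simp
  qed
  then obtain M where M: "graph_of_projection S M" "\<And>X. graph_of_projection S X \<Longrightarrow> M \<subseteq> X \<Longrightarrow> X = M"
    by blast
  note Md = graph_of_projectionD[OF M(1)]
  have total: "v \<in> Domain M" if v: "v \<in> acar A" for v
  proof (rule ccontr)
    assume nv: "v \<notin> Domain M"
    let ?G = "{(x \<oplus> c \<odot> v, y) | x y c. (x, y) \<in> M}"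
    have "M \<subseteq> ?G"
    proof
      fix p assume p: "p \<in> M"
      obtain x y where xy: "p = (x, y)" by (cases p)
      then have "x = x \<oplus> 0 \<odot> v" using Md(1) p v by simp
      then show "p \<in> ?G" using p xy by blast
    qed
    then have "?G = M" by (intro M(2) graph_of_projection_extend[OF S M(1) v nv])
    moreover have "(\<zero> \<oplus> 1 \<odot> v, \<zero>) \<in> ?G" using Md(3)[OF Sd(2)] by blast
    ultimately show False using nv v by auto
  qed
  define P where "P x = (THE y. (x, y) \<in> M)" for x
  have P: "(x, y) \<in> M \<Longrightarrow> P x = y" for x y
    unfolding P_def using Md(6) by blast
  have PM: "x \<in> acar A \<Longrightarrow> (x, P x) \<in> M" for x using total P by blast
  show thesis
  proof (rule that)
    show "P x \<in> S" if "x \<in> acar A" for x using Md(2) PM[OF that] by blast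
    show "P x = x" if "x \<in> S" for x by (rule P[OF Md(3)[OF that]])
    show "P (x \<oplus> y) = P x \<oplus> P y" if "x \<in> acar A" "y \<in> acar A" for x y
      by (rule P[OF Md(4)[OF PM PM]]) (fact that)+
    show "P (k \<odot> x) = k \<odot> P x" if "x \<in> acar A" for k x
      by (rule P[OF Md(5)[OF PM]]) (fact that)
  qed
qed

text \<open>A linear functional that does not vanish on \<open>x\<close>, extended by zero to all words, kills the relations.\<close>

lemma trel_letter:
  assumes x: "x \<in> acomp A d" and t: "gen [(d, x)] \<in> trel A"
  shows "x = \<zero>"
proof (rule ccontr)
  assume ne: "x \<noteq> \<zero>"
  have xa: "x \<in> acar A" using x by (rule acomp_acar)
  have "is_subspace A {c \<odot> x | c. True}"
    unfolding is_subspace_def using xa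
    by (auto simp flip: vsmul_add_left vsmul_mult) (use vsmul_0[OF xa] in metis)
  then obtain P where P: "\<And>a. a \<in> acar A \<Longrightarrow> P a \<in> {c \<odot> x | c. True}"
    "\<And>a. a \<in> {c \<odot> x | c. True} \<Longrightarrow> P a = a"
    "\<And>a b. a \<in> acar A \<Longrightarrow> b \<in> acar A \<Longrightarrow> P (a \<oplus> b) = P a \<oplus> P b"
    "\<And>k a. a \<in> acar A \<Longrightarrow> P (k \<odot> a) = k \<odot> P a"
    by (rule projection_exists) blast
  have inj: "c = c'" if "c \<odot> x = c' \<odot> x" for c c'
  proof (rule ccontr)
    assume "c \<noteq> c'"
    have "(c - c') \<odot> x \<oplus> c' \<odot> x = \<zero> \<oplus> c' \<odot> x"
      using that xa vsmul_add_left[of x "c - c'" c'] by simp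
    then have "(c - c') \<odot> x = \<zero>"
      using xa vadd_cancel[of "c' \<odot> x" "(c - c') \<odot> x" "\<zero>"] vadd_comm[of "c' \<odot> x" "(c - c') \<odot> x"] by simp
    then have "inverse (c - c') \<odot> (c - c') \<odot> x = \<zero>" by simp
    then show False using ne xa \<open>c \<noteq> c'\<close> by (simp flip: vsmul_mult)
  qed
  define \<phi> where "\<phi> a = (THE c. P a = c \<odot> x)" for a
  have \<phi>: "\<phi> a = c" if "P a = c \<odot> x" for a c
    unfolding \<phi>_def using that inj by (intro the_equality) auto
  have \<phi>P: "P a = \<phi> a \<odot> x" if "a \<in> acar A" for a
    using P(1)[OF that] \<phi> by auto
  have \<phi>_add: "\<phi> (a \<oplus> b) = \<phi> a + \<phi> b" if "a \<in> acar A" "b \<in> acar A" for a b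
    by (rule \<phi>) (use that P(3) \<phi>P xa in \<open>simp add: vsmul_add_left\<close>)
  have \<phi>_smul: "\<phi> (k \<odot> a) = k * \<phi> a" if "a \<in> acar A" for k a
    by (rule \<phi>) (use that P(4) \<phi>P xa in \<open>simp add: vsmul_mult\<close>)
  have "x \<in> {c \<odot> x | c. True}" using vsmul_1[OF xa] by (metis (mono_tags) mem_Collect_eq)
  then have \<phi>x: "\<phi> x = 1" by (intro \<phi>) (simp add: P(2) xa)
  \<comment> \<open>Operators produce chains, so the scalar values of the functional are encoded as
    multiples of the empty word.\<close>
  define h where "h w = (if length w = 1 \<and> fst (hd w) = d then psc (\<phi> (snd (hd w))) (gen []) else 0 :: ('v, 'k) chain)" for w :: "'v word"
  have hw: "h (us @ [(e, a)] @ ws) = (if us = [] \<and> ws = [] \<and> e = d then psc (\<phi> a) (gen []) else 0)" for us ws e a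
    by (auto simp: h_def)
  have "lin h (gen [(d, x)]) \<in> {0}"
  proof (rule lmap_trel[OF t lmap_lin])
    show "lspace {0 :: ('v, 'k) chain}" by (auto intro: lspaceI)
  qed (auto simp: hw acomp_acar \<phi>_add \<phi>_smul psc_add_left simp del: append.simps append_assoc append_Cons)
  then have "(gen [] :: ('v, 'k) chain) = 0" by (simp add: h_def \<phi>x)
  then have "Poly_Mapping.keys (gen [] :: ('v, 'k) chain) = {}" by simp
  then show False by simp
qed

section \<open>The relations of arity one and two as equations in \<open>A\<close>\<close>

lemma zero_letter_trel:
  assumes "valid A us" "valid A ws" shows "gen (us @ (d, \<zero>) # ws) \<in> trel A"
  using trel.trel_smul[OF assms, of "\<zero>" d 0] by simp

lemma amu_zero_letter:
  assumes "set xs \<subseteq> acar A" "\<zero> \<in> set xs" "n = length xs" shows "amu A n xs = \<zero>"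
proof -
  obtain us ws where "xs = us @ [0 \<odot> \<zero>] @ ws" using assms(2) by (metis append_Cons append_Nil split_list vsmul_zero)
  moreover from this have "amu A n (us @ [0 \<odot> \<zero>] @ ws) = 0 \<odot> amu A n (us @ [\<zero>] @ ws)"
    using assms by (intro amu_smul) auto
  moreover have "amu A n (us @ [\<zero>] @ ws) \<in> acar A"
    using assms calculation(1) by (intro amu_closed) auto
  ultimately show ?thesis by simp
qed

lemma front_singleton: "1 \<le> d \<Longrightarrow> front A 1 (gen [(d, a)]) = gen [(d - 1, amu A 1 [a])]"
  using front_app[of "[(d, a)]" A "[]"] by (simp add: block_out_def)

text \<open>This is the relation on a one-letter word; \<open>trel_letter\<close> brings it back
  from a statement modulo \<open>trel\<close> to an equation.\<close>

lemma m1_m1: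
  assumes a: "a \<in> acomp A d" and d: "2 \<le> d" shows "amu A 1 [amu A 1 [a]] = \<zero>"
proof (rule trel_letter)
  show "amu A 1 [amu A 1 [a]] \<in> acomp A (d - 2)"
    using block_out_comp[of "[(d, a)]"] block_out_comp[of "[(d - 1, amu A 1 [a])]"] a d by (simp add: block_out_def numeral_2_eq_2)
  have "nested A 1 (gen [(d, a)]) = front A 1 (front A 1 (gen [(d, a)]))"
    by (simp add: nested_def)
  also have "\<dots> = gen [(d - 2, amu A 1 [amu A 1 [a]])]"
    using d front_singleton[of d a] front_singleton[of "d - 1" "amu A 1 [a]"] by (simp add: numeral_2_eq_2)
  finally show "gen [(d - 2, amu A 1 [amu A 1 [a]])] \<in> trel A"
    using nested_trel[of "[(d, a)]" 1] a by simp
qed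

text \<open>This is the Leibniz rule applied to two cycles: in its terms with an inner
  \<open>m\<^sub>1\<close> a letter becomes zero, so the remaining term vanishes as well.\<close>

lemma m1_m2:
  assumes a: "a \<in> acomp A d" "b \<in> acomp A e" and z: "amu A 1 [a] = \<zero>" "amu A 1 [b] = \<zero>" and de: "1 \<le> d + e"
  shows "amu A 1 [amu A 2 [a, b]] = \<zero>"
proof (rule trel_letter)
  let ?w = "[(d, a), (e, b)]"
  have v: "valid A ?w" using a by simp
  have m: "block_out A ?w = (d + e, amu A 2 [a, b])" by (simp add: block_out_def numeral_2_eq_2)
  have c: "amu A 2 [a, b] \<in> acomp A (d + e)" using block_out_comp[OF v] m by simp
  then show "amu A 1 [amu A 2 [a, b]] \<in> acomp A (d + e - 1)"
    using block_out_comp[of "[(d + e, amu A 2 [a, b])]"] de by (simp add: block_out_def numeral_2_eq_2)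
  have b2: "front A 2 (gen ?w) = gen [(d + e, amu A 2 [a, b])]"
    using front_app[of ?w A "[]"] by (simp add: m numeral_2_eq_2)
  have "nested A 2 (gen ?w) = front A 2 (front A 1 (gen ?w)) + front A 2 (rot (- 1) (front A 1 (rot 1 (gen ?w)))) + front A 1 (front A 2 (gen ?w))"
  proof -
    have "{1..2::nat} = {1, 2}" "{0..1::int} = {0, 1}" by auto
    then show ?thesis by (simp add: nested_def numeral_2_eq_2)
  qed
  moreover have "front A 1 (gen ?w) \<in> trel A"
    using front_app[of "[(d, a)]" A "[(e, b)]"] zero_letter_trel[of "[]" "[(e, b)]" "d - 1"] a z
    by (auto simp: block_out_def numeral_2_eq_2 trel.trel_zero)
  moreover have "rot (- 1) (front A 1 (rot 1 (gen ?w))) \<in> trel A"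
    using bterm_rot[of 1 1 ?w A] bterm_app[of A "[(d, a)]" "[(e, b)]" "[]"] zero_letter_trel[of "[(d, a)]" "[]" "e - 1"] a z
    by (auto simp: block_out_def numeral_2_eq_2 trel.trel_zero intro: trel_scal)
  moreover have "nested A 2 (gen ?w) \<in> trel A" using v by (intro nested_trel) simp_all
  ultimately have "front A 1 (front A 2 (gen ?w)) \<in> trel A"
    using lspace_diff_iff[OF lspace_trel, of "nested A 2 (gen ?w)" "front A 1 (front A 2 (gen ?w))"]
    by (simp add: lspace_add[OF lspace_trel] front_trel)
  then show "gen [(d + e - 1, amu A 1 [amu A 2 [a, b]])] \<in> trel A"
    unfolding b2 using front_singleton[OF de, of "amu A 2 [a, b]"] by simp
qed

end

section \<open>The weight filtration\<close>

locale ainfinity_ideal = ainfinity A for A :: "('k::field_char_0, 'v) ainf" +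
  fixes I :: "'v set"
  assumes ideal: "ainf_ideal A I" and ideal_0: "I \<inter> acomp A 0 = {azero A}"
begin

lemma ideal_subspace: "is_subspace A I"
  and ideal_amu: "1 \<le> n \<Longrightarrow> length xs = n \<Longrightarrow> set xs \<subseteq> acar A \<Longrightarrow> x \<in> set xs \<Longrightarrow> x \<in> I \<Longrightarrow> amu A n xs \<in> I"
  using ideal unfolding ainf_ideal_def by blast+

lemma subspace_Int: "is_subspace A S \<Longrightarrow> is_subspace A T \<Longrightarrow> is_subspace A (S \<inter> T)"
  by (auto simp: is_subspace_def)

lemma subspace_closed:
  assumes "is_subspace A S"
  shows "x \<in> S \<Longrightarrow> x \<in> acar A" "\<zero> \<in> S" "x \<in> S \<Longrightarrow> y \<in> S \<Longrightarrow> x \<oplus> y \<in> S" "x \<in> S \<Longrightarrow> k \<odot> x \<in> S"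
  using assms by (auto simp: is_subspace_def)

definition Z :: "nat \<Rightarrow> 'v set" where
  "Z d = {a \<in> I \<inter> acomp A d. amu A 1 [a] = \<zero>}"

lemma subspace_Z: "is_subspace A (Z d)"
proof -
  note Id = subspace_closed[OF subspace_Int[OF ideal_subspace comp_subspace[of d]]]
  have "amu A 1 [x \<oplus> y] = \<zero>" if "x \<in> acar A" "y \<in> acar A" "amu A 1 [x] = \<zero>" "amu A 1 [y] = \<zero>" for x y
    using amu_add[of "[]" "[]" x y 1] that by simp
  moreover have "amu A 1 [k \<odot> x] = \<zero>" if "x \<in> acar A" "amu A 1 [x] = \<zero>" for x k
    using amu_smul[of "[]" "[]" x 1 k] that by simp
  moreover have "amu A 1 [\<zero>] = \<zero>" by (rule amu_zero_letter) auto
  ultimately show ?thesis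
    unfolding is_subspace_def Z_def using Id by auto
qed

text \<open>All operations are filtered, since the one of arity \<open>n\<close> raises the degree by \<open>n - 2\<close>: only arities one
  and two can reach the last two steps, and there the canonical truncation helps.\<close>

definition Lfilt :: "nat \<Rightarrow> nat \<Rightarrow> 'v set" where
  "Lfilt m d = (if m = 0 then acomp A d else if m < d then I \<inter> acomp A d else if m = d then Z d else {\<zero>})"

lemma subspace_Lfilt: "is_subspace A (Lfilt m d)"
proof -
  have "is_subspace A {\<zero>}" by (simp add: is_subspace_def)
  then show ?thesis
    using subspace_Z comp_subspace subspace_Int[OF ideal_subspace comp_subspace[of d]] by (simp add: Lfilt_def)
qed

lemmas Lfilt_closed = subspace_closed[OF subspace_Lfilt]

lemma Lfilt_Suc: "Lfilt (Suc m) d \<subseteq> Lfilt m d"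
  using Lfilt_closed(2)[of m d] by (auto simp: Lfilt_def Z_def)

lemma Lfilt_antimono: "m \<le> m' \<Longrightarrow> Lfilt m' d \<subseteq> Lfilt m d"
  using lift_Suc_antimono_le[of "\<lambda>m. Lfilt m d"] Lfilt_Suc by blast

lemma Lfilt_acomp: "Lfilt m d \<subseteq> acomp A d"
  using Lfilt_antimono[of 0 m d] by (simp add: Lfilt_def)

lemma Lfilt_big: "d < m \<Longrightarrow> Lfilt m d = {\<zero>}"
  by (simp add: Lfilt_def)

lemma amu_1_degree_1: "a \<in> acomp A 1 \<Longrightarrow> amu A 1 [a] \<in> acomp A 0"
  using block_out_comp[of "[(1, a)]"] by (simp add: block_out_def)

text \<open>Here \<open>I\<^sub>0 = 0\<close> enters. In degree 0 both sides are zero, and in degree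
  1 every element of \<open>I\<close> is a cycle because \<open>m\<^sub>1\<close> takes it to
  \<open>I\<^sub>0\<close>.\<close>

lemma Lfilt_1: "Lfilt 1 d = I \<inter> acomp A d"
proof (cases "d \<le> 1")
  case True
  then consider "d = 0" | "d = 1" by linarith
  then show ?thesis
  proof cases
    case 2
    have "amu A 1 [a] = \<zero>" if "a \<in> I \<inter> acomp A 1" for a
      using ideal_amu[of 1 "[a]" a] amu_1_degree_1[of a] that ideal_0 acomp_acar by auto
    then show ?thesis using 2 by (auto simp: Lfilt_def Z_def)
  qed (use ideal_0 in \<open>simp add: Lfilt_def\<close>)
qed (simp add: Lfilt_def)

text \<open>The steps of the filtration are nested, so membership does not determine a single weight
  of a letter. The list \<open>ks\<close> therefore chooses, for each letter, a step that contains
  it.\<close>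

definition weighted :: "nat list \<Rightarrow> 'v word \<Rightarrow> bool" where
  "weighted ks w \<longleftrightarrow> list_all2 (\<lambda>m l. snd l \<in> Lfilt m (fst l)) ks w"

lemma weighted_length: "weighted ks w \<Longrightarrow> length ks = length w"
  by (simp add: weighted_def list_all2_lengthD)

lemma weighted_Nil [simp]: "weighted [] w \<longleftrightarrow> w = []" "weighted ks [] \<longleftrightarrow> ks = []"
  by (simp_all add: weighted_def)

lemma weighted_Cons [simp]: "weighted (m # ks) (l # w) \<longleftrightarrow> snd l \<in> Lfilt m (fst l) \<and> weighted ks w"
  by (simp add: weighted_def)

lemma weighted_append: "length ks = length u \<Longrightarrow> weighted (ks @ ls) (u @ w) \<longleftrightarrow> weighted ks u \<and> weighted ls w"
  by (simp add: weighted_def list_all2_append)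

lemma weighted_take: "weighted ks w \<Longrightarrow> weighted (take m ks) (take m w)"
  and weighted_drop: "weighted ks w \<Longrightarrow> weighted (drop m ks) (drop m w)"
  by (simp_all add: weighted_def)

lemma weighted_valid: "weighted ks w \<Longrightarrow> valid A w"
  unfolding weighted_def by (induction ks w rule: list_all2_induct) (use Lfilt_acomp in auto)

lemma weighted_zero_weight: "valid A w \<Longrightarrow> weighted (replicate (length w) 0) w"
  by (induction w) (auto simp: Lfilt_def)

text \<open>A letter placed above its own degree can only be zero. This bound of the weight by the
  degree reduces multiplicativity to arities one and two, and it later makes the iteration finite in
  each degree.\<close>

lemma weighted_le_or_zero:
  assumes "weighted ks w"
  shows "sum_list ks \<le> sum_list (map fst w) \<or> \<zero> \<in> set (map snd w)"
  using assms unfolding weighted_def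
proof (induction ks w rule: list_all2_induct)
  case (Cons m ks l w)
  then show ?case using Lfilt_big[of "fst l" m] by (cases "fst l < m") auto
qed simp

lemma weighted_ideal:
  assumes "weighted ks w" "1 \<le> sum_list ks"
  shows "\<exists>x\<in>set (map snd w). x \<in> I"
  using assms unfolding weighted_def
proof (induction ks w rule: list_all2_induct)
  case (Cons m ks l w)
  then show ?case using Lfilt_antimono[of 1 m "fst l"] Lfilt_1[of "fst l"] by (cases "m = 0") auto
qed simp

text \<open>The case \<open>d = 0\<close> is separate: \<open>Lfilt 0 0\<close> is all of
  \<open>A\<^sub>0\<close> and not only the cycles of \<open>I\<close>, but there
  \<open>m\<^sub>1\<close> vanishes because its value would have negative degree.\<close>

lemma Z_amu: "a \<in> Lfilt d d \<Longrightarrow> amu A 1 [a] = \<zero>"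
proof (cases "d = 0")
  case True
  assume "a \<in> Lfilt d d"
  then have "valid A [(0, a)]" using True by (simp add: Lfilt_def)
  then show ?thesis using degree unfolding degree_ops_def Let_def by fastforce
qed (simp add: Lfilt_def Z_def)

text \<open>As long as the weight stays below the degree of the result, being an ideal is enough.
  Otherwise the arity is at most two. In arity one the input is a cycle, or its weight is one below
  its degree and the result has to be a cycle, by \<open>m1_m1\<close>. In arity two both inputs are
  cycles and \<open>m1_m2\<close> applies, or one of them lies above its degree and is zero.\<close>

lemma Lfilt_block_out:
  assumes w: "weighted ks w" and s: "2 \<le> sdeg w"
  shows "snd (block_out A w) \<in> Lfilt (sum_list ks) (fst (block_out A w))"
proof -
  have v: "valid A w" by (rule weighted_valid[OF w])
  have ne: "1 \<le> length w" using s by (cases w) auto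
  have c: "snd (block_out A w) \<in> acomp A (fst (block_out A w))" by (rule block_out_comp[OF v s])
  have a: "set (map snd w) \<subseteq> acar A" by (rule valid_acar[OF v])
  have d: "fst (block_out A w) = sum_list (map fst w) + length w - 2"
    by (simp add: block_out_def sdeg_conv)
  from weighted_le_or_zero[OF w] show ?thesis
  proof
    assume "\<zero> \<in> set (map snd w)"
    then have "snd (block_out A w) = \<zero>" using a by (simp add: block_out_def amu_zero_letter)
    then show ?thesis by (simp add: Lfilt_closed)
  next
    assume le: "sum_list ks \<le> sum_list (map fst w)"
    show ?thesis
    proof (cases "sum_list ks = 0")
      case False
      then have "1 \<le> sum_list ks" by linarith
      then obtain x where "x \<in> set (map snd w)" "x \<in> I" using weighted_ideal[OF w] by blast
      then have i: "snd (block_out A w) \<in> I \<inter> acomp A (fst (block_out A w))"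
        using c a ne ideal_amu[of "length w" "map snd w" x] by (simp add: block_out_def)
      show ?thesis
      proof (cases "sum_list ks < fst (block_out A w)")
        case True
        then show ?thesis using i False by (simp add: Lfilt_def)
      next
        case ge: False
        then have "length w \<le> 2" using d le s by linarith
        then consider "length w = 1" | "length w = 2" using ne by linarith
        then show ?thesis
        proof cases
          case 1
          then obtain l where wl: "w = [l]" by (auto simp: length_Suc_conv)
          then obtain m where ks: "ks = [m]" using weighted_length[OF w] by (auto simp: length_Suc_conv)
          have lm: "snd l \<in> Lfilt m (fst l)" using w wl ks by simp
          have f: "fst (block_out A w) = fst l - 1" "2 \<le> fst l + 1" "snd (block_out A w) = amu A 1 [snd l]"
            using wl s by (simp_all add: block_out_def)
          have m: "fst l - 1 \<le> m" "m \<le> fst l" "m \<noteq> 0" using ge le False f by (simp_all add: wl ks)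
          show ?thesis
          proof (cases "m = fst l")
            case True
            then have "snd (block_out A w) = \<zero>" using f Z_amu lm by simp
            then show ?thesis by (simp add: Lfilt_closed)
          next
            case ne: False
            then have "2 \<le> fst l" "m = fst l - 1" using m by linarith+
            moreover have "snd l \<in> acomp A (fst l)" using lm Lfilt_acomp by blast
            ultimately show ?thesis using m1_m1[of "snd l" "fst l"] i f(1,3) m(3)
              by (simp add: Lfilt_def Z_def ks)
          qed
        next
          case 2
          then obtain l l' where wl: "w = [l, l']" by (auto simp: length_Suc_conv numeral_2_eq_2)
          then obtain m m' where ks: "ks = [m, m']" using weighted_length[OF w] by (auto simp: length_Suc_conv)
          have lm: "snd l \<in> Lfilt m (fst l)" "snd l' \<in> Lfilt m' (fst l')" using w wl ks by simp_all
          have f: "fst (block_out A w) = fst l + fst l'" "snd (block_out A w) = amu A 2 [snd l, snd l']"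
            using wl by (simp_all add: block_out_def numeral_2_eq_2)
          show ?thesis
          proof (cases "m = fst l \<and> m' = fst l'")
            case True
            moreover have "snd l \<in> acomp A (fst l)" "snd l' \<in> acomp A (fst l')" using lm Lfilt_acomp by blast+
            moreover have "1 \<le> fst l + fst l'" using True False by (simp add: ks) linarith
            ultimately have "amu A 1 [amu A 2 [snd l, snd l']] = \<zero>"
              using m1_m2[of "snd l" "fst l" "snd l'" "fst l'"] Z_amu lm by simp
            then show ?thesis using i f True False by (auto simp: Lfilt_def Z_def ks)
          next
            case ne: False
            then have "fst l < m \<or> fst l' < m'" using ge f by (simp add: ks) linarith
            then have "snd l = \<zero> \<or> snd l' = \<zero>" using lm Lfilt_big by auto
            then have "snd (block_out A w) = \<zero>"
              unfolding f using a by (intro amu_zero_letter) (auto simp: wl)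
            then show ?thesis by (simp add: Lfilt_closed)
          qed
        qed
      qed
    qed (use c in \<open>simp add: Lfilt_def\<close>)
  qed
qed

section \<open>A linear operator acting as the weight on the graded pieces of
  \<open>A\<close>\<close>

definition weight_operator :: "nat \<Rightarrow> ('v \<Rightarrow> 'v) \<Rightarrow> bool" where
  "weight_operator d D \<longleftrightarrow> (\<forall>x\<in>acomp A d. D x \<in> acomp A d) \<and>
     (\<forall>x\<in>acomp A d. \<forall>y\<in>acomp A d. D (x \<oplus> y) = D x \<oplus> D y) \<and>
     (\<forall>k. \<forall>x\<in>acomp A d. D (k \<odot> x) = k \<odot> D x) \<and>
     (\<forall>m. \<forall>x\<in>Lfilt m d. D x \<oplus> (- of_nat m) \<odot> x \<in> Lfilt (Suc m) d)"

text \<open>With \<open>P\<close> projecting onto the part of \<open>I\<close> in degree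
  \<open>d\<close> and \<open>Q\<close> onto its cycles, the operator \<open>(d - 1) P + Q P\<close>
  is zero on a complement of \<open>I\<close>, is \<open>d - 1\<close> on a complement of the cycles
  in \<open>I\<close> and is \<open>d\<close> on the cycles. In degree 0, where the subtraction is
  truncated, \<open>P\<close> is zero.\<close>

lemma weight_operator_exists: "\<exists>D. weight_operator d D"
proof -
  obtain P where P: "\<And>x. x \<in> acar A \<Longrightarrow> P x \<in> Lfilt 1 d" "\<And>x. x \<in> Lfilt 1 d \<Longrightarrow> P x = x"
    "\<And>x y. x \<in> acar A \<Longrightarrow> y \<in> acar A \<Longrightarrow> P (x \<oplus> y) = P x \<oplus> P y"
    "\<And>k x. x \<in> acar A \<Longrightarrow> P (k \<odot> x) = k \<odot> P x"
    using projection_exists[OF subspace_Lfilt[of 1 d]] by blast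
  obtain Q where Q: "\<And>x. x \<in> acar A \<Longrightarrow> Q x \<in> Z d" "\<And>x. x \<in> Z d \<Longrightarrow> Q x = x"
    "\<And>x y. x \<in> acar A \<Longrightarrow> y \<in> acar A \<Longrightarrow> Q (x \<oplus> y) = Q x \<oplus> Q y"
    "\<And>k x. x \<in> acar A \<Longrightarrow> Q (k \<odot> x) = k \<odot> Q x"
    using projection_exists[OF subspace_Z[of d]] by blast
  have ZF: "Z d \<subseteq> Lfilt 1 d" using Lfilt_1[of d] by (auto simp: Z_def)
  have Pa: "x \<in> acar A \<Longrightarrow> P x \<in> acar A" for x using P(1) Lfilt_closed(1) by blast
  have Qa: "x \<in> acar A \<Longrightarrow> Q x \<in> acar A" for x using Q(1) subspace_closed(1)[OF subspace_Z] by blast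
  define D where "D x = of_nat (d - 1) \<odot> P x \<oplus> Q (P x)" for x
  have D1: "D x \<in> Lfilt 1 d" if "x \<in> acar A" for x
    unfolding D_def using P(1) Q(1) Pa that ZF by (intro Lfilt_closed(3,4)) auto
  have "D x \<oplus> (- of_nat m) \<odot> x \<in> Lfilt (Suc m) d" if x: "x \<in> Lfilt m d" for m x
  proof -
    have xa: "x \<in> acar A" by (rule Lfilt_closed(1)[OF x])
    consider "m = 0" | "1 \<le> m" "Suc m < d" | "1 \<le> m" "Suc m = d" | "1 \<le> m" "m = d" | "d < m" by linarith
    then show ?thesis
    proof cases
      case 1
      then show ?thesis using D1[OF xa] xa Lfilt_closed(1) by simp
    next
      \<comment> \<open>The filtration is constant from weight 1 to \<open>d - 1\<close>, so these
        graded pieces are zero and no cancellation is required.\<close>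
      case 2
      then have "Lfilt (Suc m) d = Lfilt 1 d" "Lfilt m d = Lfilt 1 d" by (simp_all add: Lfilt_def)
      then show ?thesis using D1[OF xa] x by (auto intro!: Lfilt_closed(3,4))
    next
      case 3
      then have "Lfilt m d = Lfilt 1 d" "Lfilt (Suc m) d = Z d" by (simp_all add: Lfilt_def)
      then have "P x = x" using P(2) x by simp
      moreover have "d - 1 = m" using 3 by simp
      ultimately have "D x \<oplus> (- of_nat m) \<odot> x = Q x \<oplus> (of_nat m + - of_nat m) \<odot> x"
        unfolding D_def using xa Qa by (simp only: vsmul_add_left vsmul_closed vadd_assoc vadd_left_comm vadd_comm)
      then show ?thesis using \<open>Lfilt (Suc m) d = Z d\<close> Q(1)[OF xa] Qa xa by simp
    next
      case 4
      then have "Lfilt m d = Z d" "Z d \<subseteq> Lfilt 1 d" using ZF by (simp_all add: Lfilt_def)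
      then have "P x = x" "Q x = x" using P(2) Q(2) x by auto
      then have "D x \<oplus> (- of_nat m) \<odot> x = (of_nat (d - 1) + 1 + - of_nat m) \<odot> x"
        unfolding D_def using xa by (simp add: vsmul_add_left del: add_uminus_conv_diff)
      also have "of_nat (d - 1) + 1 + - of_nat m = (0 :: 'k)" using 4 by (simp add: of_nat_diff)
      finally show ?thesis using xa by (simp add: Lfilt_closed)
    next
      case 5
      then have "x = \<zero>" using x Lfilt_big by auto
      moreover have "D \<zero> = \<zero>" unfolding D_def using P(2) Q(2) Lfilt_closed(2) subspace_closed(2)[OF subspace_Z] by simp
      ultimately show ?thesis by (simp add: Lfilt_closed)
    qed
  qed
  moreover have "D x \<in> acomp A d" if "x \<in> acomp A d" for x
    using D1[OF acomp_acar[OF that]] Lfilt_acomp by blast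
  moreover have "D (x \<oplus> y) = D x \<oplus> D y" if "x \<in> acomp A d" "y \<in> acomp A d" for x y
    using that[THEN acomp_acar] P(3) Q(3) Pa Qa
    by (simp add: D_def vsmul_add vadd_assoc vadd_left_comm vadd_comm)
  moreover have "D (k \<odot> x) = k \<odot> D x" if "x \<in> acomp A d" for k x
    using that[THEN acomp_acar] P(4) Q(4) Pa Qa by (simp add: D_def vsmul_add mult.commute flip: vsmul_mult)
  ultimately have "weight_operator d D" unfolding weight_operator_def by blast
  then show ?thesis by (rule exI[of _ D])
qed

definition D :: "nat \<Rightarrow> 'v \<Rightarrow> 'v" where
  "D d = (SOME D. weight_operator d D)"

lemma weight_operator_D: "weight_operator d (D d)"
  unfolding D_def by (rule someI_ex[OF weight_operator_exists])

lemma D_acomp: "x \<in> acomp A d \<Longrightarrow> D d x \<in> acomp A d"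
  and D_add: "x \<in> acomp A d \<Longrightarrow> y \<in> acomp A d \<Longrightarrow> D d (x \<oplus> y) = D d x \<oplus> D d y"
  and D_smul: "x \<in> acomp A d \<Longrightarrow> D d (k \<odot> x) = k \<odot> D d x"
  and D_weight: "x \<in> Lfilt m d \<Longrightarrow> D d x \<oplus> (- of_nat m) \<odot> x \<in> Lfilt (Suc m) d"
  using weight_operator_D[of d] unfolding weight_operator_def by blast+

end

section \<open>Congruence modulo a subspace\<close>

definition congr :: "('v, 'k::field) chain set \<Rightarrow> ('v, 'k) chain \<Rightarrow> ('v, 'k) chain \<Rightarrow> bool" where
  "congr S x y \<longleftrightarrow> x - y \<in> S"

lemma congr_refl: "lspace S \<Longrightarrow> congr S x x"
  by (simp add: congr_def lspace_0)

lemma congr_sym: "lspace S \<Longrightarrow> congr S x y \<Longrightarrow> congr S y x"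
  using lspace_minus[of S "x - y"] by (simp add: congr_def)

lemma congr_trans: "lspace S \<Longrightarrow> congr S x y \<Longrightarrow> congr S y z \<Longrightarrow> congr S x z"
  using lspace_add[of S "x - y" "y - z"] by (simp add: congr_def)

lemma congr_add: "lspace S \<Longrightarrow> congr S x y \<Longrightarrow> congr S x' y' \<Longrightarrow> congr S (x + x') (y + y')"
  using lspace_add[of S "x - y" "x' - y'"] by (simp add: congr_def algebra_simps)

lemma congr_psc: "lspace S \<Longrightarrow> congr S x y \<Longrightarrow> congr S (psc k x) (psc k y)"
  using lspace_psc[of S "x - y" k] by (simp add: congr_def psc_diff)

lemma congr_diff: "lspace S \<Longrightarrow> congr S x y \<Longrightarrow> congr S x' y' \<Longrightarrow> congr S (x - x') (y - y')"
  using lspace_diff[of S "x - y" "x' - y'"] by (simp add: congr_def algebra_simps)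

lemma congr_sum: "lspace S \<Longrightarrow> (\<And>i. i \<in> T \<Longrightarrow> congr S (f i) (g i)) \<Longrightarrow> congr S (sum f T) (sum g T)"
  by (simp add: congr_def lspace_sum flip: sum_subtractf)

lemma congr_lmap: "lmap f \<Longrightarrow> (\<And>x. x \<in> S \<Longrightarrow> f x \<in> S) \<Longrightarrow> congr S x y \<Longrightarrow> congr S (f x) (f y)"
  by (simp add: congr_def flip: lmap_diff)

lemma congr_mem: "lspace S \<Longrightarrow> congr S x y \<Longrightarrow> x \<in> S \<longleftrightarrow> y \<in> S"
  unfolding congr_def by (rule lspace_diff_iff)

lemma congr_0: "congr S x 0 \<longleftrightarrow> x \<in> S"
  by (simp add: congr_def)

section \<open>The filtration of the chains by weight\<close>

context ainfinity_ideal
begin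

text \<open>Since the relations belong to every step, a step is the preimage of a subspace of the
  tensor powers, and congruences modulo it may ignore multilinearity.\<close>

inductive_set Cfilt :: "nat \<Rightarrow> ('v, 'k) chain set" for k where
  Cfilt_trel: "p \<in> trel A \<Longrightarrow> p \<in> Cfilt k"
| Cfilt_gen: "weighted ks w \<Longrightarrow> k \<le> sum_list ks \<Longrightarrow> gen w \<in> Cfilt k"
| Cfilt_plus: "p \<in> Cfilt k \<Longrightarrow> q \<in> Cfilt k \<Longrightarrow> p + q \<in> Cfilt k"
| Cfilt_scal: "p \<in> Cfilt k \<Longrightarrow> psc c p \<in> Cfilt k"

lemma lspace_Cfilt: "lspace (Cfilt k)"
  by (rule lspaceI) (auto intro: Cfilt.intros trel.intros)

lemma lmap_Cfilt:
  assumes p: "p \<in> Cfilt k" and f: "lmap f" and S: "lspace S"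
    and t: "\<And>q. q \<in> trel A \<Longrightarrow> f q \<in> S"
    and g: "\<And>ks w. weighted ks w \<Longrightarrow> k \<le> sum_list ks \<Longrightarrow> f (gen w) \<in> S"
  shows "f p \<in> S"
  using p by (induction rule: Cfilt.induct) (auto simp: t g lmap_simps[OF f] lspace_add[OF S] lspace_psc[OF S])

lemma Cfilt_antimono: "k \<le> k' \<Longrightarrow> Cfilt k' \<subseteq> Cfilt k"
proof
  fix p assume k: "k \<le> k'" and p: "p \<in> Cfilt k'"
  show "p \<in> Cfilt k"
    by (rule lmap_Cfilt[OF p lmap_id lspace_Cfilt]) (use k in \<open>auto intro: Cfilt.intros\<close>)
qed

lemma Cfilt_lmapI:
  assumes "p \<in> Cfilt k" "lmap f" "\<And>q. q \<in> trel A \<Longrightarrow> f q \<in> trel A"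
    and "\<And>ks w. weighted ks w \<Longrightarrow> f (gen w) \<in> Cfilt (sum_list ks)"
  shows "f p \<in> Cfilt k"
  using assms(1,2) lspace_Cfilt
proof (rule lmap_Cfilt)
  fix ks w assume "weighted ks w" "k \<le> sum_list ks"
  then show "f (gen w) \<in> Cfilt k" using assms(4) Cfilt_antimono by blast
qed (use assms(3) Cfilt_trel in blast)

lemma rot_weighted:
  assumes w: "weighted ks w"
  obtains s w' where "rot z (gen w) = (psc s (gen w') :: ('v, 'k) chain)"
    "weighted (drop (nat (z mod int (length w))) ks @ take (nat (z mod int (length w))) ks) w'"
    "length w' = length w"
proof -
  let ?m = "nat (z mod int (length w))"
  have "weighted (drop ?m ks @ take ?m ks) (drop ?m w @ take ?m w)"
    using w by (simp add: weighted_append weighted_length weighted_take weighted_drop)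
  then show thesis
    by (intro that[of _ "drop ?m w @ take ?m w"]) (simp_all add: rot_gen rot_w_def Let_def)
qed

lemma sum_list_rotate: "sum_list (drop m ks @ take m ks) = sum_list (ks :: nat list)"
  by (metis add.commute append_take_drop_id sum_list_append)

lemma rot_Cfilt: "p \<in> Cfilt k \<Longrightarrow> rot z p \<in> Cfilt k"
proof (erule Cfilt_lmapI[OF _ lmap_rot rot_trel])
  fix ks w assume "weighted ks w"
  then obtain s w' where "rot z (gen w) = (psc s (gen w') :: ('v, 'k) chain)"
    "weighted (drop (nat (z mod int (length w))) ks @ take (nat (z mod int (length w))) ks) w'"
    by (rule rot_weighted)
  then show "rot z (gen w) \<in> Cfilt (sum_list ks)"
    by (simp add: Cfilt_scal Cfilt_gen sum_list_rotate del: sum_list_append)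
qed

lemma bterm_weighted:
  assumes w: "weighted ks w" and j: "t + j \<le> length w" "1 \<le> j"
  shows "bterm A w t j = 0 \<or> (\<exists>s w'. bterm A w t j = psc s (gen w') \<and>
    weighted (take t ks @ [sum_list (take j (drop t ks))] @ drop (t + j) ks) w')"
proof -
  define u blk v where "u = take t w" and "blk = take j (drop t w)" and "v = drop (t + j) w"
  have wu: "w = u @ blk @ v" "length u = t" "length blk = j"
    using j by (auto simp: u_def blk_def v_def add.commute simp flip: drop_drop)
  have "bterm A w t j = (if sdeg blk < 2 then 0 else psc ((-1) ^ sdeg u) (gen (u @ block_out A blk # v)))"
    using bterm_app[of A u blk v] wu by simp
  moreover have "weighted (take t ks @ [sum_list (take j (drop t ks))] @ drop (t + j) ks) (u @ block_out A blk # v)"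
    if "2 \<le> sdeg blk"
  proof -
    have "snd (block_out A blk) \<in> Lfilt (sum_list (take j (drop t ks))) (fst (block_out A blk))"
      using Lfilt_block_out[OF weighted_take[OF weighted_drop[OF w]]] that unfolding blk_def by blast
    then show ?thesis
      using weighted_take[OF w, of t] weighted_drop[OF w, of "t + j"] weighted_length[OF w]
      by (simp add: weighted_append u_def v_def)
  qed
  ultimately show ?thesis by auto
qed

lemma front_weighted_eq: "1 \<le> j \<Longrightarrow> j \<le> length w \<Longrightarrow> front A j (gen w) = bterm A w 0 j"
  by (simp add: front_def front_w_def)

lemma sum_list_block: "sum_list (take t ks @ [sum_list (take j (drop t ks))] @ drop (t + j) ks) = sum_list (ks :: nat list)"
proof -
  have "ks = take t ks @ take j (drop t ks) @ drop (t + j) ks"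
    by (metis add.commute append_take_drop_id drop_drop)
  then have "sum_list ks = sum_list (take t ks @ take j (drop t ks) @ drop (t + j) ks)" by simp
  then show ?thesis by simp
qed

lemma bterm_Cfilt: "weighted ks w \<Longrightarrow> t + j \<le> length w \<Longrightarrow> 1 \<le> j \<Longrightarrow> bterm A w t j \<in> Cfilt (sum_list ks)"
  using bterm_weighted[of ks w t j] sum_list_block[of t ks j]
  by (auto simp: lspace_0[OF lspace_Cfilt] intro!: Cfilt_scal Cfilt_gen simp del: sum_list_append)

lemma front_Cfilt: "p \<in> Cfilt k \<Longrightarrow> front A j p \<in> Cfilt k"
proof (erule Cfilt_lmapI[OF _ lmap_front front_trel])
  fix ks w assume "weighted ks w"
  then show "front A j (gen w) \<in> Cfilt (sum_list ks)"
    using bterm_Cfilt[of ks w 0 j] by (simp add: front_def front_w_def lspace_0[OF lspace_Cfilt])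
qed

text \<open>The generating relations and the weighted words are both homogeneous in length, so one
  formula for fixed length shows at once that the relations and all filtration steps are
  preserved.\<close>

lemma Cfilt_lmap_homI:
  assumes p: "p \<in> Cfilt k" and f: "lmap f"
    and h: "\<And>L v S. v \<in> hom L \<Longrightarrow> v \<in> S \<Longrightarrow> S = trel A \<or> (\<exists>k. S = Cfilt k) \<Longrightarrow> f v \<in> S"
  shows "f p \<in> Cfilt k"
proof (rule Cfilt_lmapI[OF p f])
  show "f q \<in> trel A" if "q \<in> trel A" for q
    by (rule lmap_trel_hom[OF that f]) (use h in blast)
  show "f (gen w) \<in> Cfilt (sum_list ks)" if "weighted ks w" for ks w
    by (rule h[of _ "length w"]) (use that Cfilt_gen in auto)
qed

lemma lspace_trel_Cfilt: "S = trel A \<or> (\<exists>k. S = Cfilt k) \<Longrightarrow> lspace S"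
  and rot_trel_Cfilt: "S = trel A \<or> (\<exists>k. S = Cfilt k) \<Longrightarrow> p \<in> S \<Longrightarrow> rot z p \<in> S"
  and front_trel_Cfilt: "S = trel A \<or> (\<exists>k. S = Cfilt k) \<Longrightarrow> p \<in> S \<Longrightarrow> front A j p \<in> S"
  using lspace_trel lspace_Cfilt rot_trel rot_Cfilt front_trel front_Cfilt by blast+

lemma bp_Cfilt: "p \<in> Cfilt k \<Longrightarrow> bp A p \<in> Cfilt k"
  by (erule Cfilt_lmap_homI[OF _ lmap_lin])
    (simp add: bp_hom lspace_sum lspace_trel_Cfilt rot_trel_Cfilt front_trel_Cfilt)

lemma bb_Cfilt: "p \<in> Cfilt k \<Longrightarrow> bb A p \<in> Cfilt k"
  by (erule Cfilt_lmap_homI[OF _ lmap_lin])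
    (simp add: bb_hom lspace_sum lspace_trel_Cfilt rot_trel_Cfilt front_trel_Cfilt)

lemma N_Cfilt: "p \<in> Cfilt k \<Longrightarrow> lin N_w p \<in> Cfilt k"
  by (erule Cfilt_lmap_homI[OF _ lmap_lin])
    (simp add: N_hom lspace_sum lspace_trel_Cfilt rot_trel_Cfilt)

lemma lam_Nil_hom: "v \<in> hom 0 \<Longrightarrow> lin lam_w v = 0"
  by (erule hom_eqI[OF _ lmap_lin lmap_zero]) simp

lemma lam_Cfilt: "p \<in> Cfilt k \<Longrightarrow> lin lam_w p \<in> Cfilt k"
proof (erule Cfilt_lmap_homI[OF _ lmap_lin])
  fix L S and v :: "('v, 'k) chain" assume "v \<in> hom L" "v \<in> S" "S = trel A \<or> (\<exists>k. S = Cfilt k)"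
  then show "lin lam_w v \<in> S"
    by (cases "L = 0") (simp_all add: lam_Nil_hom lam_hom rot_trel_Cfilt lspace_0 lspace_trel_Cfilt)
qed

section \<open>Contraction of the rows and the operators built from \<open>D\<close>\<close>

definition avg :: "('v, 'k) chain \<Rightarrow> ('v, 'k) chain" where
  "avg = lin (\<lambda>w. psc (1 / of_nat (length w)) (gen w))"

text \<open>This is the classical contraction of the cyclic rows: on words of length
  \<open>L\<close> the operator \<open>1 - N / L\<close> is the average of the
  \<open>1 - \<lambda>\<^sup>i\<close>, and dividing each of them by \<open>1 - \<lambda>\<close>
  gives the inner sum. The division by \<open>L\<close> uses characteristic zero.\<close>

definition contr :: "('v, 'k) chain \<Rightarrow> ('v, 'k) chain" where
  "contr = lin (\<lambda>w. psc (1 / of_nat (length w)) (\<Sum>i<length w. \<Sum>l<i. rot (- int l) (gen w)))"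

definition Dhead :: "('v, 'k) chain \<Rightarrow> ('v, 'k) chain" where
  "Dhead = lin (\<lambda>w. case w of [] \<Rightarrow> 0 | l # r \<Rightarrow> gen ((fst l, D (fst l) (snd l)) # r))"

definition Dsum :: "('v, 'k) chain \<Rightarrow> ('v, 'k) chain" where
  "Dsum = lin (\<lambda>w. \<Sum>i\<in>{0..<int (length w)}. rot (- i) (Dhead (rot i (gen w))))"

lemma lmap_avg: "lmap avg" and lmap_contr: "lmap contr" and lmap_Dhead: "lmap Dhead" and lmap_Dsum: "lmap Dsum"
  by (simp_all add: avg_def contr_def Dhead_def Dsum_def lmap_lin)

lemmas op_simps = lmap_simps[OF lmap_avg] lmap_simps[OF lmap_contr] lmap_simps[OF lmap_Dhead] lmap_simps[OF lmap_Dsum]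

lemma avg_hom: "v \<in> hom L \<Longrightarrow> avg v = psc (1 / of_nat L) v"
  unfolding avg_def by (erule hom_eqI[OF _ lmap_lin]) (auto intro: lmap_comb lmap_id)

lemma contr_hom: "v \<in> hom L \<Longrightarrow> contr v = psc (1 / of_nat L) (\<Sum>i<L. \<Sum>l<i. rot (- int l) v)"
  unfolding contr_def by (erule hom_eqI[OF _ lmap_lin]) (auto intro!: lmap_comb(4) lmap_setsum lmap_rot)

lemma Dsum_hom: "v \<in> hom L \<Longrightarrow> Dsum v = (\<Sum>i\<in>{0..<int L}. rot (- i) (Dhead (rot i v)))"
proof (unfold Dsum_def, erule hom_eqI[OF _ lmap_lin])
  show "lmap (\<lambda>v. \<Sum>i\<in>{0..<int L}. rot (- i) (Dhead (rot i v)))"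
    by (rule lmapI) (simp_all add: rot_simps op_simps sum.distrib psc_sum)
qed simp

lemma Dhead_hom: "v \<in> hom L \<Longrightarrow> Dhead v \<in> hom L"
  by (erule hom_lmapI[OF _ lmap_Dhead]) (auto simp: Dhead_def lspace_hom lspace_0[OF lspace_hom] split: list.splits)

lemma Dhead_Cons: "Dhead (gen (l # r)) = gen ((fst l, D (fst l) (snd l)) # r)"
  by (simp add: Dhead_def)

lemma Dhead_trel:
  assumes p: "p \<in> trel A" shows "Dhead p \<in> trel A"
proof (rule lmap_trel_letter[OF p lmap_Dhead])
  fix us ws d assume v: "valid A us" "valid A ws"
  show "letterwise A Dhead us ws d"
  proof (cases us)
    case Nil
    then show ?thesis using v
      by (intro letterwiseI[of A "[]" ws d _ _ _ 1 d "D d"]) (simp_all add: Dhead_Cons D_acomp D_add D_smul)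
  next
    case (Cons l r)
    then show ?thesis using v
      by (intro letterwise_sameI[of A "(fst l, D (fst l) (snd l)) # r" ws d _ _ _ 1]) (simp_all add: Dhead_Cons D_acomp)
  qed
qed auto

text \<open>By multilinearity the difference is the word whose first letter is \<open>D d x\<close>
  minus \<open>m\<close> times \<open>x\<close>, and this letter has gained one weight.\<close>

lemma Dhead_weight:
  assumes w: "weighted (m # ks) w"
  shows "congr (Cfilt (Suc (m + sum_list ks))) (Dhead (gen w)) (psc (of_nat m) (gen w))"
proof -
  obtain d x r where wr: "w = (d, x) # r" using w by (cases w) auto
  have x: "x \<in> Lfilt m d" and r: "weighted ks r" using w by (simp_all add: wr)
  have xa: "x \<in> acomp A d" using x Lfilt_acomp by blast
  have vr: "valid A r" by (rule weighted_valid[OF r])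
  let ?y = "(- of_nat m) \<odot> x"
  have "gen ([] @ [(d, D d x \<oplus> ?y)] @ r) - gen ([] @ [(d, D d x)] @ r) - gen ([] @ [(d, ?y)] @ r) \<in> trel A"
    by (intro trel.trel_add) (simp_all add: vr xa D_acomp)
  moreover have "gen ([] @ [(d, ?y)] @ r) - psc (- of_nat m) (gen ([] @ [(d, x)] @ r)) \<in> trel A"
    by (intro trel.trel_smul) (simp_all add: vr xa)
  ultimately have "(gen ((d, D d x \<oplus> ?y) # r) - gen ((d, D d x) # r) - gen ((d, ?y) # r)) +
      (gen ((d, ?y) # r) - psc (- of_nat m) (gen ((d, x) # r))) \<in> Cfilt (Suc (m + sum_list ks))"
    by (intro Cfilt_trel trel_plus) simp_all
  moreover have "gen ((d, D d x \<oplus> ?y) # r) \<in> Cfilt (Suc (m + sum_list ks))"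
    using D_weight[OF x] r by (intro Cfilt_gen[of "Suc m # ks"]) simp_all
  ultimately have "gen ((d, D d x \<oplus> ?y) # r) - ((gen ((d, D d x \<oplus> ?y) # r) - gen ((d, D d x) # r) - gen ((d, ?y) # r)) +
      (gen ((d, ?y) # r) - psc (- of_nat m) (gen ((d, x) # r)))) \<in> Cfilt (Suc (m + sum_list ks))"
    by (intro lspace_diff[OF lspace_Cfilt])
  then show ?thesis by (simp add: congr_def wr Dhead_Cons psc_minus_left)
qed

lemma Dhead_Cfilt: "p \<in> Cfilt k \<Longrightarrow> Dhead p \<in> Cfilt k"
proof (erule Cfilt_lmapI[OF _ lmap_Dhead Dhead_trel])
  fix ks w assume w: "weighted ks w"
  show "Dhead (gen w) \<in> Cfilt (sum_list ks)"
  proof (cases ks)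
    case Nil
    then have "Dhead (gen w) = 0" using w by (simp add: Dhead_def)
    then show ?thesis by (simp add: lspace_0[OF lspace_Cfilt])
  next
    case (Cons m ls)
    have "congr (Cfilt (sum_list ks)) (Dhead (gen w)) (psc (of_nat m) (gen w))"
      using Dhead_weight[of m ls w] w Cfilt_antimono[of "sum_list ks" "Suc (sum_list ks)"] by (auto simp: congr_def Cons)
    then show ?thesis
      using congr_mem[OF lspace_Cfilt] w by (auto intro: Cfilt_scal Cfilt_gen)
  qed
qed

lemma avg_Cfilt: "p \<in> Cfilt k \<Longrightarrow> avg p \<in> Cfilt k"
  by (erule Cfilt_lmap_homI[OF _ lmap_avg]) (simp add: avg_hom lspace_psc lspace_trel_Cfilt)

lemma contr_Cfilt: "p \<in> Cfilt k \<Longrightarrow> contr p \<in> Cfilt k"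
  by (erule Cfilt_lmap_homI[OF _ lmap_contr]) (simp add: contr_hom lspace_sum lspace_psc lspace_trel_Cfilt rot_trel_Cfilt)

lemma Dhead_trel_Cfilt: "S = trel A \<or> (\<exists>k. S = Cfilt k) \<Longrightarrow> p \<in> S \<Longrightarrow> Dhead p \<in> S"
  using Dhead_trel Dhead_Cfilt by blast

lemma Dsum_Cfilt: "p \<in> Cfilt k \<Longrightarrow> Dsum p \<in> Cfilt k"
  by (erule Cfilt_lmap_homI[OF _ lmap_Dsum]) (simp add: Dsum_hom lspace_sum lspace_trel_Cfilt rot_trel_Cfilt Dhead_trel_Cfilt)

lemma Dsum_trel: "p \<in> trel A \<Longrightarrow> Dsum p \<in> trel A"
  by (erule lmap_trel_hom[OF _ lmap_Dsum]) (auto simp: Dsum_hom intro!: lspace_sum[OF lspace_trel] rot_trel Dhead_trel)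

end

section \<open>The Cartan-type homotopy\<close>

context ainfinity_ideal
begin

text \<open>The identity \<open>(1 - \<lambda>) contr = 1 - N avg\<close> fails on the empty word,
  where \<open>\<lambda>\<close> and \<open>N\<close> are zero. Chains of weight at least 1 avoid it
  automatically, see \<open>Cfilt_nonemptysp\<close>.\<close>

definition nonemptysp :: "('v, 'k) chain set" where
  "nonemptysp = {x. Poly_Mapping.keys x \<subseteq> {w. valid A w \<and> w \<noteq> []}}"

lemma lspace_nonemptysp: "lspace nonemptysp"
  unfolding nonemptysp_def by (rule lspace_keys)

lemma gen_nonemptysp [simp]: "gen w \<in> nonemptysp \<longleftrightarrow> valid A w \<and> w \<noteq> []"
  by (simp add: nonemptysp_def)

lemma nonemptysp_validsp: "x \<in> nonemptysp \<Longrightarrow> x \<in> validsp"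
  by (auto simp: nonemptysp_def validsp_def)

lemma trel_nonemptysp: "p \<in> trel A \<Longrightarrow> p \<in> nonemptysp"
proof (erule lmap_trel[OF _ lmap_id lspace_nonemptysp])
  fix us ws a c d assume "valid A us" "valid A ws" "a \<in> acomp A d" "c \<in> acomp A d"
  then show "gen (us @ [(d, a \<oplus> c)] @ ws) - gen (us @ [(d, a)] @ ws) - gen (us @ [(d, c)] @ ws) \<in> nonemptysp"
    by (intro lspace_diff[OF lspace_nonemptysp]) simp_all
next
  fix us ws a k d assume "valid A us" "valid A ws" "a \<in> acomp A d"
  then show "gen (us @ [(d, k \<odot> a)] @ ws) - psc k (gen (us @ [(d, a)] @ ws)) \<in> nonemptysp"
    by (intro lspace_diff[OF lspace_nonemptysp] lspace_psc[OF lspace_nonemptysp]) simp_all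
qed

lemma Cfilt_nonemptysp: "p \<in> Cfilt k \<Longrightarrow> 1 \<le> k \<Longrightarrow> p \<in> nonemptysp"
  by (erule lmap_Cfilt[OF _ lmap_id lspace_nonemptysp]) (auto simp: trel_nonemptysp intro: weighted_valid)

lemma nonemptysp_eqI:
  assumes "x \<in> nonemptysp" "lmap f" "lmap g" "\<And>L v. v \<in> hom L \<Longrightarrow> 0 < L \<Longrightarrow> f v = g v"
  shows "f x = g x"
proof (rule lmap_eqI[OF assms(2,3)])
  fix w assume "w \<in> Poly_Mapping.keys x"
  then show "f (gen w) = g (gen w)"
    using assms(1) by (intro assms(4)[of _ "length w"]) (auto simp: nonemptysp_def)
qed

lemma lam_one_hom:
  assumes v: "v \<in> hom L" "0 < L"
  shows "contr v - lin lam_w (contr v) = v - lin N_w (avg v)"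
    and "contr (v - lin lam_w v) = v - lin N_w (avg v)"
proof -
  have tel: "(\<Sum>l<i. rot (- int l) v - rot (- 1 - int l) v) = v - rot (- int i) v" for i
    by (induction i) (simp_all add: algebra_simps)
  have cv: "contr v \<in> hom L"
    unfolding contr_hom[OF v(1)] by (intro psc_hom lspace_sum[OF lspace_hom] rot_hom v)
  have "(\<Sum>s\<in>{0..<int L}. rot s v) = (\<Sum>s\<in>{1 - int L..<1 - int L + int L}. rot s v)"
    by (rule sum_periodic[symmetric]) (rule rot_hom_periodic[OF v(1)], simp)
  also have "\<dots> = (\<Sum>i<L. rot (- int i) v)"
    by (rule sum.reindex_bij_witness[of _ "\<lambda>s. - int s" "\<lambda>x. nat (- x)"]) auto
  finally have N: "lin N_w (avg v) = psc (1 / of_nat L) (\<Sum>i<L. rot (- int i) v)"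
    by (simp add: avg_hom[OF v(1)] lin_simps N_hom[OF v(1)])
  have 1: "v - lin N_w (avg v) = psc (1 / of_nat L) (\<Sum>i<L. v - rot (- int i) v)"
  proof -
    have "psc (1 / of_nat L) (\<Sum>i<L. v) = v"
      using v(2) by (simp flip: psc_of_nat)
    then show ?thesis by (simp add: N sum_subtractf psc_diff)
  qed
  show "contr v - lin lam_w (contr v) = v - lin N_w (avg v)"
    unfolding 1 lam_hom[OF cv v(2)] unfolding contr_hom[OF v(1)]
    by (simp add: rot_simps rot_rot flip: psc_diff sum_subtractf tel)
  have lv: "v - rot (- 1) v \<in> hom L" by (intro lspace_diff[OF lspace_hom] rot_hom v)
  show "contr (v - lin lam_w v) = v - lin N_w (avg v)"
    unfolding 1 lam_hom[OF v] contr_hom[OF lv]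
    by (simp add: rot_simps rot_rot minus_diff_commute flip: tel)
qed

lemma contr_lam: "x \<in> nonemptysp \<Longrightarrow> contr x - lin lam_w (contr x) = x - lin N_w (avg x)"
  by (erule nonemptysp_eqI) (simp_all add: lam_one_hom lmapI lin_simps op_simps psc_diff algebra_simps)

lemma contr_one_minus_lam: "x \<in> nonemptysp \<Longrightarrow> contr (x - lin lam_w x) = x - lin N_w (avg x)"
  by (erule nonemptysp_eqI) (simp_all only: lam_one_hom(2), (rule lmapI; simp add: lin_simps op_simps psc_diff algebra_simps)+)

lemma N_hom_hom: "v \<in> hom L \<Longrightarrow> lin N_w v \<in> hom L"
  by (simp add: N_hom lspace_sum lspace_hom rot_hom)

lemma avg_N: "x \<in> nonemptysp \<Longrightarrow> avg (lin N_w x) = lin N_w (avg x)"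
  by (erule nonemptysp_eqI) (simp_all add: N_hom_hom avg_hom lin_simps lmapI op_simps)

lemma N_one_minus_lam: "x \<in> nonemptysp \<Longrightarrow> lin N_w (x - lin lam_w x) = 0"
proof (erule nonemptysp_eqI[where g = "\<lambda>_. 0"])
  fix L and v :: "('v, 'k) chain" assume v: "v \<in> hom L" "0 < L"
  have "(\<Sum>s\<in>{0..<int L}. rot (s + - 1) v) = (\<Sum>s\<in>{0..<int L}. rot s v)"
    by (rule sum_periodic_shift) (rule rot_hom_periodic[OF v(1)], simp)
  then show "lin N_w (v - lin lam_w v) = 0"
    unfolding lam_hom[OF v] lin_simps N_hom[OF v(1)] N_hom[OF rot_hom[OF v(1)]] by (simp add: rot_rot)
qed (simp_all add: lmapI lin_simps lmap_zero psc_diff algebra_simps)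

lemma rot_N_hom: "v \<in> hom L \<Longrightarrow> rot z (lin N_w v) = lin N_w v"
proof -
  assume v: "v \<in> hom L"
  have "(\<Sum>s\<in>{0..<int L}. rot (s + z) v) = (\<Sum>s\<in>{0..<int L}. rot s v)"
    by (rule sum_periodic_shift) (rule rot_hom_periodic[OF v], simp)
  then show ?thesis by (simp add: N_hom[OF v] rot_simps rot_rot add.commute)
qed

lemma N_rot_hom: "v \<in> hom L \<Longrightarrow> lin N_w (rot z v) = lin N_w v"
proof -
  assume v: "v \<in> hom L"
  have "(\<Sum>s\<in>{0..<int L}. rot (s + z) v) = (\<Sum>s\<in>{0..<int L}. rot s v)"
    by (rule sum_periodic_shift) (rule rot_hom_periodic[OF v], simp)
  then show ?thesis by (simp add: N_hom[OF v] N_hom[OF rot_hom[OF v]] rot_rot)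
qed

text \<open>On an invariant chain the conjugates of \<open>Dhead\<close> are the rotations of one
  single chain, so their sum is \<open>N\<close> of it. Dually, \<open>N\<close> absorbs the outer
  rotations of the conjugates.\<close>

lemma N_Dhead_N:
  assumes x: "x \<in> nonemptysp"
  shows "lin N_w (Dhead (lin N_w x)) = Dsum (lin N_w x)" "lin N_w (Dsum x) = lin N_w (Dhead (lin N_w x))"
proof -
  have "lin N_w (Dhead (lin N_w v)) = Dsum (lin N_w v)" if v: "v \<in> hom L" for L v
  proof -
    let ?u = "Dhead (lin N_w v)"
    have u: "?u \<in> hom L" by (intro Dhead_hom N_hom_hom v)
    have "Dsum (lin N_w v) = (\<Sum>i\<in>{0..<int L}. rot (- i) ?u)"
      by (simp add: Dsum_hom[OF N_hom_hom[OF v]] rot_N_hom[OF v])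
    also have "\<dots> = (\<Sum>s\<in>{1 - int L..<1 - int L + int L}. rot s ?u)"
      by (rule sum.reindex_bij_witness[of _ uminus uminus]) auto
    also have "\<dots> = lin N_w ?u"
      unfolding N_hom[OF u] by (rule sum_periodic) (rule rot_hom_periodic[OF u], simp)
    finally show ?thesis ..
  qed
  from this show "lin N_w (Dhead (lin N_w x)) = Dsum (lin N_w x)"
    by (rule nonemptysp_eqI[OF x, of "\<lambda>x. lin N_w (Dhead (lin N_w x))" "\<lambda>x. Dsum (lin N_w x)", rotated 2])
      (assumption | rule lmapI; simp add: lin_simps op_simps)+
  have "lin N_w (Dsum v) = lin N_w (Dhead (lin N_w v))" if v: "v \<in> hom L" for L v
  proof -
    have "lin N_w (rot (- i) (Dhead (rot i v))) = lin N_w (Dhead (rot i v))" for i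
      by (rule N_rot_hom[OF Dhead_hom[OF rot_hom[OF v]]])
    then show ?thesis by (simp add: Dsum_hom[OF v] N_hom[OF v] lin_simps op_simps)
  qed
  from this show "lin N_w (Dsum x) = lin N_w (Dhead (lin N_w x))"
    by (rule nonemptysp_eqI[OF x, of "\<lambda>x. lin N_w (Dsum x)" "\<lambda>x. lin N_w (Dhead (lin N_w x))", rotated 2])
      (assumption | rule lmapI; simp add: lin_simps op_simps)+
qed

text \<open>By \<open>N_Dhead_N\<close> the operators \<open>Dsum\<close> and \<open>Dhead N\<close>
  agree after applying \<open>N\<close>, so exactness of the row writes their difference as
  \<open>1 - \<lambda>\<close> of this chain. It links \<open>Dsum\<close>, whose leading term is
  known, with \<open>Dhead N\<close>, which is compatible with \<open>b\<close>.\<close>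

definition row_homotopy :: "('v, 'k) chain \<Rightarrow> ('v, 'k) chain" where
  "row_homotopy x = contr (Dsum x - Dhead (lin N_w x))"

lemma row_homotopy_Cfilt: "x \<in> Cfilt k \<Longrightarrow> row_homotopy x \<in> Cfilt k"
  unfolding row_homotopy_def by (intro contr_Cfilt lspace_diff[OF lspace_Cfilt] Dsum_Cfilt Dhead_Cfilt N_Cfilt)

lemma row_homotopy_lam:
  assumes x: "x \<in> nonemptysp" and y: "Dsum x - Dhead (lin N_w x) \<in> nonemptysp"
  shows "row_homotopy x - lin lam_w (row_homotopy x) = Dsum x - Dhead (lin N_w x)"
proof -
  have N: "lin N_w (Dsum x - Dhead (lin N_w x)) = 0"
    by (simp add: lin_simps N_Dhead_N(2)[OF x])
  show ?thesis
    unfolding row_homotopy_def contr_lam[OF y] avg_N[OF y, symmetric] N by (simp add: op_simps)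
qed

text \<open>Each letter, rotated to the front, contributes its own weight, and these weights add up
  to the weight of the word.\<close>

lemma Dsum_weight:
  assumes x: "x \<in> Cfilt k"
  shows "congr (Cfilt (Suc k)) (Dsum x) (psc (of_nat k) x)"
  unfolding congr_def
proof (rule lmap_Cfilt[OF x _ lspace_Cfilt, of "\<lambda>x. Dsum x - psc (of_nat k) x"])
  show "lmap (\<lambda>x. Dsum x - psc (of_nat k) x)" by (intro lmap_comb lmap_Dsum lmap_id)
  show "Dsum q - psc (of_nat k) q \<in> Cfilt (Suc k)" if "q \<in> trel A" for q
    using that by (intro Cfilt_trel lspace_diff[OF lspace_trel] Dsum_trel trel_scal)
  fix ks w assume w: "weighted ks w" and k: "k \<le> sum_list ks"
  show "Dsum (gen w) - psc (of_nat k) (gen w) \<in> Cfilt (Suc k)"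
  proof (cases "sum_list ks = k")
    case False
    then have "gen w \<in> Cfilt (Suc k)" using w k by (intro Cfilt_gen) auto
    then show ?thesis by (intro lspace_diff[OF lspace_Cfilt] Dsum_Cfilt Cfilt_scal)
  next
    case True
    let ?L = "int (length w)"
    have "congr (Cfilt (Suc k)) (rot (- i) (Dhead (rot i (gen w)))) (psc (of_nat (ks ! nat i)) (gen w))"
      if i: "i \<in> {0..<?L}" for i
    proof -
      have m: "nat (i mod ?L) = nat i" "nat i < length ks" using i weighted_length[OF w] by auto
      obtain s w' where sw: "rot i (gen w) = (psc s (gen w') :: ('v, 'k) chain)"
        "weighted (drop (nat i) ks @ take (nat i) ks) w'"
        using rot_weighted[OF w, of i] m by metis
      have d: "drop (nat i) ks = ks ! nat i # drop (Suc (nat i)) ks"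
        using m(2) by (simp add: Cons_nth_drop_Suc)
      have "ks ! nat i + sum_list (drop (Suc (nat i)) ks @ take (nat i) ks) = k"
        using sum_list_rotate[of "nat i" ks] True unfolding d by simp
      then have "congr (Cfilt (Suc k)) (Dhead (gen w')) (psc (of_nat (ks ! nat i)) (gen w'))"
        using Dhead_weight[of "ks ! nat i" "drop (Suc (nat i)) ks @ take (nat i) ks" w'] sw(2)
        unfolding d by simp
      then have "congr (Cfilt (Suc k)) (rot (- i) (psc s (Dhead (gen w')))) (rot (- i) (psc s (psc (of_nat (ks ! nat i)) (gen w'))))"
        by (intro congr_lmap[OF lmap_rot rot_Cfilt] congr_psc[OF lspace_Cfilt])
      moreover have "rot (- i) (psc s (psc (of_nat (ks ! nat i)) (gen w'))) = psc (of_nat (ks ! nat i)) (rot (- i) (rot i (gen w)))"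
        by (simp add: sw(1) rot_simps mult.commute)
      moreover have "rot (- i) (rot i (gen w)) = (gen w :: ('v, 'k) chain)" by (simp add: rot_rot)
      ultimately show ?thesis by (simp only: sw(1) op_simps)
    qed
    then have "congr (Cfilt (Suc k)) (Dsum (gen w)) (\<Sum>i\<in>{0..<?L}. psc (of_nat (ks ! nat i)) (gen w))"
      unfolding Dsum_hom[of "gen w" "length w", simplified] by (intro congr_sum lspace_Cfilt)
    moreover have "(\<Sum>i\<in>{0..<?L}. ks ! nat i) = k"
    proof -
      have "(\<Sum>i\<in>{0..<?L}. ks ! nat i) = (\<Sum>i<length ks. ks ! i)"
        using weighted_length[OF w] by (intro sum.reindex_bij_witness[of _ int nat]) auto
      then show ?thesis using True by (simp add: sum_list_sum_nth atLeast0LessThan)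
    qed
    ultimately show ?thesis
      by (simp add: congr_def flip: psc_sum_left of_nat_sum)
  qed
qed

text \<open>The right-hand side vanishes after summation over all rotations of \<open>w\<close>, since each letter of a
  block is then the first letter equally often.\<close>

lemma Dhead_commutator:
  assumes w: "weighted ks w" and L: "length w = L" and k: "sum_list ks = k"
  shows "congr (Cfilt (Suc k)) (bb A (Dhead (gen w)) - Dhead (bp A (gen w)))
    (\<Sum>n\<in>{1..L}. \<Sum>s\<in>{1..<n}. psc (of_nat (ks ! 0)) (front A n (rot (- int s) (gen w))) - psc (of_nat (ks ! s)) (front A n (gen w)))"
  (is "congr _ _ ?R")
proof (cases ks)
  case Nil
  then have "w = []" using w by simp
  then show ?thesis using L by (simp add: op_simps Dhead_def lin_simps bprime_w_sum congr_refl[OF lspace_Cfilt] lmap_0[OF lmap_lin])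
next
  case (Cons m ms)
  \<comment> \<open>This is the weight of the first letter after contracting \<open>n\<close>
    letters from position \<open>t\<close>: the weight of the whole block if the block starts the
    word, and that of the untouched first letter otherwise.\<close>
  let ?e = "\<lambda>n t. if t = 0 then sum_list (take n ks) else m"
  let ?c = "psc (of_nat m) :: ('v, 'k) chain \<Rightarrow> _"
  have "congr (Cfilt (Suc k)) (Dhead (gen w)) (?c (gen w))"
    using Dhead_weight[of m ms w] w k by (simp add: Cons)
  then have "congr (Cfilt (Suc k)) (bb A (Dhead (gen w))) (bb A (?c (gen w)))"
    by (intro congr_lmap[OF lmap_lin bb_Cfilt])
  moreover have "congr (Cfilt (Suc k)) (Dhead (bterm A w t n)) (psc (of_nat (?e n t)) (bterm A w t n))"
    if n: "n \<in> {1..L}" "t \<in> {0..L - n}" for n t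
  proof -
    from bterm_weighted[OF w, of t n] n L
    have "bterm A w t n = 0 \<or> (\<exists>s w'. bterm A w t n = psc s (gen w') \<and>
      weighted (take t ks @ [sum_list (take n (drop t ks))] @ drop (t + n) ks) w')" by auto
    then show ?thesis
    proof (elim disjE exE conjE)
      fix s w' assume h: "bterm A w t n = psc s (gen w')"
        "weighted (take t ks @ [sum_list (take n (drop t ks))] @ drop (t + n) ks) w'"
      have "\<exists>ls. take t ks @ [sum_list (take n (drop t ks))] @ drop (t + n) ks = (?e n t) # ls"
        by (cases t) (auto simp: Cons)
      then obtain ls where ls: "take t ks @ [sum_list (take n (drop t ks))] @ drop (t + n) ks = (?e n t) # ls"
        by blast
      have "(?e n t) + sum_list ls = k"
        using sum_list_block[of t ks n] k unfolding ls by simp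
      then have "congr (Cfilt (Suc k)) (Dhead (gen w')) (psc (of_nat (?e n t)) (gen w'))"
        using Dhead_weight[of "?e n t" ls w'] h(2) unfolding ls by simp
      then have "congr (Cfilt (Suc k)) (psc s (Dhead (gen w'))) (psc s (psc (of_nat (?e n t)) (gen w')))"
        by (rule congr_psc[OF lspace_Cfilt])
      then show ?thesis by (simp add: h(1) op_simps mult.commute)
    qed (simp add: op_simps congr_refl[OF lspace_Cfilt])
  qed
  then have "congr (Cfilt (Suc k)) (Dhead (bp A (gen w)))
      (\<Sum>n\<in>{1..L}. \<Sum>t\<in>{0..L - n}. psc (of_nat (?e n t)) (bterm A w t n))"
    unfolding lin_gen bprime_w_sum L op_simps by (intro congr_sum[OF lspace_Cfilt])
  ultimately have "congr (Cfilt (Suc k)) (bb A (Dhead (gen w)) - Dhead (bp A (gen w)))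
      (bb A (?c (gen w)) - (\<Sum>n\<in>{1..L}. \<Sum>t\<in>{0..L - n}. psc (of_nat (?e n t)) (bterm A w t n)))"
    by (rule congr_diff[OF lspace_Cfilt])
  moreover have "bb A (?c (gen w)) - (\<Sum>n\<in>{1..L}. \<Sum>t\<in>{0..L - n}. psc (of_nat (?e n t)) (bterm A w t n)) =
    ?R"
  proof -
    have "?c (\<Sum>t\<in>{0..L - n}. bterm A w t n) + ?c (\<Sum>s\<in>{1..<n}. front A n (rot (- int s) (gen w))) -
        (\<Sum>t\<in>{0..L - n}. psc (of_nat (?e n t)) (bterm A w t n)) =
      (\<Sum>s\<in>{1..<n}. psc (of_nat (ks ! 0)) (front A n (rot (- int s) (gen w))) - psc (of_nat (ks ! s)) (front A n (gen w)))"
      if n: "n \<in> {1..L}" for n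
    proof -
      have b: "front A n (gen w) = bterm A w 0 n" using n L by (intro front_weighted_eq) auto
      have t: "{0..L - n} = insert 0 {1..L - n}" by auto
      have "take n ks = map ((!) ks) [0..<n]"
        by (rule nth_equalityI) (use n L weighted_length[OF w] in auto)
      then have "sum_list (take n ks) = (\<Sum>s\<in>{0..<n}. ks ! s)"
        by (simp add: sum_list_distinct_conv_sum_set interv_sum_list_conv_sum_set_nat)
      also have "{0..<n} = insert 0 {1..<n}" using n by auto
      finally have "sum_list (take n ks) = m + (\<Sum>s\<in>{1..<n}. ks ! s)" by (simp add: Cons)
      then show ?thesis
        by (simp add: t b psc_add psc_sum psc_add_left psc_sum_left sum_subtractf Cons algebra_simps)
    qed
    then show ?thesis
      by (simp add: b_w_sum bprime_w_sum L lin_simps psc_add psc_sum flip: sum.distrib sum_subtractf)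
  qed
  ultimately show ?thesis by simp
qed

lemma bb_Dhead_N:
  assumes x: "x \<in> Cfilt k"
  shows "congr (Cfilt (Suc k)) (bb A (Dhead (lin N_w x))) (Dhead (bp A (lin N_w x)))"
  unfolding congr_def
proof (rule lmap_Cfilt[OF x _ lspace_Cfilt, of "\<lambda>x. bb A (Dhead (lin N_w x)) - Dhead (bp A (lin N_w x))"])
  show "lmap (\<lambda>x. bb A (Dhead (lin N_w x)) - Dhead (bp A (lin N_w x)))"
    by (rule lmapI) (simp_all add: lin_simps op_simps psc_diff algebra_simps)
  show "bb A (Dhead (lin N_w q)) - Dhead (bp A (lin N_w q)) \<in> Cfilt (Suc k)" if "q \<in> trel A" for q
    using that by (intro Cfilt_trel lspace_diff[OF lspace_trel] bb_trel Dhead_trel bp_trel N_trel)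
  fix ks w assume w: "weighted ks w" and k: "k \<le> sum_list ks"
  define L where "L = length w"
  define K where "K = sum_list ks"
  \<comment> \<open>The weight of the letter in cyclic position \<open>z\<close>, which
    \<open>rot z\<close> brings to the front.\<close>
  define \<kappa> where "\<kappa> z = (of_nat (ks ! nat (z mod int L)) :: 'k)" for z
  have lks: "length ks = L" using weighted_length[OF w] by (simp add: L_def)
  have "congr (Cfilt (Suc K)) (bb A (Dhead (rot z (gen w))) - Dhead (bp A (rot z (gen w))))
      (\<Sum>n\<in>{1..L}. \<Sum>s\<in>{1..<n}. psc (\<kappa> z) (front A n (rot (z - int s) (gen w))) - psc (\<kappa> (z + int s)) (front A n (rot z (gen w))))" for z
  proof -
    define m where "m = nat (z mod int L)"
    obtain c w' where c: "rot z (gen w) = (psc c (gen w') :: ('v, 'k) chain)"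
      "weighted (drop m ks @ take m ks) w'" "length w' = L"
      using rot_weighted[OF w, of z] unfolding m_def L_def by metis
    have kap: "of_nat ((drop m ks @ take m ks) ! s) = \<kappa> (z + int s)" if s: "s < L" for s
    proof -
      have mL: "m < L" using s by (simp add: m_def nat_less_iff)
      have "(z + int s) mod int L = (int m + int s) mod int L"
        using s by (simp add: m_def mod_simps)
      moreover have "(drop m ks @ take m ks) ! s = ks ! ((m + s) mod L)"
        using s mL lks by (auto simp: nth_append mod_if not_less add.commute)
      ultimately show ?thesis
        by (simp add: \<kappa>_def nat_mod_distrib nat_add_distrib flip: of_nat_add zmod_int)
    qed
    have "congr (Cfilt (Suc K)) (psc c (bb A (Dhead (gen w')) - Dhead (bp A (gen w'))))
      (psc c (\<Sum>n\<in>{1..L}. \<Sum>s\<in>{1..<n}. psc (of_nat ((drop m ks @ take m ks) ! 0)) (front A n (rot (- int s) (gen w'))) -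
        psc (of_nat ((drop m ks @ take m ks) ! s)) (front A n (gen w'))))"
      by (intro congr_psc[OF lspace_Cfilt] Dhead_commutator c) (simp add: K_def sum_list_rotate del: sum_list_append)
    moreover have "psc c (\<Sum>n\<in>{1..L}. \<Sum>s\<in>{1..<n}. psc (of_nat ((drop m ks @ take m ks) ! 0)) (front A n (rot (- int s) (gen w'))) -
        psc (of_nat ((drop m ks @ take m ks) ! s)) (front A n (gen w'))) =
      (\<Sum>n\<in>{1..L}. \<Sum>s\<in>{1..<n}. psc (\<kappa> z) (front A n (rot (- int s) (psc c (gen w')))) - psc (\<kappa> (z + int s)) (front A n (psc c (gen w'))))"
      unfolding psc_sum
    proof (intro sum.cong refl)
      fix n s assume "n \<in> {1..L}" "s \<in> {1..<n}"
      then have "0 < L" "s < L" by auto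
      then show "psc c (psc (of_nat ((drop m ks @ take m ks) ! 0)) (front A n (rot (- int s) (gen w'))) -
        psc (of_nat ((drop m ks @ take m ks) ! s)) (front A n (gen w'))) =
        psc (\<kappa> z) (front A n (rot (- int s) (psc c (gen w')))) - psc (\<kappa> (z + int s)) (front A n (psc c (gen w')))"
        unfolding kap[OF \<open>0 < L\<close>] kap[OF \<open>s < L\<close>] by (simp add: psc_diff rot_simps front_simps mult.commute)
    qed
    moreover have "psc c (bb A (Dhead (gen w')) - Dhead (bp A (gen w'))) = bb A (Dhead (rot z (gen w))) - Dhead (bp A (rot z (gen w)))"
      by (simp only: c(1) op_simps lmap_simps[OF lmap_lin] psc_diff)
    moreover have "rot (- int s) (psc c (gen w')) = (rot (z - int s) (gen w) :: ('v, 'k) chain)" for s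
      by (simp add: rot_rot flip: c(1))
    ultimately show ?thesis
      by (simp only: c(1)[symmetric])
  qed
  then have "congr (Cfilt (Suc K)) (\<Sum>z\<in>{0..<int L}. bb A (Dhead (rot z (gen w))) - Dhead (bp A (rot z (gen w))))
      (\<Sum>z\<in>{0..<int L}. \<Sum>n\<in>{1..L}. \<Sum>s\<in>{1..<n}. psc (\<kappa> z) (front A n (rot (z - int s) (gen w))) - psc (\<kappa> (z + int s)) (front A n (rot z (gen w))))"
    by (intro congr_sum[OF lspace_Cfilt])
  moreover have "(\<Sum>z\<in>{0..<int L}. \<Sum>n\<in>{1..L}. \<Sum>s\<in>{1..<n}. psc (\<kappa> z) (front A n (rot (z - int s) (gen w))) - psc (\<kappa> (z + int s)) (front A n (rot z (gen w)))) = 0"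
  proof -
    have per: "rot (z + int L) (gen w :: ('v, 'k) chain) = rot z (gen w)" for z
      by (rule rot_periodic) (simp add: L_def)
    have perk: "\<kappa> (z + int L) = \<kappa> z" for z by (simp add: \<kappa>_def)
    \<comment> \<open>Replacing \<open>z\<close> by \<open>z + s\<close> turns the first kind of
      term into the second. The shift is allowed because weights and rotations both have period
      \<open>L\<close> in \<open>z\<close>.\<close>
    have "(\<Sum>z\<in>{0..<int L}. psc (\<kappa> z) (front A n (rot (z - int s) (gen w)))) = (\<Sum>z\<in>{0..<int L}. psc (\<kappa> (z + int s)) (front A n (rot z (gen w))))" for n s
    proof -
      have "(\<Sum>z\<in>{0..<int L}. psc (\<kappa> (z + int s + int s - int s)) (front A n (rot (z + int s - int s) (gen w)))) =
          (\<Sum>z\<in>{0..<int L}. psc (\<kappa> z) (front A n (rot (z - int s) (gen w))))"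
        using sum_periodic_shift[of "\<lambda>z. psc (\<kappa> z) (front A n (rot (z - int s) (gen w)))" L "int s"] perk per[of "_ - int s"]
        by (simp add: algebra_simps)
      then show ?thesis by (simp add: add.commute)
    qed
    then show ?thesis
      by (simp add: sum_subtractf sum.swap[of _ _ "{0..<int L}"])
  qed
  moreover have "(\<Sum>z\<in>{0..<int L}. bb A (Dhead (rot z (gen w))) - Dhead (bp A (rot z (gen w)))) =
      bb A (Dhead (lin N_w (gen w))) - Dhead (bp A (lin N_w (gen w)))"
    by (simp add: N_w_rot lin_simps op_simps sum_subtractf L_def)
  ultimately have "bb A (Dhead (lin N_w (gen w))) - Dhead (bp A (lin N_w (gen w))) \<in> Cfilt (Suc K)"
    by (simp add: congr_0)
  then show "bb A (Dhead (lin N_w (gen w))) - Dhead (bp A (lin N_w (gen w))) \<in> Cfilt (Suc k)"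
    using Cfilt_antimono[of "Suc k" "Suc K"] k by (auto simp: K_def)
qed

end

section \<open>Acyclicity of the kernel\<close>

definition degsp :: "int \<Rightarrow> ('v, 'k::field) chain set" where
  "degsp s = {x. Poly_Mapping.keys x \<subseteq> {w. int (sdeg w) = s}}"

lemma lspace_degsp: "lspace (degsp s)"
  unfolding degsp_def by (rule lspace_keys)

lemma gen_degsp [simp]: "gen w \<in> degsp s \<longleftrightarrow> int (sdeg w) = s"
  by (simp add: degsp_def)

lemma degsp_lmapI: "x \<in> degsp s \<Longrightarrow> lmap f \<Longrightarrow> (\<And>w. int (sdeg w) = s \<Longrightarrow> f (gen w) \<in> degsp s') \<Longrightarrow> f x \<in> degsp s'"
  by (rule lspace_lmap_keys[OF lspace_degsp]) (auto simp: degsp_def)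

lemma rot_degsp: "x \<in> degsp s \<Longrightarrow> rot z x \<in> degsp s"
proof (erule degsp_lmapI[OF _ lmap_rot])
  fix w :: "'v word" assume "int (sdeg w) = s"
  moreover have "sdeg (drop m w) + sdeg (take m w) = sdeg w" for m
    by (metis add.commute append_take_drop_id sdeg_simps(3))
  ultimately show "rot z (gen w) \<in> degsp s"
    by (auto simp: rot_gen rot_w_def Let_def intro!: lspace_psc[OF lspace_degsp])
qed

lemma front_degsp:
  fixes A :: "('k::field, 'v) ainf"
  shows "x \<in> degsp s \<Longrightarrow> front A j x \<in> degsp (s - 1)"
proof (erule degsp_lmapI[OF _ lmap_front])
  fix w :: "'v word" assume w: "int (sdeg w) = s"
  show "front A j (gen w) \<in> degsp (s - 1)"
  proof (cases "1 \<le> j \<and> j \<le> length w")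
    case True
    define u v where "u = take j w" and "v = drop j w"
    have uv: "w = u @ v" "length u = j" using True by (auto simp: u_def v_def)
    then have "u \<noteq> []" using True by auto
    then show ?thesis
      using front_app[of u A v] uv w sdeg_block_out[of u A] by (auto simp: lspace_0[OF lspace_degsp])
  qed (auto simp: front_def front_w_def lspace_0[OF lspace_degsp])
qed

lemma bp_degsp: "x \<in> degsp s \<Longrightarrow> bp A x \<in> degsp (s - 1)"
  by (erule degsp_lmapI[OF _ lmap_lin]) (auto simp: bprime_w_rot intro!: lspace_sum[OF lspace_degsp] rot_degsp front_degsp)

lemma bb_degsp: "x \<in> degsp s \<Longrightarrow> bb A x \<in> degsp (s - 1)"
  by (erule degsp_lmapI[OF _ lmap_lin]) (auto simp: b_w_rot intro!: lspace_sum[OF lspace_degsp] rot_degsp front_degsp)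

lemma N_degsp: "x \<in> degsp s \<Longrightarrow> lin N_w x \<in> degsp s"
  by (erule degsp_lmapI[OF _ lmap_lin]) (auto simp: N_w_rot intro!: lspace_sum[OF lspace_degsp] rot_degsp)

lemma lam_degsp: "x \<in> degsp s \<Longrightarrow> lin lam_w x \<in> degsp s"
proof (erule degsp_lmapI[OF _ lmap_lin])
  fix w :: "'v word" assume "int (sdeg w) = s"
  then show "lin lam_w (gen w) \<in> degsp s"
    by (cases "w = []") (simp_all add: lam_w_eq rot_degsp, simp add: lam_w_def lspace_0[OF lspace_degsp])
qed

lemma totdiff_even: "even p \<Longrightarrow> totdiff A x p = bb A (x p) + (x (p + 1) - lin lam_w (x (p + 1)))"
  and totdiff_odd: "odd p \<Longrightarrow> totdiff A x p = lin N_w (x (p + 1)) - bp A (x p)"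
  by (simp_all add: totdiff_def vdiff_def hdiff_def)

lemma totdiff_add: "totdiff A (\<lambda>p. x p + y p) p = totdiff A x p + totdiff A y p"
  and totdiff_diff: "totdiff A (\<lambda>p. x p - y p) p = totdiff A x p - totdiff A y p"
  by (cases "even p"; simp add: totdiff_even totdiff_odd lin_simps)+

lemma totdiff_degsp: "(\<And>p. x p \<in> degsp (t - p)) \<Longrightarrow> totdiff A x p \<in> degsp (t - 1 - p)"
  using bb_degsp[of "x p" "t - p" A] bp_degsp[of "x p" "t - p" A]
  by (cases "even p")
    (auto simp: totdiff_even totdiff_odd diff_diff_eq add.commute diff_diff_add intro!: lspace_add[OF lspace_degsp] lspace_diff[OF lspace_degsp] lam_degsp N_degsp)

context ainfinity_ideal
begin

lemma avg_degsp: "x \<in> degsp s \<Longrightarrow> avg x \<in> degsp s"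
  by (erule degsp_lmapI[OF _ lmap_avg]) (auto simp: avg_def intro!: lspace_psc[OF lspace_degsp])

lemma contr_degsp: "x \<in> degsp s \<Longrightarrow> contr x \<in> degsp s"
  by (erule degsp_lmapI[OF _ lmap_contr]) (auto simp: contr_def intro!: lspace_psc[OF lspace_degsp] lspace_sum[OF lspace_degsp] rot_degsp)

lemma Dhead_degsp: "x \<in> degsp s \<Longrightarrow> Dhead x \<in> degsp s"
  by (erule degsp_lmapI[OF _ lmap_Dhead]) (auto simp: Dhead_def lspace_0[OF lspace_degsp] split: list.splits)

lemma Dsum_degsp: "x \<in> degsp s \<Longrightarrow> Dsum x \<in> degsp s"
  by (erule degsp_lmapI[OF _ lmap_Dsum]) (auto simp: Dsum_def intro!: lspace_sum[OF lspace_degsp] rot_degsp Dhead_degsp)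

lemma row_homotopy_degsp: "x \<in> degsp s \<Longrightarrow> row_homotopy x \<in> degsp s"
  unfolding row_homotopy_def by (intro contr_degsp lspace_diff[OF lspace_degsp] Dsum_degsp Dhead_degsp N_degsp)

lemma totdiff_Cfilt: "(\<And>p. x p \<in> Cfilt k) \<Longrightarrow> totdiff A x p \<in> Cfilt k"
  by (cases "even p") (auto simp: totdiff_even totdiff_odd intro!: lspace_add[OF lspace_Cfilt] lspace_diff[OF lspace_Cfilt] bb_Cfilt bp_Cfilt lam_Cfilt N_Cfilt)

lemma totdiff_trel: "x p \<in> trel A \<Longrightarrow> x (p + 1) \<in> trel A \<Longrightarrow> totdiff A x p \<in> trel A"
  by (cases "even p") (auto simp: totdiff_even totdiff_odd intro!: lspace_add[OF lspace_trel] lspace_diff[OF lspace_trel] bb_trel bp_trel lam_trel N_trel)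

lemma lam_N: "x \<in> nonemptysp \<Longrightarrow> lin lam_w (lin N_w x) = lin N_w x"
proof (rule nonemptysp_eqI[of x "\<lambda>x. lin lam_w (lin N_w x)" "\<lambda>x. lin N_w x"])
  show "lin lam_w (lin N_w v) = lin N_w v" if "v \<in> hom L" "0 < L" for L and v :: "('v, 'k) chain"
    using that by (simp add: lam_hom[OF N_hom_hom] rot_N_hom)
qed (assumption | rule lmapI; simp add: lin_simps)+

text \<open>All mixed terms cancel identically; only the squares of the column differentials need
  the relations.\<close>

lemma totdiff_totdiff:
  assumes x: "\<And>p. x p \<in> nonemptysp"
  shows "totdiff A (totdiff A x) p \<in> trel A"
proof (cases "even p")
  case True
  have "totdiff A (totdiff A x) p = bb A (bb A (x p)) + bb A (x (p + 1) - lin lam_w (x (p + 1))) -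
      (bp A (x (p + 1)) - lin lam_w (bp A (x (p + 1)))) + (lin N_w (x (p + 2)) - lin lam_w (lin N_w (x (p + 2))))"
    using True by (simp add: totdiff_even totdiff_odd lin_simps add.assoc algebra_simps)
  also have "\<dots> = bb A (bb A (x p))"
    using lam_N[OF x] by (simp add: bb_one_minus_lam)
  finally show ?thesis using bb_bb_trel[OF nonemptysp_validsp[OF x]] by simp
next
  case False
  have "totdiff A (totdiff A x) p = bp A (bp A (x p)) + (lin N_w (bb A (x (p + 1))) - bp A (lin N_w (x (p + 1)))) +
      lin N_w (x (p + 2) - lin lam_w (x (p + 2)))"
    using False by (simp add: totdiff_even totdiff_odd lin_simps add.assoc algebra_simps)
  also have "\<dots> = bp A (bp A (x p))"
    using N_one_minus_lam[OF x] by (simp add: bp_N)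
  finally show ?thesis using bp_bp_trel[OF nonemptysp_validsp[OF x]] by simp
qed

text \<open>A primitive of the even components is found by contracting the rows; the remaining cycle has
  invariant odd components, and these are bounded by \<open>Dhead\<close>.\<close>

lemma weight_step:
  assumes k: "1 \<le> k" and z: "\<And>p. z p \<in> Cfilt k" and dz: "\<And>p. totdiff A z p \<in> Cfilt (Suc k)"
    and deg: "\<And>p. z p \<in> degsp (t - p)"
  obtains y where "\<And>p. y p \<in> Cfilt k" "\<And>p. y p \<in> degsp (t + 1 - p)" "\<And>p. z p - totdiff A y p \<in> Cfilt (Suc k)"
proof -
  define c :: 'k where "c = 1 / of_nat k"
  have ck: "c * of_nat k = 1" using k by (simp add: c_def)
  let ?S = "Cfilt (Suc k)"
  note ls = lspace_Cfilt[of "Suc k"] and lk = lspace_Cfilt[of k]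
  note tr [trans] = congr_trans[OF ls]
  have SK: "x \<in> ?S \<Longrightarrow> x \<in> Cfilt k" for x using Cfilt_antimono[of k "Suc k"] by auto
  have ns: "x \<in> Cfilt k \<Longrightarrow> x \<in> nonemptysp" for x using Cfilt_nonemptysp k by blast
  have avN: "x \<in> Cfilt k \<Longrightarrow> x - lin lam_w x \<in> ?S \<Longrightarrow> congr ?S x (lin N_w (avg x))" for x
    unfolding congr_def using contr_one_minus_lam[OF ns] contr_Cfilt by metis
  \<comment> \<open>Chosen so that \<open>b (ye q)\<close> and \<open>z q\<close> have the same
    image under \<open>N\<close> for even \<open>q\<close>, see \<open>main\<close>. The first
    summand comes from the invariant part of the odd component, the second one corrects for its
    failure to be invariant.\<close>
  define ye where "ye q = avg (z (q - 1)) + psc c (avg (bp A (row_homotopy (z (q - 2)))))" for q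
  have yeF: "ye q \<in> Cfilt k" for q
    unfolding ye_def by (intro lspace_add[OF lk] lspace_psc[OF lk] avg_Cfilt bp_Cfilt row_homotopy_Cfilt z)
  have yeC: "ye q \<in> degsp (t + 1 - q)" for q
  proof -
    have "z (q - 1) \<in> degsp (t + 1 - q)" using deg[of "q - 1"] by (simp add: algebra_simps)
    moreover have "bp A (row_homotopy (z (q - 2))) \<in> degsp (t + 1 - q)"
      using bp_degsp[OF row_homotopy_degsp[OF deg[of "q - 2"]], of A] by (simp add: algebra_simps)
    ultimately show ?thesis
      unfolding ye_def by (intro lspace_add[OF lspace_degsp] lspace_psc[OF lspace_degsp] avg_degsp)
  qed
  define r where "r q = z q - bb A (ye q)" for q
  have rF: "r q \<in> Cfilt k" for q unfolding r_def by (intro lspace_diff[OF lk] z bb_Cfilt yeF)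
  have rC: "r q \<in> degsp (t - q)" for q
    unfolding r_def using bb_degsp[OF yeC[of q], of A] deg[of q] by (intro lspace_diff[OF lspace_degsp]) simp_all
  \<comment> \<open>The odd column gives \<open>N\<close> of \<open>z q\<close> as
    \<open>b' o'\<close>, and the even column before it says that \<open>o'\<close> is invariant up
    to \<open>contr (b e)\<close>. It remains to bring \<open>b'\<close> of this error into the form
    \<open>b' N\<close>, to which \<open>b' N = N b\<close> applies.\<close>
  have main: "congr ?S (lin N_w (z q)) (lin N_w (bb A (ye q)))" if q: "even q" for q
  proof -
    define o' e g where "o' = z (q - 1)" and "e = z (q - 2)" and "g = bp A (row_homotopy e)"
    have F: "o' \<in> Cfilt k" "e \<in> Cfilt k" "g \<in> Cfilt k" "row_homotopy e \<in> Cfilt k"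
      by (auto simp: o'_def e_def g_def intro!: z bp_Cfilt row_homotopy_Cfilt)
    have h1: "congr ?S (lin N_w (z q)) (bp A o')"
      using dz[of "q - 1"] q by (simp add: totdiff_odd congr_def o'_def)
    have h2: "bb A e + (o' - lin lam_w o') \<in> ?S"
      using dz[of "q - 2"] q by (simp add: totdiff_even o'_def e_def algebra_simps)
    have "contr (bb A e) + (o' - lin N_w (avg o')) \<in> ?S"
      using contr_Cfilt[OF h2] contr_one_minus_lam[OF ns[OF F(1)]] by (simp add: lmap_add[OF lmap_contr])
    then have o: "congr ?S o' (lin N_w (avg o') - contr (bb A e))"
      by (simp add: congr_def algebra_simps)
    have Nbe: "lin N_w (bb A e) \<in> ?S"
      using N_Cfilt[OF h2] N_one_minus_lam[OF ns[OF F(1)]] by (simp add: lmap_add[OF lmap_lin])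
    \<comment> \<open>The multiple \<open>k b e\<close> lies in the image of
      \<open>1 - \<lambda>\<close>: \<open>Dsum\<close> has leading term \<open>k\<close> and
      differs from \<open>Dhead N\<close> by the row homotopy, while the contribution of
      \<open>Dhead N\<close> is \<open>Dhead\<close> of \<open>N b e\<close>, which is of higher
      weight.\<close>
    have "congr ?S (psc (of_nat k) (bb A e)) (bb A (Dsum e))"
      using congr_lmap[OF lmap_lin bb_Cfilt Dsum_weight[OF F(2)]] congr_sym[OF ls] by (simp add: lin_simps)
    also have "bb A (Dsum e) = bb A (Dhead (lin N_w e)) + (g - lin lam_w g)"
    proof -
      have "Dsum e = Dhead (lin N_w e) + (row_homotopy e - lin lam_w (row_homotopy e))"
        using row_homotopy_lam[OF ns[OF F(2)]] F(2) by (simp add: ns lspace_diff[OF lk] Dsum_Cfilt Dhead_Cfilt N_Cfilt)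
      then show ?thesis by (simp add: lmap_add[OF lmap_lin] bb_one_minus_lam g_def)
    qed
    also have "congr ?S \<dots> (Dhead (bp A (lin N_w e)) + (g - lin lam_w g))"
      by (intro congr_add[OF ls] congr_refl[OF ls] bb_Dhead_N F)
    also have "congr ?S \<dots> (0 + (g - lin lam_w g))"
      unfolding bp_N by (intro congr_add[OF ls] congr_refl[OF ls]) (simp add: congr_0 Dhead_Cfilt Nbe)
    finally have "congr ?S (psc (of_nat k) (bb A e)) (g - lin lam_w g)" by simp
    then have "congr ?S (bp A (contr (psc (of_nat k) (bb A e)))) (bp A (contr (g - lin lam_w g)))"
      by (intro congr_lmap[OF lmap_lin bp_Cfilt] congr_lmap[OF lmap_contr contr_Cfilt])
    also have "bp A (contr (g - lin lam_w g)) = bp A g - bp A (lin N_w (avg g))"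
      by (simp add: contr_one_minus_lam[OF ns[OF F(3)]] lin_simps)
    also have "congr ?S \<dots> (0 - bp A (lin N_w (avg g)))"
      using bp_bp_trel[OF nonemptysp_validsp[OF ns[OF F(4)]]]
      by (intro congr_diff[OF ls] congr_refl[OF ls]) (simp add: congr_0 g_def Cfilt_trel)
    finally have "congr ?S (psc c (bp A (contr (psc (of_nat k) (bb A e))))) (psc c (0 - bp A (lin N_w (avg g))))"
      by (rule congr_psc[OF ls])
    then have X: "congr ?S (bp A (contr (bb A e))) (- psc c (bp A (lin N_w (avg g))))"
      using ck by (simp add: op_simps lin_simps psc_minus)
    note h1
    also have "congr ?S (bp A o') (bp A (lin N_w (avg o') - contr (bb A e)))"
      by (intro congr_lmap[OF lmap_lin bp_Cfilt] o)
    also have "bp A (lin N_w (avg o') - contr (bb A e)) = bp A (lin N_w (avg o')) - bp A (contr (bb A e))"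
      by (simp add: lin_simps)
    also have "congr ?S \<dots> (bp A (lin N_w (avg o')) - - psc c (bp A (lin N_w (avg g))))"
      by (intro congr_diff[OF ls] congr_refl[OF ls] X)
    also have "\<dots> = bp A (lin N_w (ye q))"
      by (simp add: ye_def lin_simps o'_def e_def g_def)
    finally show ?thesis by (simp add: bp_N)
  qed
  \<comment> \<open>By \<open>main\<close> the chains \<open>N (r p)\<close> for even
    \<open>p\<close> are of higher weight, so contracting the row removes \<open>r p\<close> up to
    higher weight.\<close>
  define y where "y p = (if even p then ye p else contr (r (p - 1)))" for p
  have yF: "y p \<in> Cfilt k" for p by (simp add: y_def yeF contr_Cfilt rF)
  have yC: "y p \<in> degsp (t + 1 - p)" for p
    using contr_degsp[OF rC[of "p - 1"]] yeC[of p] by (simp add: y_def algebra_simps)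
  define z' where "z' p = z p - totdiff A y p" for p
  have z'F: "z' p \<in> Cfilt k" for p unfolding z'_def by (intro lspace_diff[OF lk] z totdiff_Cfilt yF)
  have z'C: "z' p \<in> degsp (t - p)" for p
    unfolding z'_def using totdiff_degsp[of y "t + 1" A p] yC deg by (intro lspace_diff[OF lspace_degsp]) simp_all
  have z'_even: "z' p \<in> ?S" if p: "even p" for p
  proof -
    have "z' p = r p - (contr (r p) - lin lam_w (contr (r p)))"
      using p by (simp add: z'_def totdiff_even y_def r_def)
    also have "\<dots> = avg (lin N_w (r p))"
      using contr_lam[OF ns[OF rF]] avg_N[OF ns[OF rF]] by simp
    finally show ?thesis
      using main[OF p] by (simp add: avg_Cfilt congr_def r_def lin_simps)
  qed
  have dz': "totdiff A z' p \<in> ?S" for p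
    unfolding z'_def totdiff_diff using totdiff_totdiff[of y p] ns yF
    by (intro lspace_diff[OF ls] dz Cfilt_trel) blast
  have z'_odd: "z' p - lin lam_w (z' p) \<in> ?S" "bp A (z' p) \<in> ?S" if p: "odd p" for p
  proof -
    have "bb A (z' (p - 1)) + (z' p - lin lam_w (z' p)) \<in> ?S"
      using dz'[of "p - 1"] p by (simp add: totdiff_even)
    then show "z' p - lin lam_w (z' p) \<in> ?S"
      using lspace_diff[OF ls _ bb_Cfilt[OF z'_even[of "p - 1"]]] p by fastforce
    have "lin N_w (z' (p + 1)) - bp A (z' p) \<in> ?S"
      using dz'[of p] p by (simp add: totdiff_odd)
    then show "bp A (z' p) \<in> ?S"
      using lspace_diff_iff[OF ls] N_Cfilt[OF z'_even[of "p + 1"]] p by simp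
  qed
  \<comment> \<open>On invariant chains \<open>N Dhead\<close> equals \<open>Dsum\<close>, which is
    \<open>k\<close> up to higher weight. So \<open>Dhead\<close> divided by \<open>k\<close> is a
    right inverse of \<open>N\<close> there.\<close>
  define y' where "y' p = (if even p then psc c (Dhead (z' (p - 1))) else 0)" for p
  have y'F: "y' p \<in> Cfilt k" for p
    by (simp add: y'_def Cfilt_scal Dhead_Cfilt z'F lspace_0[OF lk])
  have y'C: "y' p \<in> degsp (t + 1 - p)" for p
    using Dhead_degsp[OF z'C[of "p - 1"]]
    by (simp add: y'_def lspace_psc[OF lspace_degsp] lspace_0[OF lspace_degsp] algebra_simps)
  have fin: "z' p - totdiff A y' p \<in> ?S" for p
  proof (cases "even p")
    case True
    define x f where "x = z' (p - 1)" and "f = avg x"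
    have x: "x \<in> Cfilt k" "x - lin lam_w x \<in> ?S" "bp A x \<in> ?S"
      using z'_odd[of "p - 1"] True z'F by (simp_all add: x_def)
    have xN: "congr ?S x (lin N_w f)" unfolding f_def by (rule avN[OF x(1,2)])
    \<comment> \<open>Near-invariance of \<open>x\<close> lets \<open>Dhead\<close> pass through the
      differential, where it meets \<open>b' x\<close>, which is of higher weight already.\<close>
    have "congr ?S (bb A (Dhead x)) (bb A (Dhead (lin N_w f)))"
      by (intro congr_lmap[OF lmap_lin bb_Cfilt] congr_lmap[OF lmap_Dhead Dhead_Cfilt] xN)
    also have "congr ?S \<dots> (Dhead (bp A (lin N_w f)))"
      by (rule bb_Dhead_N) (simp add: f_def avg_Cfilt x)
    also have "congr ?S \<dots> (Dhead (bp A x))"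
      by (intro congr_lmap[OF lmap_lin bp_Cfilt] congr_lmap[OF lmap_Dhead Dhead_Cfilt] congr_sym[OF ls xN])
    finally have "bb A (Dhead x) \<in> ?S"
      using congr_mem[OF ls] Dhead_Cfilt[OF x(3)] by blast
    then have "totdiff A y' p \<in> ?S"
      using True by (simp add: totdiff_even y'_def lin_simps Cfilt_scal flip: x_def)
    then show ?thesis using z'_even[OF True] by (intro lspace_diff[OF ls])
  next
    case False
    define x f where "x = z' p" and "f = avg x"
    have x: "x \<in> Cfilt k" "x - lin lam_w x \<in> ?S"
      using z'_odd[of p] False z'F by (simp_all add: x_def)
    have xN: "congr ?S x (lin N_w f)" unfolding f_def by (rule avN[OF x(1,2)])
    have "congr ?S (lin N_w (Dhead x)) (lin N_w (Dhead (lin N_w f)))"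
      by (intro congr_lmap[OF lmap_lin N_Cfilt] congr_lmap[OF lmap_Dhead Dhead_Cfilt] xN)
    also have "\<dots> = Dsum (lin N_w f)"
      by (rule N_Dhead_N) (simp add: f_def avg_Cfilt x ns)
    also have "congr ?S \<dots> (Dsum x)"
      by (intro congr_lmap[OF lmap_Dsum Dsum_Cfilt] congr_sym[OF ls xN])
    also have "congr ?S \<dots> (psc (of_nat k) x)" by (rule Dsum_weight[OF x(1)])
    finally have "congr ?S (psc c (lin N_w (Dhead x))) (psc c (psc (of_nat k) x))" by (rule congr_psc[OF ls])
    then have "congr ?S x (psc c (lin N_w (Dhead x)))" using ck by (simp add: congr_sym[OF ls])
    moreover have "totdiff A y' p = psc c (lin N_w (Dhead x))"
      using False by (simp add: totdiff_odd y'_def lin_simps x_def)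
    ultimately show ?thesis by (simp add: congr_def x_def)
  qed
  show thesis
  proof (rule that[of "\<lambda>p. y p + y' p"])
    show "y p + y' p \<in> Cfilt k" for p by (intro lspace_add[OF lk] yF y'F)
    show "y p + y' p \<in> degsp (t + 1 - p)" for p by (intro lspace_add[OF lspace_degsp] yC y'C)
    show "z p - totdiff A (\<lambda>p. y p + y' p) p \<in> ?S" for p
      using fin[of p] by (simp add: totdiff_add z'_def algebra_simps)
  qed
qed

section \<open>Convergence of the iteration\<close>

definition degpart :: "int \<Rightarrow> ('v, 'k) chain \<Rightarrow> ('v, 'k) chain" where
  "degpart s = lin (\<lambda>w. if int (sdeg w) = s then gen w else 0)"

lemma degpart_degsp: "x \<in> degsp s \<Longrightarrow> degpart s x = x"
  unfolding degpart_def by (rule lmap_eqI[OF lmap_lin lmap_id]) (auto simp: degsp_def)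

lemma degpart_trel:
  assumes p: "p \<in> trel A" shows "degpart s p \<in> trel A"
proof (rule lmap_trel_letter[OF p])
  show "lmap (degpart s)" by (simp add: degpart_def lmap_lin)
  fix us ws d assume v: "valid A us" "valid A ws"
  show "letterwise A (degpart s) us ws d"
  proof (cases "int (sdeg us + (d + 1 + sdeg ws)) = s")
    case True
    then show ?thesis using v
      by (intro letterwise_sameI[of A us ws d _ _ _ 1]) (simp_all add: degpart_def)
  qed (intro letterwise_0, simp add: degpart_def)
qed auto

text \<open>A word of weight at least \<open>k\<close> has shifted degree at least
  \<open>k > s\<close> unless it contains a zero letter, and then it is a relation. A presentation
  of \<open>p\<close> by weighted words may involve other degrees, which \<open>degpart\<close>
  discards.\<close>

lemma Cfilt_degsp_trel:
  assumes p: "p \<in> Cfilt k" "p \<in> degsp s" and s: "s < int k"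
  shows "p \<in> trel A"
proof -
  have "degpart s p \<in> trel A"
  proof (rule lmap_Cfilt[OF p(1) _ lspace_trel degpart_trel])
    show "lmap (degpart s)" by (simp add: degpart_def lmap_lin)
    fix ks w assume w: "weighted ks w" "k \<le> sum_list ks"
    show "degpart s (gen w) \<in> trel A"
    proof (cases "int (sdeg w) = s")
      case True
      then have "\<zero> \<in> set (map snd w)"
        using weighted_le_or_zero[OF w(1)] w(2) s sdeg_conv[of w] by linarith
      then obtain d where "(d, \<zero>) \<in> set w" by auto
      then obtain us ws where w': "w = us @ (d, \<zero>) # ws" by (meson split_list)
      then show ?thesis
        using weighted_valid[OF w(1)] True by (simp add: degpart_def zero_letter_trel)
    qed (simp add: degpart_def trel.trel_zero)
  qed
  then show ?thesis using degpart_degsp[OF p(2)] by simp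
qed

lemma acyclic:
  assumes z: "\<And>p. z p \<in> Cfilt 1" "\<And>p. z p \<in> degsp (t - p)" and dz: "\<And>p. totdiff A z p \<in> trel A"
  obtains y where "\<And>p. y p \<in> Cfilt 1" "\<And>p. y p \<in> degsp (t + 1 - p)" "\<And>p. z p - totdiff A y p \<in> trel A"
proof -
  define P where "P n y \<longleftrightarrow> (\<forall>p. y p \<in> Cfilt 1 \<and> y p \<in> degsp (t + 1 - p) \<and> z p - totdiff A y p \<in> Cfilt (Suc n))" for n y
  define Q where "Q n y y' \<longleftrightarrow> (\<forall>p. y' p - y p \<in> Cfilt (Suc n))" for n and y y' :: "int \<Rightarrow> ('v, 'k) chain"
  have "\<exists>f. \<forall>n. P n (f n) \<and> Q n (f n) (f (Suc n))"
  proof (rule dependent_nat_choice)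
    have "totdiff A (\<lambda>_. 0) p = 0" for p
      by (cases "even p") (simp_all add: totdiff_even totdiff_odd lin_simps)
    then show "\<exists>y. P 0 y"
      using z by (intro exI[of _ "\<lambda>_. 0"]) (simp add: P_def lspace_0[OF lspace_Cfilt] lspace_0[OF lspace_degsp])
    fix y n assume y: "P n y"
    have "\<exists>u. (\<forall>p. u p \<in> Cfilt (Suc n)) \<and> (\<forall>p. u p \<in> degsp (t + 1 - p)) \<and>
        (\<forall>p. (z p - totdiff A y p) - totdiff A u p \<in> Cfilt (Suc (Suc n)))"
    proof (rule weight_step[of "Suc n" "\<lambda>p. z p - totdiff A y p" t])
      show "z p - totdiff A y p \<in> Cfilt (Suc n)" for p using y by (simp add: P_def)
      show "totdiff A (\<lambda>p. z p - totdiff A y p) p \<in> Cfilt (Suc (Suc n))" for p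
        unfolding totdiff_diff using y Cfilt_nonemptysp[of "y _" 1]
        by (intro Cfilt_trel lspace_diff[OF lspace_trel] dz totdiff_totdiff) (simp add: P_def)
      show "z p - totdiff A y p \<in> degsp (t - p)" for p
        using totdiff_degsp[of y "t + 1" A p] y z by (intro lspace_diff[OF lspace_degsp]) (simp_all add: P_def)
    qed (simp, blast)
    then obtain u where u: "\<And>p. u p \<in> Cfilt (Suc n)" "\<And>p. u p \<in> degsp (t + 1 - p)"
      "\<And>p. (z p - totdiff A y p) - totdiff A u p \<in> Cfilt (Suc (Suc n))" by blast
    have "P (Suc n) (\<lambda>p. y p + u p)"
      using y u Cfilt_antimono[of 1 "Suc n"]
      by (auto simp: P_def totdiff_add diff_diff_eq intro!: lspace_add[OF lspace_Cfilt] lspace_add[OF lspace_degsp])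
    moreover have "Q n y (\<lambda>p. y p + u p)" using u by (simp add: Q_def)
    ultimately show "\<exists>y'. P (Suc n) y' \<and> Q n y y'" by blast
  qed
  then obtain f where f: "\<And>n. P n (f n)" "\<And>n. Q n (f n) (f (Suc n))" by blast
  \<comment> \<open>In column \<open>p\<close> the correction from \<open>f n\<close> to
    \<open>f (Suc n)\<close> has weight at least \<open>n + 1\<close> and degree
    \<open>t + 1 - p\<close>, so it is a relation as soon as
    \<open>n \<ge> t + 1 - p\<close>.\<close>
  have stab: "f n p - f m p \<in> trel A" if "m \<le> n" "t + 1 - p \<le> int m" for n m p
    using that
  proof (induction n rule: dec_induct)
    case (step n)
    have "f (Suc n) p - f n p \<in> trel A"
    proof (rule Cfilt_degsp_trel)
      show "f (Suc n) p - f n p \<in> Cfilt (Suc n)" using f(2) by (simp add: Q_def)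
      show "f (Suc n) p - f n p \<in> degsp (t + 1 - p)" using f(1) by (intro lspace_diff[OF lspace_degsp]) (simp_all add: P_def)
    qed (use step in simp)
    then have "(f (Suc n) p - f n p) + (f n p - f m p) \<in> trel A" using step by (intro trel_plus) auto
    then show ?case by simp
  qed (simp add: trel.trel_zero)
  \<comment> \<open>The number of iterations depends on the column and grows as \<open>p\<close>
    decreases. The resulting primitive may have infinitely many nonzero components, as the
    direct-product complex permits.\<close>
  define y where "y p = f (nat (t + 1 - p)) p" for p
  have "z p - totdiff A y p \<in> trel A" for p
  proof -
    define n where "n = nat (t + 1 - p)"
    have y1: "y p - f n p \<in> trel A" by (simp add: y_def n_def trel.trel_zero)
    have "f n (p + 1) - f (nat (t + 1 - (p + 1))) (p + 1) \<in> trel A" by (rule stab) (auto simp: n_def)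
    then have y2: "y (p + 1) - f n (p + 1) \<in> trel A"
      using lspace_minus[OF lspace_trel] by (fastforce simp: y_def)
    have "z p - totdiff A (f n) p \<in> trel A"
    proof (rule Cfilt_degsp_trel)
      show "z p - totdiff A (f n) p \<in> Cfilt (Suc n)" using f(1) by (simp add: P_def)
      show "z p - totdiff A (f n) p \<in> degsp (t - p)"
        using totdiff_degsp[of "f n" "t + 1" A p] f(1) z by (intro lspace_diff[OF lspace_degsp]) (simp_all add: P_def)
    qed (simp add: n_def)
    moreover have "totdiff A (\<lambda>p. y p - f n p) p \<in> trel A" by (rule totdiff_trel[OF y1 y2])
    ultimately have "(z p - totdiff A (f n) p) - totdiff A (\<lambda>p. y p - f n p) p \<in> trel A"
      by (rule lspace_diff[OF lspace_trel])
    then show ?thesis by (simp add: totdiff_diff)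
  qed
  then show thesis
    using f(1) by (intro that[of y]) (simp_all add: y_def P_def)
qed

end

section \<open>Comparison with the quotient\<close>

lemma totdiff_minus: "totdiff A (\<lambda>p. - x p) p = - totdiff A x p"
  by (cases "even p") (simp_all add: totdiff_even totdiff_odd lin_simps)

lemma totdiff_0: "totdiff A (\<lambda>_. 0) p = 0"
  by (cases "even p") (simp_all add: totdiff_even totdiff_odd lin_simps)

definition chainsp :: "('k::field, 'v) ainf \<Rightarrow> int \<Rightarrow> ('v, 'k) chain set" where
  "chainsp A s = {x. Poly_Mapping.keys x \<subseteq> {w. valid A w \<and> w \<noteq> [] \<and> int (sdeg w) = s}}"

lemma lspace_chainsp: "lspace (chainsp A s)"
  unfolding chainsp_def by (rule lspace_keys)

lemma chains_iff: "x \<in> chains A t \<longleftrightarrow> (\<forall>p. x p \<in> chainsp A (t - p))"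
  by (auto simp: chains_def chainsp_def)

lemma gen_chainsp [simp]: "gen w \<in> chainsp A s \<longleftrightarrow> valid A w \<and> w \<noteq> [] \<and> int (sdeg w) = s"
  by (simp add: chainsp_def)

lemma chainsp_lmapI:
  "x \<in> chainsp A s \<Longrightarrow> lmap f \<Longrightarrow> lspace S \<Longrightarrow>
    (\<And>w. valid A w \<Longrightarrow> w \<noteq> [] \<Longrightarrow> int (sdeg w) = s \<Longrightarrow> f (gen w) \<in> S) \<Longrightarrow> f x \<in> S"
  by (rule lspace_lmap_keys) (auto simp: chainsp_def)

lemma homologous_refl: "x \<in> cycles A t \<Longrightarrow> (x, x) \<in> homologous A t"
  by (auto simp: homologous_def chains_iff totdiff_0 lspace_0 lspace_chainsp lspace_trel intro!: bexI[of _ "\<lambda>_. 0"])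

lemma homologous_sym: "(x, y) \<in> homologous A t \<Longrightarrow> (y, x) \<in> homologous A t"
proof -
  assume "(x, y) \<in> homologous A t"
  then obtain z where z: "x \<in> cycles A t" "y \<in> cycles A t" "z \<in> chains A (t + 1)"
    "\<And>p. x p - y p - totdiff A z p \<in> trel A" by (auto simp: homologous_def)
  have "- (x p - y p - totdiff A z p) \<in> trel A" for p
    by (rule lspace_minus[OF lspace_trel z(4)])
  then show ?thesis using z
    by (auto simp: homologous_def chains_iff totdiff_minus lspace_minus lspace_chainsp algebra_simps intro!: bexI[of _ "\<lambda>p. - z p"])
qed

lemma homologous_trans: "(x, y) \<in> homologous A t \<Longrightarrow> (y, u) \<in> homologous A t \<Longrightarrow> (x, u) \<in> homologous A t"
proof -
  assume "(x, y) \<in> homologous A t" "(y, u) \<in> homologous A t"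
  then obtain z z' where z: "x \<in> cycles A t" "u \<in> cycles A t" "z \<in> chains A (t + 1)" "z' \<in> chains A (t + 1)"
    "\<And>p. x p - y p - totdiff A z p \<in> trel A" "\<And>p. y p - u p - totdiff A z' p \<in> trel A" by (auto simp: homologous_def)
  have "(x p - y p - totdiff A z p) + (y p - u p - totdiff A z' p) \<in> trel A" for p
    by (rule lspace_add[OF lspace_trel z(5,6)])
  then have "x p - u p - totdiff A (\<lambda>p. z p + z' p) p \<in> trel A" for p
    by (simp add: totdiff_add algebra_simps)
  moreover have "(\<lambda>p. z p + z' p) \<in> chains A (t + 1)"
    using z(3,4) by (simp add: chains_iff lspace_add lspace_chainsp)
  ultimately show ?thesis using z(1,2) by (auto simp: homologous_def)
qed

lemma equiv_homologous: "equiv (cycles A t) (homologous A t)"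
proof (rule equivI)
  show "homologous A t \<subseteq> cycles A t \<times> cycles A t" by (auto simp: homologous_def)
  show "refl_on (cycles A t) (homologous A t)" by (intro refl_onI homologous_refl)
  show "sym (homologous A t)" by (rule symI) (rule homologous_sym)
  show "trans (homologous A t)" by (rule transI) (rule homologous_trans)
qed

context ainfinity_ideal
begin

section \<open>Arithmetic of cosets\<close>

abbreviation "Q \<equiv> quot A I"
abbreviation "q \<equiv> coset A I"

lemma I_closed: "x \<in> I \<Longrightarrow> x \<in> acar A" "\<zero> \<in> I" "x \<in> I \<Longrightarrow> y \<in> I \<Longrightarrow> x \<oplus> y \<in> I" "x \<in> I \<Longrightarrow> k \<odot> x \<in> I"
  using subspace_closed[OF ideal_subspace] by auto

definition sim :: "'v \<Rightarrow> 'v \<Rightarrow> bool" where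
  "sim x y \<longleftrightarrow> x \<in> acar A \<and> y \<in> acar A \<and> (\<exists>i\<in>I. x = y \<oplus> i)"

lemma sim_refl: "x \<in> acar A \<Longrightarrow> sim x x"
  using I_closed(2) by (auto simp: sim_def intro!: bexI[of _ "\<zero>"])

lemma sim_sym: "sim x y \<Longrightarrow> sim y x"
proof -
  assume "sim x y"
  then obtain i where i: "x \<in> acar A" "y \<in> acar A" "i \<in> I" "x = y \<oplus> i" by (auto simp: sim_def)
  then have "y = x \<oplus> (- 1) \<odot> i" using I_closed(1) by (simp add: vadd_assoc)
  then show ?thesis using i I_closed(4) by (auto simp: sim_def)
qed

lemma sim_trans: "sim x y \<Longrightarrow> sim y z \<Longrightarrow> sim x z"
  unfolding sim_def using I_closed by (metis vadd_assoc)

lemma sim_add: "sim x y \<Longrightarrow> sim x' y' \<Longrightarrow> sim (x \<oplus> x') (y \<oplus> y')"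
proof -
  assume "sim x y" "sim x' y'"
  then obtain i j where i: "x \<in> acar A" "y \<in> acar A" "i \<in> I" "x = y \<oplus> i" "x' \<in> acar A" "y' \<in> acar A" "j \<in> I" "x' = y' \<oplus> j"
    by (auto simp: sim_def)
  then have "x \<oplus> x' = (y \<oplus> y') \<oplus> (i \<oplus> j)"
    using I_closed(1) by (simp add: vadd_assoc vadd_left_comm)
  moreover have "x \<oplus> x' \<in> acar A" "y \<oplus> y' \<in> acar A" "i \<oplus> j \<in> I"
    using i I_closed(3) vadd_closed by blast+
  ultimately show ?thesis unfolding sim_def by blast
qed

lemma sim_smul: "sim x y \<Longrightarrow> sim (k \<odot> x) (k \<odot> y)"
  using I_closed by (auto simp: sim_def vsmul_add)

lemma q_eq_iff:
  assumes x: "x \<in> acar A" and y: "y \<in> acar A"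
  shows "q x = q y \<longleftrightarrow> sim x y"
proof
  assume "q x = q y"
  moreover have "x \<in> q x" using x I_closed(2) by (auto simp: coset_def intro!: exI[of _ "\<zero>"])
  ultimately show "sim x y" using x y by (auto simp: sim_def coset_def)
next
  assume s: "sim x y"
  have "q x \<subseteq> q y" if "sim x y" for x y
  proof
    fix u assume "u \<in> q x"
    then have "sim u x" using that I_closed(1) by (auto simp: coset_def sim_def)
    then have "sim u y" using that sim_trans by blast
    then show "u \<in> q y" by (auto simp: coset_def sim_def)
  qed
  then show "q x = q y" using s sim_sym by blast
qed

lemma rep_sim: "x \<in> acar A \<Longrightarrow> sim (rep (q x)) x"
proof -
  assume x: "x \<in> acar A"
  have "x \<in> q x" using x I_closed(2) by (auto simp: coset_def intro!: exI[of _ "\<zero>"])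
  then have "rep (q x) \<in> q x" unfolding rep_def by (rule someI)
  then show ?thesis using x I_closed(1) by (auto simp: coset_def sim_def)
qed

lemma sim_acar: "sim x y \<Longrightarrow> x \<in> acar A" "sim x y \<Longrightarrow> y \<in> acar A"
  by (auto simp: sim_def)

lemma q_add: "x \<in> acar A \<Longrightarrow> y \<in> acar A \<Longrightarrow> aadd Q (q x) (q y) = q (x \<oplus> y)"
  by (simp add: quot_def q_eq_iff rep_sim[THEN sim_acar(1)] sim_add rep_sim)

lemma q_smul: "x \<in> acar A \<Longrightarrow> asmul Q k (q x) = q (k \<odot> x)"
  by (simp add: quot_def q_eq_iff rep_sim[THEN sim_acar(1)] sim_smul rep_sim)

lemma q_zero: "azero Q = q \<zero>"
  by (simp add: quot_def)

lemma acomp_Q: "acomp Q d = q ` acomp A d"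
  by (simp add: quot_def)

text \<open>The arguments are exchanged from left to right, with \<open>us\<close> holding those
  already treated. One exchange changes the value by an operation applied to a list with an entry in
  \<open>I\<close>, which lies in \<open>I\<close> again.\<close>

lemma amu_sim:
  assumes "list_all2 sim xs ys" "set us \<subseteq> acar A" "n = length us + length xs" "1 \<le> n"
  shows "sim (amu A n (us @ xs)) (amu A n (us @ ys))"
  using assms
proof (induction xs ys arbitrary: us rule: list_all2_induct)
  case Nil
  then show ?case by (auto intro!: sim_refl amu_closed)
next
  case (Cons x xs y ys)
  have a: "x \<in> acar A" "y \<in> acar A" "set xs \<subseteq> acar A"
    using Cons.hyps by (auto simp: sim_def list_all2_conv_all_nth in_set_conv_nth)
  obtain i where i: "i \<in> I" "x = y \<oplus> i" using Cons.hyps(1) by (auto simp: sim_def)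
  have n: "n = length us + 1 + length xs" using Cons.prems by simp
  have "amu A n (us @ [y \<oplus> i] @ xs) = amu A n (us @ [y] @ xs) \<oplus> amu A n (us @ [i] @ xs)"
    using Cons.prems a i I_closed(1) n by (intro amu_add) auto
  moreover have "amu A n (us @ [i] @ xs) \<in> I"
    using Cons.prems a i I_closed(1) n by (intro ideal_amu[of _ _ i]) auto
  moreover have "amu A n (us @ [y] @ xs) \<in> acar A"
    using Cons.prems a n by (intro amu_closed) auto
  ultimately have "sim (amu A n (us @ x # xs)) (amu A n (us @ y # xs))"
    using I_closed(1) by (auto simp: sim_def i(2))
  moreover have "sim (amu A n ((us @ [y]) @ xs)) (amu A n ((us @ [y]) @ ys))"
    using Cons.prems a by (intro Cons.IH) auto
  ultimately show ?case using sim_trans by simp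
qed

lemma amu_Q:
  assumes "set xs \<subseteq> acar A" "xs \<noteq> []"
  shows "amu Q (length xs) (map q xs) = q (amu A (length xs) xs)"
proof -
  have "list_all2 sim (map rep (map q xs)) xs"
    using assms(1) rep_sim by (simp add: list_all2_conv_all_nth subset_eq)
  then have "sim (amu A (length xs) ([] @ map rep (map q xs))) (amu A (length xs) ([] @ xs))"
    using assms(2) by (intro amu_sim) (auto simp: Suc_le_eq)
  then show ?thesis using sim_acar by (simp add: quot_def q_eq_iff)
qed

section \<open>The induced map of complexes\<close>

lemma word_map_simps [simp]: "word_map f [] = []" "word_map f (l # w) = (fst l, f (snd l)) # word_map f w"
  "word_map f (u @ w) = word_map f u @ word_map f w" "length (word_map f w) = length w" "sdeg (word_map f w) = sdeg w"
  "word_map f w = [] \<longleftrightarrow> w = []" "word_map f (take n w) = take n (word_map f w)" "word_map f (drop n w) = drop n (word_map f w)"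
  by (simp_all add: word_map_def take_map drop_map sdeg_def comp_def split_def)

lemma sdeg_take_drop_word_map [simp]:
  "sdeg (take n (word_map f w)) = sdeg (take n w)" "sdeg (drop n (word_map f w)) = sdeg (drop n w)"
  by (metis word_map_simps(5,7), metis word_map_simps(5,8))

lemma map_snd_word_map: "map snd (word_map f w) = map f (map snd w)"
  by (simp add: word_map_def split_def)

lemma word_map_valid: "valid A w \<Longrightarrow> valid Q (word_map q w)"
  by (induction w) (auto simp: acomp_Q)

definition proj :: "('v, 'k) chain \<Rightarrow> ('v set word \<Rightarrow>\<^sub>0 'k)" where
  "proj = lin (\<lambda>w. gen (word_map q w))"

lemma lmap_proj: "lmap proj"
  by (simp add: proj_def lmap_lin)

lemmas proj_simps = lmap_simps[OF lmap_proj]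

lemma proj_gen: "proj (gen w) = gen (word_map q w)"
  by (simp add: proj_def)

lemma chain_map_proj: "chain_map q x = (\<lambda>p. proj (x p))"
  by (simp add: chain_map_def proj_def)

lemma proj_trel: "p \<in> trel A \<Longrightarrow> proj p \<in> trel Q"
proof (erule lmap_trel[OF _ lmap_proj lspace_trel])
  fix us ws a c d assume v: "valid A us" "valid A ws" "a \<in> acomp A d" "c \<in> acomp A d"
  have "gen (word_map q us @ [(d, aadd Q (q a) (q c))] @ word_map q ws) - gen (word_map q us @ [(d, q a)] @ word_map q ws) -
      gen (word_map q us @ [(d, q c)] @ word_map q ws) \<in> trel Q"
    using v by (intro trel.trel_add) (auto simp: word_map_valid acomp_Q)
  then show "proj (gen (us @ [(d, a \<oplus> c)] @ ws)) - proj (gen (us @ [(d, a)] @ ws)) - proj (gen (us @ [(d, c)] @ ws)) \<in> trel Q"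
    using v by (simp add: proj_gen q_add acomp_acar)
next
  fix us ws a k d assume v: "valid A us" "valid A ws" "a \<in> acomp A d"
  have "gen (word_map q us @ [(d, asmul Q k (q a))] @ word_map q ws) - psc k (gen (word_map q us @ [(d, q a)] @ word_map q ws)) \<in> trel Q"
    using v by (intro trel.trel_smul) (auto simp: word_map_valid acomp_Q)
  then show "proj (gen (us @ [(d, k \<odot> a)] @ ws)) - psc k (proj (gen (us @ [(d, a)] @ ws))) \<in> trel Q"
    using v by (simp add: proj_gen q_smul acomp_acar)
qed

lemma proj_rot_gen: "proj (rot z (gen w)) = rot z (proj (gen w))"
  by (simp add: proj_gen rot_gen rot_w_def Let_def proj_simps)

lemma proj_rot: "proj (rot z x) = rot z (proj x)"
  by (rule lmap_eqI[of "\<lambda>x. proj (rot z x)" "\<lambda>x. rot z (proj x)"])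
    (simp_all add: proj_rot_gen lmap_compose lmap_proj lmap_rot)

lemma proj_front_gen:
  assumes w: "valid A w"
  shows "proj (front A j (gen w)) = front Q j (proj (gen w))"
proof (cases "1 \<le> j \<and> j \<le> length w")
  case True
  define u v where "u = take j w" and "v = drop j w"
  have uv: "w = u @ v" "length u = j" using True by (auto simp: u_def v_def)
  then have ne: "u \<noteq> []" using True by auto
  have ne': "word_map q u \<noteq> []" using ne by simp
  have "set (map snd u) \<subseteq> acar A" using valid_acar w uv by simp
  then have "block_out Q (word_map q u) = (fst (block_out A u), q (snd (block_out A u)))"
    using amu_Q[of "map snd u"] ne by (simp add: block_out_def map_snd_word_map)
  then show ?thesis
    using front_app[OF ne, of A v] front_app[OF ne', of Q "word_map q v"]
    by (simp add: proj_gen uv proj_simps)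
qed (auto simp: front_def front_w_def proj_gen proj_simps)


lemma validsp_eqI:
  assumes "x \<in> validsp" "lmap f" "lmap g" "\<And>w. valid A w \<Longrightarrow> f (gen w) = g (gen w)"
  shows "f x = g x"
  by (rule lmap_eqI[OF assms(2,3)]) (use assms(1,4) in \<open>auto simp: validsp_def\<close>)

lemma proj_front: "x \<in> validsp \<Longrightarrow> proj (front A j x) = front Q j (proj x)"
  by (rule validsp_eqI[of x "\<lambda>x. proj (front A j x)" "\<lambda>x. front Q j (proj x)"])
    (assumption | rule proj_front_gen lmap_compose[OF lmap_proj lmap_front] lmap_compose[OF lmap_front lmap_proj])+

lemma gen_validsp: "valid A w \<Longrightarrow> gen w \<in> validsp"
  by (simp add: validsp_def)

lemma rot_validsp: "x \<in> validsp \<Longrightarrow> rot z x \<in> validsp"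
  by (erule validsp_lmapI[OF _ lmap_rot lspace_validsp])
    (auto simp: rot_gen rot_w_def Let_def valid_take_drop intro!: lspace_psc[OF lspace_validsp] gen_validsp)

lemma proj_rbr: "valid A w \<Longrightarrow> proj (rot a (front A j (rot z (gen w)))) = rot a (front Q j (rot z (proj (gen w))))"
  by (simp add: proj_rot proj_front rot_validsp gen_validsp)

lemma proj_bb: "x \<in> validsp \<Longrightarrow> proj (bb A x) = bb Q (proj x)"
proof (rule validsp_eqI[of x "\<lambda>x. proj (bb A x)" "\<lambda>x. bb Q (proj x)"])
  show "proj (bb A (gen w)) = bb Q (proj (gen w))" if "valid A w" for w
    using that by (simp add: b_w_rot proj_simps proj_rbr) (simp add: proj_gen b_w_rot)
qed (assumption | rule lmap_compose[OF lmap_proj lmap_lin] lmap_compose[OF lmap_lin lmap_proj])+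

lemma proj_bp: "x \<in> validsp \<Longrightarrow> proj (bp A x) = bp Q (proj x)"
proof (rule validsp_eqI[of x "\<lambda>x. proj (bp A x)" "\<lambda>x. bp Q (proj x)"])
  show "proj (bp A (gen w)) = bp Q (proj (gen w))" if "valid A w" for w
    using that by (simp add: bprime_w_rot proj_simps proj_rbr) (simp add: proj_gen bprime_w_rot)
qed (assumption | rule lmap_compose[OF lmap_proj lmap_lin] lmap_compose[OF lmap_lin lmap_proj])+

lemma proj_N: "proj (lin N_w x) = lin N_w (proj x)"
proof (rule lmap_eqI[of "\<lambda>x. proj (lin N_w x)" "\<lambda>x. lin N_w (proj x)"])
  show "proj (lin N_w (gen w)) = lin N_w (proj (gen w))" for w
    by (simp add: N_w_rot proj_simps proj_rot) (simp add: proj_gen N_w_rot)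
qed (rule lmap_compose[OF lmap_proj lmap_lin] lmap_compose[OF lmap_lin lmap_proj])+

lemma proj_lam: "proj (lin lam_w x) = lin lam_w (proj x)"
proof (rule lmap_eqI[of "\<lambda>x. proj (lin lam_w x)" "\<lambda>x. lin lam_w (proj x)"])
  show "proj (lin lam_w (gen w)) = lin lam_w (proj (gen w))" for w
    by (cases "w = []") (simp_all add: lam_w_eq proj_rot proj_gen, simp add: lam_w_def proj_simps)
qed (rule lmap_compose[OF lmap_proj lmap_lin] lmap_compose[OF lmap_lin lmap_proj])+

lemma proj_totdiff: "(\<And>p. x p \<in> validsp) \<Longrightarrow> proj (totdiff A x p) = totdiff Q (\<lambda>p. proj (x p)) p"
  by (cases "even p") (simp_all add: totdiff_even totdiff_odd proj_simps proj_bb proj_bp proj_N proj_lam)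

lemma proj_chainsp: "x \<in> chainsp A s \<Longrightarrow> proj x \<in> chainsp Q s"
  by (erule chainsp_lmapI[OF _ lmap_proj lspace_chainsp]) (simp add: proj_gen word_map_valid)

lemma zero_letter_Q:
  assumes "valid Q us" "valid Q ws" shows "gen (us @ (d, azero Q) # ws) \<in> trel Q"
proof -
  have "azero Q \<in> acomp Q d" by (simp add: acomp_Q q_zero)
  moreover have "asmul Q 0 (azero Q) = azero Q" by (simp add: q_zero q_smul)
  ultimately show ?thesis using trel.trel_smul[OF assms, of "azero Q" d 0] by simp
qed

section \<open>The kernel of the induced map\<close>

lemma proj_Fk1: "p \<in> Cfilt 1 \<Longrightarrow> proj p \<in> trel Q"
proof (erule lmap_Cfilt[OF _ lmap_proj lspace_trel proj_trel])
  fix ks w assume w: "weighted ks w" "1 \<le> sum_list ks"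
  then obtain d x where x: "(d, x) \<in> set w" "x \<in> I" using weighted_ideal by fastforce
  then obtain us ws where w': "w = us @ (d, x) # ws" by (meson split_list)
  have "sim x \<zero>" using x(2) I_closed(1) by (auto simp: sim_def)
  then have "q x = azero Q" using sim_acar by (simp add: q_zero q_eq_iff)
  then show "proj (gen w) \<in> trel Q"
    using weighted_valid[OF w(1)] by (simp add: proj_gen w' zero_letter_Q word_map_valid)
qed

text \<open>The representatives chosen by \<open>rep\<close> need not be homogeneous, so a lift
  within the given degree is chosen separately.\<close>

definition lift :: "nat \<times> 'v set \<Rightarrow> nat \<times> 'v" where
  "lift l = (fst l, SOME a. a \<in> acomp A (fst l) \<and> q a = snd l)"

lemma lift: "X \<in> acomp Q d \<Longrightarrow> snd (lift (d, X)) \<in> acomp A d \<and> q (snd (lift (d, X))) = X"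
proof -
  assume "X \<in> acomp Q d"
  then obtain a where "a \<in> acomp A d \<and> q a = X" by (auto simp: acomp_Q)
  then have "(SOME a. a \<in> acomp A d \<and> q a = X) \<in> acomp A d \<and> q (SOME a. a \<in> acomp A d \<and> q a = X) = X"
    by (rule someI)
  then show ?thesis by (simp add: lift_def)
qed

lemma fst_lift [simp]: "fst (lift l) = fst l"
  by (simp add: lift_def)

lemma lift_word: "valid Q w \<Longrightarrow> valid A (map lift w) \<and> word_map q (map lift w) = w"
  by (induction w) (auto simp: lift)

lemma sdeg_lift [simp]: "sdeg (map lift w) = sdeg w"
  by (induction w) auto

text \<open>The chosen lifts are not linear, so this section of \<open>proj\<close> respects the
  relations only up to \<open>Cfilt 1\<close>. That is enough to determine the kernel of
  \<open>proj\<close> on tensor powers without choosing bases.\<close>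

definition secmap :: "('v set word \<Rightarrow>\<^sub>0 'k) \<Rightarrow> ('v, 'k) chain" where
  "secmap = lin (\<lambda>w. gen (map lift w))"

lemma lmap_secmap: "lmap secmap"
  by (simp add: secmap_def lmap_lin)

lemma secmap_gen: "secmap (gen w) = gen (map lift w)"
  by (simp add: secmap_def)

lemma proj_secmap: "x \<in> chainsp Q s \<Longrightarrow> proj (secmap x) = x"
proof (rule lmap_eqI[of "\<lambda>x. proj (secmap x)" "\<lambda>x. x"])
  show "proj (secmap (gen w)) = gen w" if "x \<in> chainsp Q s" "w \<in> Poly_Mapping.keys x" for w
    using that lift_word[of w] by (auto simp: secmap_gen proj_gen chainsp_def)
qed (rule lmap_compose[OF lmap_proj lmap_secmap] lmap_id)+

lemma secmap_chainsp: "x \<in> chainsp Q s \<Longrightarrow> secmap x \<in> chainsp A s"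
  by (erule chainsp_lmapI[OF _ lmap_secmap lspace_chainsp]) (simp add: secmap_gen lift_word)

text \<open>Two lifts in the same degree differ by an element of \<open>I\<close> of that degree,
  and such a letter has weight 1 by \<open>Lfilt_1\<close>.\<close>

lemma letter_sim_Fk1:
  assumes v: "valid A us" "valid A ws" and a: "a \<in> acomp A d" "b \<in> acomp A d" "q a = q b"
  shows "congr (Cfilt 1) (gen (us @ (d, a) # ws)) (gen (us @ (d, b) # ws))"
proof -
  define i where "i = a \<oplus> (- 1) \<odot> b"
  have ac: "a \<in> acar A" "b \<in> acar A" using a acomp_acar by auto
  have "sim a b" using a ac by (simp add: q_eq_iff)
  then obtain j where j: "j \<in> I" "a = b \<oplus> j" by (auto simp: sim_def)
  have "i = j" using j ac I_closed(1) by (simp add: i_def vadd_comm[of b j] vadd_assoc)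
  moreover have "i \<in> acomp A d" using a by (simp add: i_def)
  ultimately have i: "i \<in> Lfilt 1 d" "i \<in> acomp A d" "a = b \<oplus> i" using j Lfilt_1[of d] by auto
  have "weighted (replicate (length us) 0 @ 1 # replicate (length ws) 0) (us @ (d, i) # ws)"
    using v i weighted_zero_weight by (simp add: weighted_append)
  then have "gen (us @ (d, i) # ws) \<in> Cfilt 1" by (rule Cfilt_gen) simp
  moreover have "gen (us @ [(d, b \<oplus> i)] @ ws) - gen (us @ [(d, b)] @ ws) - gen (us @ [(d, i)] @ ws) \<in> Cfilt 1"
    using v a i by (intro Cfilt_trel trel.trel_add)
  ultimately have "(gen (us @ [(d, b \<oplus> i)] @ ws) - gen (us @ [(d, b)] @ ws) - gen (us @ [(d, i)] @ ws)) + gen (us @ (d, i) # ws) \<in> Cfilt 1"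
    by (intro Cfilt_plus)
  then show ?thesis by (simp add: congr_def i(3))
qed

lemma word_sim_Fk1:
  assumes "valid A us" "valid A w" "valid A w'" "word_map q w = word_map q w'"
  shows "congr (Cfilt 1) (gen (us @ w)) (gen (us @ w'))"
  using assms
proof (induction w arbitrary: us w')
  case Nil
  then have "w' = []" by (metis word_map_simps(1,6))
  then show ?case by (simp add: congr_refl lspace_Cfilt)
next
  case (Cons l w)
  then obtain l' u where w': "w' = l' # u" by (cases w') auto
  obtain d a b where l: "l = (d, a)" "l' = (d, b)" using Cons.prems w' by (cases l; cases l') auto
  have "congr (Cfilt 1) (gen (us @ (d, a) # w)) (gen (us @ (d, b) # w))"
    using Cons.prems l w' by (intro letter_sim_Fk1) auto
  moreover have "congr (Cfilt 1) (gen ((us @ [(d, b)]) @ w)) (gen ((us @ [(d, b)]) @ u))"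
    using Cons.prems l w' by (intro Cons.IH) auto
  ultimately show ?case using congr_trans[OF lspace_Cfilt] by (fastforce simp: l w')
qed

lemma secmap_proj: "x \<in> validsp \<Longrightarrow> x - secmap (proj x) \<in> Cfilt 1"
proof (erule validsp_lmapI[where f = "\<lambda>x. x - secmap (proj x)", OF _ _ lspace_Cfilt])
  show "lmap (\<lambda>x. x - secmap (proj x))"
    by (intro lmap_comb(2) lmap_id lmap_compose[OF lmap_secmap lmap_proj])
  show "gen w - secmap (proj (gen w)) \<in> Cfilt 1" if "valid A w" for w
    using word_sim_Fk1[of "[]" w "map lift (word_map q w)"] lift_word[OF word_map_valid[OF that]] that
    by (simp add: congr_def secmap_gen proj_gen)
qed

lemma secmap_trel: "p \<in> trel Q \<Longrightarrow> secmap p \<in> Cfilt 1"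
proof (erule lmap_trel[OF _ lmap_secmap lspace_Cfilt])
  fix us ws X Y d assume v: "valid Q us" "valid Q ws" "X \<in> acomp Q d" "Y \<in> acomp Q d"
  let ?w = "\<lambda>a. map lift us @ (d, a) # map lift ws"
  define a b c where "a = snd (lift (d, X))" and "b = snd (lift (d, Y))" and "c = snd (lift (d, aadd Q X Y))"
  have ab: "a \<in> acomp A d" "b \<in> acomp A d" "q a = X" "q b = Y" using lift v by (simp_all add: a_def b_def)
  have XY: "aadd Q X Y = q (a \<oplus> b)" using ab acomp_acar q_add by metis
  then have "aadd Q X Y \<in> acomp Q d" using ab by (simp add: acomp_Q)
  then have c: "c \<in> acomp A d" "q c = q (a \<oplus> b)" using lift XY by (simp_all add: c_def)
  have "congr (Cfilt 1) (gen (?w c)) (gen (?w (a \<oplus> b)))"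
    using ab c v lift_word by (intro letter_sim_Fk1) auto
  moreover have "gen (map lift us @ [(d, a \<oplus> b)] @ map lift ws) - gen (map lift us @ [(d, a)] @ map lift ws) -
      gen (map lift us @ [(d, b)] @ map lift ws) \<in> Cfilt 1"
    using ab v lift_word by (intro Cfilt_trel trel.trel_add) auto
  ultimately have "(gen (?w c) - gen (?w (a \<oplus> b))) + (gen (?w (a \<oplus> b)) - gen (?w a) - gen (?w b)) \<in> Cfilt 1"
    by (intro Cfilt_plus) (simp_all add: congr_def)
  moreover have "lift (d, X) = (d, a)" "lift (d, Y) = (d, b)" "lift (d, aadd Q X Y) = (d, c)"
    by (simp_all add: a_def b_def c_def prod_eq_iff)
  ultimately show "secmap (gen (us @ [(d, aadd Q X Y)] @ ws)) - secmap (gen (us @ [(d, X)] @ ws)) - secmap (gen (us @ [(d, Y)] @ ws)) \<in> Cfilt 1"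
    by (simp add: secmap_gen algebra_simps)
next
  fix us ws X k d assume v: "valid Q us" "valid Q ws" "X \<in> acomp Q d"
  let ?w = "\<lambda>a. map lift us @ (d, a) # map lift ws"
  define a c where "a = snd (lift (d, X))" and "c = snd (lift (d, asmul Q k X))"
  have ab: "a \<in> acomp A d" "q a = X" using lift v by (simp_all add: a_def)
  have XY: "asmul Q k X = q (k \<odot> a)" using ab acomp_acar q_smul by metis
  then have "asmul Q k X \<in> acomp Q d" using ab by (simp add: acomp_Q)
  then have c: "c \<in> acomp A d" "q c = q (k \<odot> a)" using lift XY by (simp_all add: c_def)
  have "congr (Cfilt 1) (gen (?w c)) (gen (?w (k \<odot> a)))"
    using ab c v lift_word by (intro letter_sim_Fk1) auto
  moreover have "gen (map lift us @ [(d, k \<odot> a)] @ map lift ws) - psc k (gen (map lift us @ [(d, a)] @ map lift ws)) \<in> Cfilt 1"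
    using ab v lift_word by (intro Cfilt_trel trel.trel_smul) auto
  ultimately have "(gen (?w c) - gen (?w (k \<odot> a))) + (gen (?w (k \<odot> a)) - psc k (gen (?w a))) \<in> Cfilt 1"
    by (intro Cfilt_plus) (simp_all add: congr_def)
  moreover have "lift (d, X) = (d, a)" "lift (d, asmul Q k X) = (d, c)"
    by (simp_all add: a_def c_def prod_eq_iff)
  ultimately show "secmap (gen (us @ [(d, asmul Q k X)] @ ws)) - psc k (secmap (gen (us @ [(d, X)] @ ws))) \<in> Cfilt 1"
    by (simp add: secmap_gen)
qed

text \<open>With \<open>proj_Fk1\<close> this identifies the kernel with \<open>Cfilt 1\<close>, the
  complex treated in \<open>acyclic\<close>.\<close>

lemma proj_kernel:
  assumes x: "x \<in> validsp" and p: "proj x \<in> trel Q" shows "x \<in> Cfilt 1"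
proof -
  have "(x - secmap (proj x)) + secmap (proj x) \<in> Cfilt 1" by (intro Cfilt_plus secmap_proj x secmap_trel p)
  then show ?thesis by simp
qed

lemma chainsp_nonemptysp: "x \<in> chainsp A s \<Longrightarrow> x \<in> nonemptysp" and chainsp_degsp: "x \<in> chainsp A s \<Longrightarrow> x \<in> degsp s"
  and chspI: "x \<in> nonemptysp \<Longrightarrow> x \<in> degsp s \<Longrightarrow> x \<in> chainsp A s"
  by (auto simp: chainsp_def nonemptysp_def degsp_def)

lemma front_validsp: "x \<in> validsp \<Longrightarrow> front A j x \<in> validsp"
proof (erule validsp_lmapI[OF _ lmap_front lspace_validsp])
  fix w assume w: "valid A w"
  show "front A j (gen w) \<in> validsp"
  proof (cases "1 \<le> j \<and> j \<le> length w")
    case True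
    define u v where "u = take j w" and "v = drop j w"
    have uv: "w = u @ v" "length u = j" using True by (auto simp: u_def v_def)
    then have ne: "u \<noteq> []" using True by auto
    then show ?thesis
      using front_app[OF ne, of A v] uv w block_out_comp[of u] by (auto simp: lspace_0[OF lspace_validsp] intro!: gen_validsp)
  qed (auto simp: front_def front_w_def lspace_0[OF lspace_validsp])
qed

lemma bb_validsp: "x \<in> validsp \<Longrightarrow> bb A x \<in> validsp"
  by (erule validsp_lmapI[OF _ lmap_lin lspace_validsp])
    (auto simp: b_w_rot intro!: lspace_sum[OF lspace_validsp] rot_validsp front_validsp gen_validsp)

lemma bp_validsp: "x \<in> validsp \<Longrightarrow> bp A x \<in> validsp"
  by (erule validsp_lmapI[OF _ lmap_lin lspace_validsp])
    (auto simp: bprime_w_rot intro!: lspace_sum[OF lspace_validsp] rot_validsp front_validsp gen_validsp)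

lemma N_validsp: "x \<in> validsp \<Longrightarrow> lin N_w x \<in> validsp"
  by (erule validsp_lmapI[OF _ lmap_lin lspace_validsp])
    (auto simp: N_w_rot intro!: lspace_sum[OF lspace_validsp] rot_validsp gen_validsp)

lemma lam_validsp: "x \<in> validsp \<Longrightarrow> lin lam_w x \<in> validsp"
proof (erule validsp_lmapI[OF _ lmap_lin lspace_validsp])
  show "lin lam_w (gen w) \<in> validsp" if "valid A w" for w
    using that by (cases "w = []") (simp_all add: lam_w_eq rot_validsp gen_validsp, simp add: lam_w_def lspace_0[OF lspace_validsp])
qed

lemma totdiff_validsp: "(\<And>p. x p \<in> validsp) \<Longrightarrow> totdiff A x p \<in> validsp"
  by (cases "even p") (auto simp: totdiff_even totdiff_odd intro!: lspace_add[OF lspace_validsp] lspace_diff[OF lspace_validsp] bb_validsp bp_validsp lam_validsp N_validsp)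

lemma cyclesD: "x \<in> cycles A t \<Longrightarrow> x p \<in> chainsp A (t - p)" "x \<in> cycles A t \<Longrightarrow> totdiff A x p \<in> trel A"
  by (auto simp: cycles_def chains_iff)

section \<open>The induced map on homology\<close>

lemma chain_map_cycles:
  assumes x: "x \<in> cycles A t" shows "chain_map q x \<in> cycles Q t"
proof -
  have v: "x p \<in> validsp" for p by (rule nonemptysp_validsp[OF chainsp_nonemptysp[OF cyclesD(1)[OF x]]])
  have "totdiff Q (\<lambda>p. proj (x p)) p \<in> trel Q" for p
    using proj_trel[OF cyclesD(2)[OF x]] proj_totdiff[of x, OF v] by metis
  then show ?thesis
    using proj_chainsp[OF cyclesD(1)[OF x]] by (simp add: cycles_def chains_iff chain_map_proj)
qed

lemma chain_map_homologous: "(x, y) \<in> homologous A t \<Longrightarrow> (chain_map q x, chain_map q y) \<in> homologous Q t"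
proof -
  assume "(x, y) \<in> homologous A t"
  then obtain z where "x \<in> cycles A t" "y \<in> cycles A t" "\<forall>p. z p \<in> chainsp A (t + 1 - p)"
    "\<forall>p. x p - y p - totdiff A z p \<in> trel A" by (auto simp: homologous_def chains_iff)
  then have z: "x \<in> cycles A t" "y \<in> cycles A t" "\<And>p. z p \<in> chainsp A (t + 1 - p)"
    "\<And>p. x p - y p - totdiff A z p \<in> trel A" by auto
  have "proj (x p) - proj (y p) - totdiff Q (\<lambda>p. proj (z p)) p \<in> trel Q" for p
    using proj_trel[OF z(4)[of p]] proj_totdiff[of z] nonemptysp_validsp[OF chainsp_nonemptysp[OF z(3)]] by (simp add: proj_simps)
  moreover have "(\<lambda>p. proj (z p)) \<in> chains Q (t + 1)" using z(3) by (simp add: chains_iff proj_chainsp)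
  ultimately show ?thesis
    using chain_map_cycles z(1,2) by (auto simp: homologous_def chain_map_proj)
qed

text \<open>The long exact sequence is replaced by a direct chase: a primitive in the quotient is
  lifted, its defect is a cycle in the kernel, and \<open>acyclic\<close> supplies the
  correction.\<close>

lemma chain_map_homologous_inj:
  assumes x: "x \<in> cycles A t" and y: "y \<in> cycles A t" and h: "(chain_map q x, chain_map q y) \<in> homologous Q t"
  shows "(x, y) \<in> homologous A t"
proof -
  obtain z where "\<forall>p. z p \<in> chainsp Q (t + 1 - p)" "\<forall>p. proj (x p) - proj (y p) - totdiff Q z p \<in> trel Q"
    using h by (auto simp: homologous_def chains_iff chain_map_proj)
  then have z: "\<And>p. z p \<in> chainsp Q (t + 1 - p)" "\<And>p. proj (x p) - proj (y p) - totdiff Q z p \<in> trel Q" by auto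
  define s where "s p = secmap (z p)" for p
  have s: "s p \<in> chainsp A (t + 1 - p)" "proj (s p) = z p" for p
    using secmap_chainsp[OF z(1)] proj_secmap[OF z(1)] by (simp_all add: s_def)
  have sv: "s p \<in> validsp" for p using nonemptysp_validsp[OF chainsp_nonemptysp[OF s(1)]] .
  define u where "u p = x p - y p - totdiff A s p" for p
  have uv: "u p \<in> validsp" for p
    unfolding u_def using cyclesD(1) x y
    by (intro lspace_diff[OF lspace_validsp] totdiff_validsp sv nonemptysp_validsp[OF chainsp_nonemptysp]) blast+
  have "proj (u p) \<in> trel Q" for p
    using z(2)[of p] by (simp add: u_def proj_simps proj_totdiff[OF sv] s(2))
  then have u1: "u p \<in> Cfilt 1" for p by (rule proj_kernel[OF uv])
  have uC: "u p \<in> degsp (t - p)" for p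
    unfolding u_def using totdiff_degsp[of s "t + 1" A p] s(1) cyclesD(1) x y
    by (intro lspace_diff[OF lspace_degsp]) (auto intro: chainsp_degsp)
  have "totdiff A u p \<in> trel A" for p
    unfolding u_def totdiff_diff using chainsp_nonemptysp[OF s(1)]
    by (intro lspace_diff[OF lspace_trel] cyclesD(2)[OF x] cyclesD(2)[OF y] totdiff_totdiff)
  then obtain w where w: "\<And>p. w p \<in> Cfilt 1" "\<And>p. w p \<in> degsp (t + 1 - p)" "\<And>p. u p - totdiff A w p \<in> trel A"
    using acyclic[OF u1 uC] by blast
  have "(\<lambda>p. s p + w p) \<in> chains A (t + 1)"
    using s(1) w Cfilt_nonemptysp[of "w _" 1] by (simp add: chains_iff lspace_add[OF lspace_chainsp] chspI)
  moreover have "x p - y p - totdiff A (\<lambda>p. s p + w p) p \<in> trel A" for p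
    using w(3)[of p] by (simp add: totdiff_add u_def algebra_simps)
  ultimately show ?thesis using x y by (auto simp: homologous_def)
qed

text \<open>The differential of a lifted cycle is a cycle in the kernel, hence the differential of
  some \<open>w\<close> in the kernel. Subtracting \<open>w\<close> makes the lift a cycle and
  changes its image only by relations.\<close>

lemma chain_map_homologous_surj:
  assumes y: "y \<in> cycles Q t"
  obtains x where "x \<in> cycles A t" "(chain_map q x, y) \<in> homologous Q t"
proof -
  have yc: "y p \<in> chainsp Q (t - p)" "totdiff Q y p \<in> trel Q" for p
    using y by (auto simp: cycles_def chains_iff)
  define s where "s p = secmap (y p)" for p
  have s: "s p \<in> chainsp A (t - p)" "proj (s p) = y p" for p
    using secmap_chainsp[OF yc(1)] proj_secmap[OF yc(1)] by (simp_all add: s_def)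
  have sn: "s p \<in> nonemptysp" for p using chainsp_nonemptysp[OF s(1)] .
  have sv: "s p \<in> validsp" for p using nonemptysp_validsp[OF sn] .
  have u1: "totdiff A s p \<in> Cfilt 1" for p
    using yc(2)[of p] by (intro proj_kernel totdiff_validsp sv) (simp add: proj_totdiff[OF sv] s(2))
  have uC: "totdiff A s p \<in> degsp (t - 1 - p)" for p
    by (rule totdiff_degsp) (rule chainsp_degsp[OF s(1)])
  obtain w where w: "\<And>p. w p \<in> Cfilt 1" "\<And>p. w p \<in> degsp (t - 1 + 1 - p)" "\<And>p. totdiff A s p - totdiff A w p \<in> trel A"
    using acyclic[OF u1 uC totdiff_totdiff[OF sn]] by blast
  define x where "x p = s p - w p" for p
  have "x p \<in> chainsp A (t - p)" for p
    unfolding x_def using w(1,2)[of p] Cfilt_nonemptysp[of "w p" 1]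
    by (intro lspace_diff[OF lspace_chainsp s(1)] chspI) simp_all
  then have x: "x \<in> cycles A t"
    using w(3) unfolding x_def cycles_def chains_iff by (simp add: totdiff_diff)
  have "proj (x p) - y p - totdiff Q (\<lambda>_. 0) p \<in> trel Q" for p
    using lspace_minus[OF lspace_trel proj_Fk1[OF w(1)[of p]]] by (simp add: x_def proj_simps s(2) totdiff_0)
  moreover have "(\<lambda>_. 0) \<in> chains Q (t + 1)" by (simp add: chains_iff lspace_0[OF lspace_chainsp])
  ultimately have "(chain_map q x, y) \<in> homologous Q t"
    using chain_map_cycles[OF x] y by (auto simp: homologous_def chain_map_proj)
  then show thesis using x that by blast
qed

text \<open>\<open>HP_map\<close> evaluates at an arbitrarily chosen representative; homologous
  cycles have homologous images, so any other representative gives the same class.\<close>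

lemma HP_map_class:
  assumes x: "x \<in> cycles A t"
  shows "HP_map Q t q (homologous A t `` {x}) = homologous Q t `` {chain_map q x}"
proof -
  define x' where "x' = (SOME x'. x' \<in> homologous A t `` {x})"
  have "x' \<in> homologous A t `` {x}"
    unfolding x'_def by (rule someI[of _ x]) (use homologous_refl[OF x] in simp)
  then have "(chain_map q x, chain_map q x') \<in> homologous Q t"
    by (intro chain_map_homologous) simp
  then show ?thesis
    unfolding HP_map_def x'_def[symmetric] using equiv_class_eq[OF equiv_homologous] by metis
qed

lemma HP_map_bij: "bij_betw (HP_map Q t q) (HP A t) (HP Q t)"
  unfolding bij_betw_def
proof
  show "inj_on (HP_map Q t q) (HP A t)"
  proof (rule inj_onI)
    fix X Y assume "X \<in> HP A t" "Y \<in> HP A t" and eq: "HP_map Q t q X = HP_map Q t q Y"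
    then obtain x y where x: "x \<in> cycles A t" "X = homologous A t `` {x}" and y: "y \<in> cycles A t" "Y = homologous A t `` {y}"
      unfolding HP_def by (auto elim!: quotientE)
    have "(chain_map q x, chain_map q y) \<in> homologous Q t"
      using eq x y chain_map_cycles by (simp add: HP_map_class eq_equiv_class_iff[OF equiv_homologous])
    then have "(x, y) \<in> homologous A t" by (rule chain_map_homologous_inj[OF x(1) y(1)])
    then show "X = Y" using x y equiv_class_eq[OF equiv_homologous] by metis
  qed
  show "HP_map Q t q ` HP A t = HP Q t"
  proof (intro equalityI subsetI)
    fix Y assume "Y \<in> HP_map Q t q ` HP A t"
    then show "Y \<in> HP Q t"
      unfolding HP_def using HP_map_class chain_map_cycles by (auto elim!: quotientE intro!: quotientI)
  next
    fix Y assume "Y \<in> HP Q t"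
    then obtain y where y: "y \<in> cycles Q t" "Y = homologous Q t `` {y}"
      unfolding HP_def by (auto elim!: quotientE)
    obtain x where x: "x \<in> cycles A t" "(chain_map q x, y) \<in> homologous Q t"
      using chain_map_homologous_surj[OF y(1)] by blast
    have "Y = HP_map Q t q (homologous A t `` {x})"
      using x y HP_map_class equiv_class_eq[OF equiv_homologous] by metis
    then show "Y \<in> HP_map Q t q ` HP A t"
      using x unfolding HP_def by (auto intro: quotientI)
  qed
qed

end

theorem theorem4p4:
  fixes A :: "('k::field_char_0, 'v) ainf" and I :: "'v set"
  assumes "ainf_algebra A"
    and "ainf_ideal A I"
    and "I \<inter> acomp A 0 = {azero A}"
  shows "\<forall>t::int. bij_betw (HP_map (quot A I) t (coset A I)) (HP A t) (HP (quot A I) t)"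
proof
  interpret ainfinity_ideal A I
    by unfold_locales (fact assms)+
  show "bij_betw (HP_map (quot A I) t (coset A I)) (HP A t) (HP (quot A I) t)" for t
    by (rule HP_map_bij)
qed

end
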